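(* Let $\mathfrak k$ be a field, $n\ge 1$ an integer, and let $q\in\mathfrak k^*$ be generic (not a root of unity). Let $L_{\mathrm{sh}_{1,n-1}}:H_n(q)\to H_n(q)$, $x\mapsto \mathrm{sh}_{1,n-1}\,x$, be the operator of left multiplication by the additive 1-shuffle. Then the eigenvalues of $L_{\mathrm{sh}_{1,n-1}}$ are among $q^{j-1}[j]_q$ ($=1+q^2+\cdots+q^{2j-2}$ for $j\ge1$, and $0$ for $j=0$), $j=0,1,\dots,n$, and for every $j\in\{0,1,\dots,n\}$ the multiplicity of the eigenvalue $q^{j-1}[j]_q$ is $$d_{n,j}=\frac{n!}{j!}\sum_{i=0}^{n-j}\frac{(-1)^i}{i!},$$ the number of permutations in the symmetric group $\mathbb S_n$ with exactly $j$ fixed points (multiplicity $0$, for $j=n-1$, $n\geq 2$, or for $n=1,j=0$, means that the number is not an eigenvalue).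
   Context: Notation: $[j]_q=(q^j-q^{-j})/(q-q^{-1})$. $H_n(q)$ is the quotient of the group algebra over $\mathfrak k$ of the braid group $B_n$ (generators $\sigma_1,\dots,\sigma_{n-1}$; relations $\sigma_i\sigma_j\sigma_i=\sigma_j\sigma_i\sigma_j$ for $|i-j|=1$, $\sigma_i\sigma_j=\sigma_j\sigma_i$ for $|i-j|>1$) by $\sigma_i^2=(q-q^{-1})\sigma_i+1$; it has dimension $n!$. The additive 1-shuffle is $$\mathrm{sh}_{1,n-1}=1+q\sigma_{n-1}+q^2\sigma_{n-2}\sigma_{n-1}+\cdots+q^{n-1}\sigma_1\sigma_2\cdots\sigma_{n-1}$$ (and $\mathrm{sh}_{1,0}=1$). Multiplicity of an eigenvalue means its multiplicity as a root of the characteristic polynomial. *)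

theory Defs
  imports
    "Jordan_Normal_Form.VS_Connect"
    "Jordan_Normal_Form.Char_Poly"
    "HOL-Algebra.QuotRing"
    "HOL-Combinatorics.Permutations"
begin

hide_const (open) Multiset.mult
hide_const (open) Polynomial.smult
hide_const (open) Modules.module

section \<open>Groups given by generators and relations\<close>

text \<open>The letter \<open>(x, True)\<close> stands for the generator \<open>x\<close> and \<open>(x, False)\<close> for its inverse.\<close>

type_synonym 'g gword = "('g \<times> bool) list"

definition gwords :: "'g set \<Rightarrow> 'g gword set" where
  "gwords X = lists (X \<times> UNIV)"

inductive_set pres_cong :: "'g set \<Rightarrow> ('g gword \<times> 'g gword) set \<Rightarrow> ('g gword \<times> 'g gword) set"
  for X :: "'g set" and R :: "('g gword \<times> 'g gword) set" where
  pres_refl: "u \<in> gwords X \<Longrightarrow> (u, u) \<in> pres_cong X R"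
| pres_sym: "(u, v) \<in> pres_cong X R \<Longrightarrow> (v, u) \<in> pres_cong X R"
| pres_trans: "(u, v) \<in> pres_cong X R \<Longrightarrow> (v, w) \<in> pres_cong X R \<Longrightarrow> (u, w) \<in> pres_cong X R"
| pres_context: "(u, v) \<in> pres_cong X R \<Longrightarrow> a \<in> gwords X \<Longrightarrow> b \<in> gwords X
    \<Longrightarrow> (a @ u @ b, a @ v @ b) \<in> pres_cong X R"
| pres_cancel: "x \<in> X \<Longrightarrow> ([(x, s), (x, \<not> s)], []) \<in> pres_cong X R"
| pres_rel: "(u, v) \<in> R \<Longrightarrow> u \<in> gwords X \<Longrightarrow> v \<in> gwords X \<Longrightarrow> (u, v) \<in> pres_cong X R"

definition presented_group :: "'g set \<Rightarrow> ('g gword \<times> 'g gword) set \<Rightarrow> 'g gword set monoid" where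
  "presented_group X R =
    \<lparr>carrier = gwords X // pres_cong X R,
     mult = (\<lambda>A B. \<Union>u\<in>A. \<Union>v\<in>B. pres_cong X R `` {u @ v}),
     one = pres_cong X R `` {[]}\<rparr>"

section \<open>Group algebras and quotient algebras\<close>

text \<open>A \<open>module\<close> record carries a multiplication besides the scalar multiplication, so it can
  hold an algebra over a field.  Elements of the group algebra are the finitely supported
  functions on the group, with convolution as product.\<close>

definition group_algebra :: "('g, 'b) monoid_scheme \<Rightarrow> ('k::field, 'g \<Rightarrow> 'k) module" where
  "group_algebra G =
    \<lparr>carrier = {f. finite {g. f g \<noteq> 0} \<and> {g. f g \<noteq> 0} \<subseteq> carrier G},
     mult = (\<lambda>f f' g. \<Sum>(h, h') | f h \<noteq> 0 \<and> f' h' \<noteq> 0 \<and> h \<otimes>\<^bsub>G\<^esub> h' = g. f h * f' h'),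
     one = (\<lambda>g. if g = \<one>\<^bsub>G\<^esub> then 1 else 0),
     zero = (\<lambda>g. 0),
     add = (\<lambda>f f' g. f g + f' g),
     smult = (\<lambda>c f g. c * f g)\<rparr>"

definition group_algebra_elem :: "'g \<Rightarrow> 'g \<Rightarrow> 'k::field" where
  "group_algebra_elem g = (\<lambda>h. if h = g then 1 else 0)"

definition quot_algebra :: "('k, 'v, 'm) module_scheme \<Rightarrow> 'v set \<Rightarrow> ('k, 'v set) module" where
  "quot_algebra A I =
    \<lparr>carrier = carrier (A Quot I), mult = mult (A Quot I), one = one (A Quot I),
     zero = zero (A Quot I), add = add (A Quot I),
     smult = (\<lambda>c S. \<Union>x\<in>S. I +>\<^bsub>A\<^esub> (c \<odot>\<^bsub>A\<^esub> x))\<rparr>"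

section \<open>Braid groups and Hecke algebras\<close>

definition braid_relations :: "nat \<Rightarrow> (nat gword \<times> nat gword) set" where
  "braid_relations n =
    {([(i, True), (j, True), (i, True)], [(j, True), (i, True), (j, True)]) | i j.
       i \<in> {1..<n} \<and> j \<in> {1..<n} \<and> \<bar>int i - int j\<bar> = 1}
    \<union> {([(i, True), (j, True)], [(j, True), (i, True)]) | i j.
       i \<in> {1..<n} \<and> j \<in> {1..<n} \<and> \<bar>int i - int j\<bar> > 1}"

definition braid_group :: "nat \<Rightarrow> nat gword set monoid" where
  "braid_group n = presented_group {1..<n} (braid_relations n)"

definition braid_gen :: "nat \<Rightarrow> nat \<Rightarrow> nat gword set" where
  "braid_gen n i = pres_cong {1..<n} (braid_relations n) `` {[(i, True)]}"

definition braid_algebra :: "nat \<Rightarrow> ('k::field, nat gword set \<Rightarrow> 'k) module" where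
  "braid_algebra n = group_algebra (braid_group n)"

definition hecke_ideal :: "nat \<Rightarrow> 'k::field \<Rightarrow> (nat gword set \<Rightarrow> 'k) set" where
  "hecke_ideal n q = Idl\<^bsub>braid_algebra n\<^esub>
    ((\<lambda>i. let s = group_algebra_elem (braid_gen n i) in
        (s \<otimes>\<^bsub>braid_algebra n\<^esub> s) \<ominus>\<^bsub>braid_algebra n\<^esub>
        (((q - inverse q) \<odot>\<^bsub>braid_algebra n\<^esub> s) \<oplus>\<^bsub>braid_algebra n\<^esub> \<one>\<^bsub>braid_algebra n\<^esub>))
      ` {1..<n})"

definition hecke_algebra :: "nat \<Rightarrow> 'k::field \<Rightarrow> ('k, (nat gword set \<Rightarrow> 'k) set) module" where
  "hecke_algebra n q = quot_algebra (braid_algebra n) (hecke_ideal n q)"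

definition hecke_gen :: "nat \<Rightarrow> 'k::field \<Rightarrow> nat \<Rightarrow> (nat gword set \<Rightarrow> 'k) set" where
  "hecke_gen n q i = hecke_ideal n q +>\<^bsub>braid_algebra n\<^esub> group_algebra_elem (braid_gen n i)"

text \<open>The summand with index \<open>k\<close> is \<open>q\<^sup>k \<sigma>\<^bsub>n-k\<^esub> \<sigma>\<^bsub>n-k+1\<^esub> \<dots> \<sigma>\<^bsub>n-1\<^esub>\<close>.\<close>

definition additive_shuffle :: "nat \<Rightarrow> 'k::field \<Rightarrow> (nat gword set \<Rightarrow> 'k) set" where
  "additive_shuffle n q =
    (\<Oplus>\<^bsub>hecke_algebra n q\<^esub>k\<in>{..<n}. q ^ k \<odot>\<^bsub>hecke_algebra n q\<^esub>
       foldr (\<lambda>i x. hecke_gen n q i \<otimes>\<^bsub>hecke_algebra n q\<^esub> x) [n - k..<n] \<one>\<^bsub>hecke_algebra n q\<^esub>)"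

definition shuffle_operator ::
    "nat \<Rightarrow> 'k::field \<Rightarrow> (nat gword set \<Rightarrow> 'k) set \<Rightarrow> (nat gword set \<Rightarrow> 'k) set" where
  "shuffle_operator n q = (\<lambda>x. additive_shuffle n q \<otimes>\<^bsub>hecke_algebra n q\<^esub> x)"

section \<open>Eigenvalues and characteristic polynomials of linear operators\<close>

definition operator_eigenvalue :: "('k::field, 'v, 'm) module_scheme \<Rightarrow> ('v \<Rightarrow> 'v) \<Rightarrow> 'k \<Rightarrow> bool" where
  "operator_eigenvalue V T c \<longleftrightarrow> (\<exists>x\<in>carrier V. x \<noteq> \<zero>\<^bsub>V\<^esub> \<and> T x = c \<odot>\<^bsub>V\<^esub> x)"

definition operator_matrix ::
    "('k::field, 'v, 'm) module_scheme \<Rightarrow> ('v \<Rightarrow> 'v) \<Rightarrow> 'v list \<Rightarrow> 'k mat \<Rightarrow> bool" where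
  "operator_matrix V T bs M \<longleftrightarrow>
     distinct bs \<and> vectorspace.basis class_ring V (set bs) \<and>
     M \<in> carrier_mat (length bs) (length bs) \<and>
     (\<forall>j<length bs. T (bs ! j) = (\<Oplus>\<^bsub>V\<^esub>i\<in>{..<length bs}. M $$ (i, j) \<odot>\<^bsub>V\<^esub> bs ! i))"

text \<open>Meaningful for linear operators on finite-dimensional spaces, where matrices with respect
  to different bases are similar and hence have the same characteristic polynomial.\<close>

definition operator_char_poly :: "('k::field, 'v, 'm) module_scheme \<Rightarrow> ('v \<Rightarrow> 'v) \<Rightarrow> 'k poly" where
  "operator_char_poly V T = (THE p. \<exists>bs M. operator_matrix V T bs M \<and> p = char_poly M)"

definition eigenvalue_multiplicity ::
    "('k::field, 'v, 'm) module_scheme \<Rightarrow> ('v \<Rightarrow> 'v) \<Rightarrow> 'k \<Rightarrow> nat" where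
  "eigenvalue_multiplicity V T c = Polynomial.order c (operator_char_poly V T)"

section \<open>Quantum integers\<close>

definition q_int :: "'k::field \<Rightarrow> nat \<Rightarrow> 'k" where
  "q_int q j = (q powi int j - q powi (- int j)) / (q - inverse q)"

definition shuffle_eigenvalue :: "'k::field \<Rightarrow> nat \<Rightarrow> 'k" where
  "shuffle_eigenvalue q j = q powi (int j - 1) * q_int q j"

end

theory Submission
  imports Defs "HOL-Library.Function_Algebras" "HOL-Combinatorics.Multiset_Permutations"
begin

text \<open>
  \<open>H\<^sub>n(q)\<close> acts on words with distinct letters \<open>1, \<dots>, n\<close>, the generator \<open>\<sigma>\<^sub>i\<close> permuting the letters
  in positions \<open>i\<close> and \<open>i + 1\<close>. Applying elements to the decreasing word identifies \<open>H\<^sub>n(q)\<close> with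
  the space of all such words, and the shuffle becomes the operator \<open>S\<^sub>n\<close> that inserts the last
  letter everywhere. From \<open>S\<^sub>n\<^sub>+\<^sub>1 = 1 + q S\<^sub>n \<sigma>\<^sub>n\<close> one gets \<open>S\<^sub>n\<^sub>+\<^sub>1 S\<^sub>n (\<sigma>\<^sub>n - q) = 0\<close>, so that
  \<open>S\<^sub>n B\<^sub>j = [j] B\<^sub>j + q\<^bsup>2j\<^esup> B\<^sub>j\<^sub>+\<^sub>1\<close> for \<open>B\<^sub>j = S\<^sub>n S\<^sub>n\<^sub>-\<^sub>1 \<cdots> S\<^sub>n\<^sub>-\<^sub>j\<^sub>+\<^sub>1\<close>, where \<open>[j]\<close> is the asserted
  eigenvalue; the images of the \<open>B\<^sub>j\<close> form a filtration on whose \<open>j\<close>-th layer \<open>S\<^sub>n\<close> acts as \<open>[j]\<close>.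

  To count dimensions, call a letter of a word single if it is smaller than all preceding letters
  and larger than the next letter, if there is one. The lexicographically largest word in the
  shuffle of a word \<open>u\<close> without single letters with the letters of a set \<open>v\<close> has exactly the
  elements of \<open>v\<close> as single letters, and every word arises once in this way. Hence the vectors
  \<open>B\<^sub>j(u v)\<close> with \<open>|v| = j\<close> are a basis, with respect to which \<open>S\<^sub>n\<close> is triangular. Under
  Foata's correspondence between words and permutations, single letters are fixed points.
\<close>

section \<open>Shuffle operators on words\<close>

text \<open>The presentation of \<open>H_n(q)\<close> bounds its dimension only from above; that the
  spanning products do not collapse is seen from an action. The words therefore serve twice: they
  carry the shuffle computations, and they show that evaluation at the decreasing word is injective.
  The dimension n! is a consequence, not an input.

  The shuffle of a word also contains words in which letters other than the last have moved, because
  of the term \<open>q - inverse q\<close> in the quadratic relation. Only the lexicographically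
  largest word is kept under control, and vectors are identified by it.

  The layers are reached by splitting off the last j letters, expanding the prefix in the same kind
  of basis over a smaller alphabet, and applying \<open>B_j\<close>. This is why statements about
  words allow any finite alphabet and a tail \<open>r\<close> out of reach of the operators.

  Multiplicities are algebraic, so a triangular matrix suffices. Foata's correspondence explains the
  answer, but the count is by inversion over subsets: in both models the objects with prescribed set
  V correspond to those on the complement of V with empty set.\<close>

declare plus_fun_apply [simp del] zero_fun_apply [simp del]

type_synonym 'k wfun = "(nat \<Rightarrow> nat) \<Rightarrow> 'k"

definition scl :: "'k::field \<Rightarrow> 'k wfun \<Rightarrow> 'k wfun" where
  "scl c f = (\<lambda>p. c * f p)"

lemma scl_apply: "scl c f p = c * f p"
  by (simp add: scl_def)

lemmas wfun_eq_iff = fun_eq_iff scl_apply plus_fun_apply zero_fun_apply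

interpretation fv: vector_space "scl :: 'k::field \<Rightarrow> 'k wfun \<Rightarrow> 'k wfun"
  by unfold_locales (auto simp: wfun_eq_iff algebra_simps)

interpretation fvp: vector_space_pair "scl :: 'k::field \<Rightarrow> 'k wfun \<Rightarrow> 'k wfun" "scl :: 'k::field \<Rightarrow> 'k wfun \<Rightarrow> 'k wfun"
  by unfold_locales

abbreviation flinear :: "('k::field wfun \<Rightarrow> 'k wfun) \<Rightarrow> bool" where
  "flinear \<equiv> Vector_Spaces.linear scl scl"

lemma flinearI:
  assumes "\<And>f g. T (f + g) = T f + T g" and "\<And>c f. T (scl c f) = scl c (T f)"
  shows "flinear T"
  using assms by unfold_locales auto

text \<open>Words are infinite, with positions counted from 0, so \<open>\<sigma>\<^sub>i\<close> acts on positions \<open>i - 1\<close> and \<open>i\<close>.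
  The scalar \<open>q\<close> for equal letters makes the braid and quadratic relations hold for all words.\<close>

definition hecke_op :: "'k::field \<Rightarrow> nat \<Rightarrow> 'k wfun \<Rightarrow> 'k wfun" where
  "hecke_op q i f = (\<lambda>p. if p (i - 1) = p i then q * f p
     else f (p(i - 1 := p i, i := p (i - 1)))
       + (if p (i - 1) < p i then (q - inverse q) * f p else 0))"

lemma hecke_op_linear: "flinear (hecke_op q i)"
  by (rule flinearI) (auto simp: hecke_op_def wfun_eq_iff algebra_simps)

lemma hecke_op_add: "hecke_op q i (f + g) = hecke_op q i f + hecke_op q i g"
  and hecke_op_scl: "hecke_op q i (scl c f) = scl c (hecke_op q i f)"
  by (auto simp: hecke_op_def wfun_eq_iff algebra_simps)

lemma hecke_op_eval:
  "hecke_op q (Suc a) f (r(a := x, Suc a := y)) = (if x = y then q * f (r(a := x, Suc a := y))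
     else f (r(a := y, Suc a := x)) + (if x < y then (q - inverse q) * f (r(a := x, Suc a := y)) else 0))"
  by (auto simp: hecke_op_def fun_upd_twist)

lemma hecke_op_quadratic:
  assumes "i \<ge> 1" "q \<noteq> 0"
  shows "hecke_op q i (hecke_op q i f) = scl (q - inverse q) (hecke_op q i f) + f"
proof
  fix p :: "nat \<Rightarrow> nat"
  obtain a where i: "i = Suc a" using assms by (cases i) auto
  define x y where "x = p a" and "y = p (Suc a)"
  \<comment> \<open>Written as an update, the word keeps this shape after every swap, so
    \<open>hecke_op_eval\<close> applies again and only the order of the two letters
    matters.\<close>
  have p: "p = p(a := x, Suc a := y)" by (simp add: x_def y_def)
  have "hecke_op q i (hecke_op q i f) (p(a := x, Suc a := y))
      = (scl (q - inverse q) (hecke_op q i f) + f) (p(a := x, Suc a := y))"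
    unfolding i plus_fun_apply scl_apply hecke_op_eval using assms(2)
    by (auto simp: algebra_simps)
  then show "hecke_op q i (hecke_op q i f) p = (scl (q - inverse q) (hecke_op q i f) + f) p"
    using p by simp
qed

lemma hecke_op_braid_adjacent:
  assumes "i \<ge> 1" "q \<noteq> 0"
  shows "hecke_op q i (hecke_op q (Suc i) (hecke_op q i f))
    = hecke_op q (Suc i) (hecke_op q i (hecke_op q (Suc i) f))"
proof
  fix p :: "nat \<Rightarrow> nat"
  define a where "a = i - 1"
  have i: "i = Suc a" using assms a_def by auto
  define x y z where "x = p a" and "y = p (Suc a)" and "z = p (Suc (Suc a))"
  have p: "p = p(a := x, Suc a := y, Suc (Suc a) := z)" by (simp add: x_def y_def z_def)
  have e1: "hecke_op q (Suc a) f (r(a := x, Suc a := y, Suc (Suc a) := z)) =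
     (if x = y then q * f (r(a := x, Suc a := y, Suc (Suc a) := z))
     else f (r(a := y, Suc a := x, Suc (Suc a) := z)) + (if x < y then (q - inverse q) * f (r(a := x, Suc a := y, Suc (Suc a) := z)) else 0))"
    for f :: "'a wfun" and r x y z
    by (auto simp: hecke_op_def fun_upd_twist)
  have e2: "hecke_op q (Suc (Suc a)) f (r(a := x, Suc a := y, Suc (Suc a) := z)) =
     (if y = z then q * f (r(a := x, Suc a := y, Suc (Suc a) := z))
     else f (r(a := x, Suc a := z, Suc (Suc a) := y)) + (if y < z then (q - inverse q) * f (r(a := x, Suc a := y, Suc (Suc a) := z)) else 0))"
    for f :: "'a wfun" and r x y z
    by (auto simp: hecke_op_def fun_upd_twist)
  have inv: "inverse q * (q * t) = t" "q * (inverse q * t) = t" for t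
    using assms by (auto simp: mult.assoc[symmetric])
  show "hecke_op q i (hecke_op q (Suc i) (hecke_op q i f)) p
    = hecke_op q (Suc i) (hecke_op q i (hecke_op q (Suc i) f)) p"
    unfolding i
    apply (subst (1 2) p)
    apply (simp only: e1 e2)
    \<comment> \<open>All relative orders of the three letters; the inconsistent combinations are
      discharged together with the genuine ones.\<close>
    apply (rule linorder_cases[of x y]; rule linorder_cases[of y z]; rule linorder_cases[of x z])
    apply (simp_all add: algebra_simps inv)
    done
qed

lemma hecke_op_commute:
  assumes "i \<ge> 1" "Suc i < j"
  shows "hecke_op q i (hecke_op q j f) = hecke_op q j (hecke_op q i f)"
proof
  fix p :: "nat \<Rightarrow> nat"
  define a where "a = i - 1"
  define b where "b = j - 1"
  have i: "i = Suc a" and j: "j = Suc b" and ab: "Suc a < b" using assms a_def b_def by auto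
  define x y z w where "x = p a" and "y = p (Suc a)" and "z = p b" and "w = p (Suc b)"
  have p: "p = p(a := x, Suc a := y, b := z, Suc b := w)" by (simp add: x_def y_def z_def w_def)
  have e1: "hecke_op q (Suc a) f (r(a := x, Suc a := y, b := z, Suc b := w)) =
     (if x = y then q * f (r(a := x, Suc a := y, b := z, Suc b := w))
     else f (r(a := y, Suc a := x, b := z, Suc b := w)) + (if x < y then (q - inverse q) * f (r(a := x, Suc a := y, b := z, Suc b := w)) else 0))"
    for f :: "'a wfun" and r x y z w
    using ab by (auto simp: hecke_op_def fun_upd_twist)
  have e2: "hecke_op q (Suc b) f (r(a := x, Suc a := y, b := z, Suc b := w)) =
     (if z = w then q * f (r(a := x, Suc a := y, b := z, Suc b := w))
     else f (r(a := x, Suc a := y, b := w, Suc b := z)) + (if z < w then (q - inverse q) * f (r(a := x, Suc a := y, b := z, Suc b := w)) else 0))"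
    for f :: "'a wfun" and r x y z w
    using ab by (auto simp: hecke_op_def fun_upd_twist)
  show "hecke_op q i (hecke_op q j f) p = hecke_op q j (hecke_op q i f) p"
    unfolding i j
    apply (subst (1 2) p)
    apply (simp only: e1 e2)
    apply (rule linorder_cases[of x y]; rule linorder_cases[of z w])
    apply (simp_all add: algebra_simps)
    done
qed

text \<open>For \<open>m = 0\<close> the recursion mentions \<open>hecke_op q 0\<close>, which is no
  generator; it disappears because \<open>shuffle_op q 0\<close> is 0. The same value makes a
  product of shuffles vanish once its index reaches 0.\<close>

fun shuffle_op :: "'k::field \<Rightarrow> nat \<Rightarrow> 'k wfun \<Rightarrow> 'k wfun" where
  "shuffle_op q 0 f = 0"
| "shuffle_op q (Suc m) f = f + scl q (shuffle_op q m (hecke_op q m f))"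

lemma shuffle_op_add: "shuffle_op q n (f + g) = shuffle_op q n f + shuffle_op q n g"
  by (induction n arbitrary: f g) (simp_all add: hecke_op_add fv.scale_right_distrib)

lemma shuffle_op_scl: "shuffle_op q n (scl c f) = scl c (shuffle_op q n f)"
  by (induction n arbitrary: f)
    (simp_all add: hecke_op_scl fv.scale_right_distrib mult.commute)

lemma shuffle_op_linear: "flinear (shuffle_op q n)"
  by (rule flinearI) (simp_all add: shuffle_op_add shuffle_op_scl)

text \<open>\<open>S_n\<close> involves only \<open>\<sigma>_1, ..., \<sigma>_{n-1}\<close>, all of
  them at distance at least 2 from \<open>\<sigma>_i\<close>.\<close>

lemma shuffle_op_hecke_commute:
  assumes "n < i"
  shows "shuffle_op q n (hecke_op q i f) = hecke_op q i (shuffle_op q n f)"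
  using assms
proof (induction n arbitrary: f)
  case 0
  then show ?case by (simp add: hecke_op_def wfun_eq_iff)
next
  case (Suc n)
  show ?case
  proof (cases "n = 0")
    case False
    then have "hecke_op q n (hecke_op q i f) = hecke_op q i (hecke_op q n f)"
      using hecke_op_commute[of n i] Suc by auto
    then show ?thesis using Suc by (simp add: hecke_op_add hecke_op_scl)
  qed (simp add: wfun_eq_iff)
qed

text \<open>Shuffling in two letters one after the other is symmetric in them, up to the factor \<open>q\<close>.\<close>

lemma shuffle_op_twice_hecke:
  assumes "q \<noteq> 0" "n \<ge> 1"
  shows "shuffle_op q (Suc n) (shuffle_op q n (hecke_op q n f))
    = scl q (shuffle_op q (Suc n) (shuffle_op q n f))"
  using assms(2)
proof (induction n arbitrary: f)
  case 0
  then show ?case by simp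
next
  case (Suc n)
  let ?S = "shuffle_op q" and ?h = "hecke_op q (Suc n)"
  \<comment> \<open>\<open>S_{n+2} = 1 + q S_{n+1} \<sigma>_{n+1}\<close> is applied to
    \<open>S_{n+1} g\<close>; in the second summand \<open>S_{n+1} g\<close> is unfolded to
    \<open>g + q S_n \<sigma>_n g\<close>, and \<open>\<sigma>_{n+1}\<close> commutes with
    \<open>S_n\<close>.\<close>
  have expand: "?S (Suc (Suc n)) (?S (Suc n) g)
     = ?S (Suc n) (g + scl q (?h g)) + scl (q * q) (?S (Suc n) (?S n (?h (hecke_op q n g))))" for g
    by (simp add: shuffle_op_add shuffle_op_scl hecke_op_add hecke_op_scl fv.scale_right_distrib
         shuffle_op_hecke_commute[symmetric] add_ac)
  \<comment> \<open>The quadratic relation in the form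
    \<open>(1 + q \<sigma>) \<sigma> = q (1 + q \<sigma>)\<close>: this settles the first summand of
    \<open>expand\<close>.\<close>
  have sq: "?h f + scl q (?h (?h f)) = scl q (f + scl q (?h f))"
    using assms by (auto simp: hecke_op_quadratic wfun_eq_iff field_simps)
  \<comment> \<open>The braid relation brings \<open>\<sigma>_n\<close> to the left, next to
    \<open>S_{n+1} S_n\<close>, where the induction hypothesis turns it into q.\<close>
  have "?S (Suc n) (?S n (?h (hecke_op q n (?h f)))) = scl q (?S (Suc n) (?S n (?h (hecke_op q n f))))"
  proof (cases "n = 0")
    case False
    then have "?h (hecke_op q n (?h f)) = hecke_op q n (?h (hecke_op q n f))"
      using hecke_op_braid_adjacent assms(1) by (metis One_nat_def Suc_leI neq0_conv)
    then show ?thesis using Suc.IH False by simp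
  qed (simp add: wfun_eq_iff shuffle_op_hecke_commute)
  then show ?case
    unfolding expand sq
    by (simp only: shuffle_op_add shuffle_op_scl fv.scale_right_distrib fv.scale_scale mult_ac)
qed

text \<open>Unfold the right factor as \<open>1 + q S_{n-1} \<sigma>_{n-1}\<close>; by
  \<open>shuffle_op_twice_hecke\<close> the generator turns into a second factor q.\<close>

lemma shuffle_op_square:
  assumes "q \<noteq> 0"
  shows "shuffle_op q n (shuffle_op q n f)
    = shuffle_op q n f + scl (q ^ 2) (shuffle_op q n (shuffle_op q (n - 1) f))"
proof (cases n)
  case (Suc m)
  have "shuffle_op q n (shuffle_op q n f)
      = shuffle_op q n f + scl q (shuffle_op q (Suc m) (shuffle_op q m (hecke_op q m f)))"
    unfolding Suc by (subst (2) shuffle_op.simps) (simp only: shuffle_op_add shuffle_op_scl)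
  also have "scl q (shuffle_op q (Suc m) (shuffle_op q m (hecke_op q m f)))
     = scl (q ^ 2) (shuffle_op q n (shuffle_op q (n - 1) f))"
  proof (cases "m = 0")
    case False
    then show ?thesis using shuffle_op_twice_hecke[OF assms, of m f] Suc
      by (simp add: power2_eq_square)
  qed (simp add: Suc wfun_eq_iff hecke_op_def)
  finally show ?thesis .
qed (simp add: wfun_eq_iff)

fun multi_shuffle :: "'k::field \<Rightarrow> nat \<Rightarrow> nat \<Rightarrow> 'k wfun \<Rightarrow> 'k wfun" where
  "multi_shuffle q n 0 f = f"
| "multi_shuffle q n (Suc j) f = shuffle_op q n (multi_shuffle q (n - 1) j f)"

lemma multi_shuffle_add: "multi_shuffle q n j (f + g) = multi_shuffle q n j f + multi_shuffle q n j g"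
  by (induction q n j f rule: multi_shuffle.induct) (simp_all add: shuffle_op_add)

lemma multi_shuffle_scl: "multi_shuffle q n j (scl c f) = scl c (multi_shuffle q n j f)"
  by (induction q n j f rule: multi_shuffle.induct) (simp_all add: shuffle_op_scl)

lemma multi_shuffle_linear: "flinear (multi_shuffle q n j)"
  by (rule flinearI) (simp_all add: multi_shuffle_add multi_shuffle_scl)

lemma multi_shuffle_compose:
  "multi_shuffle q n i (multi_shuffle q (n - i) j f) = multi_shuffle q n (i + j) f"
proof (induction i arbitrary: n)
  case (Suc i)
  have "n - Suc i = n - 1 - i" by simp
  then show ?case using Suc[of "n - 1"] by simp
qed simp

text \<open>\<open>shuffle_op_square\<close> replaces the leading \<open>S_n S_n\<close> by
  \<open>S_n + q^2 S_n S_{n-1}\<close>, and the induction hypothesis acts on the remaining product.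
  So the coefficients obey \<open>[j+1] = 1 + q^2 [j]\<close>, which produces the geometric
  sum.\<close>

lemma shuffle_op_multi_shuffle:
  assumes "q \<noteq> 0"
  shows "shuffle_op q n (multi_shuffle q n j f)
    = scl (\<Sum>i<j. q ^ (2 * i)) (multi_shuffle q n j f) + scl (q ^ (2 * j)) (multi_shuffle q n (Suc j) f)"
proof (induction j arbitrary: n)
  case 0
  then show ?case by (auto simp: wfun_eq_iff)
next
  case (Suc j)
  have s: "(\<Sum>i<Suc j. q ^ (2 * i)) = 1 + q ^ 2 * (\<Sum>i<j. q ^ (2 * i))"
    by (subst sum.lessThan_Suc_shift) (simp add: sum_distrib_left power2_eq_square mult_ac)
  let ?g = "multi_shuffle q (n - 1) j f" and ?c = "\<Sum>i<j. q ^ (2 * i)"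
  have "shuffle_op q n (multi_shuffle q n (Suc j) f)
     = shuffle_op q n ?g + scl (q ^ 2) (shuffle_op q n (shuffle_op q (n - 1) ?g))"
    using shuffle_op_square[OF assms, of n ?g] by simp
  also have "\<dots> = shuffle_op q n ?g + scl (q ^ 2) (scl ?c (shuffle_op q n ?g)
       + scl (q ^ (2 * j)) (shuffle_op q n (multi_shuffle q (n - 1) (Suc j) f)))"
    by (simp only: Suc.IH shuffle_op_add shuffle_op_scl)
  also have "\<dots> = scl (1 + q ^ 2 * ?c) (shuffle_op q n ?g)
       + scl (q ^ (2 * Suc j)) (shuffle_op q n (multi_shuffle q (n - 1) (Suc j) f))"
    by (simp add: fv.scale_right_distrib fv.scale_left_distrib add.assoc power2_eq_square mult_ac)
  finally show ?case by (simp only: s multi_shuffle.simps)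
qed

lemma multi_shuffle_hecke_commute:
  assumes "n < i"
  shows "multi_shuffle q n j (hecke_op q i f) = hecke_op q i (multi_shuffle q n j f)"
  using assms by (induction j arbitrary: n) (simp_all add: shuffle_op_hecke_commute)

text \<open>The index range says that \<open>\<sigma>_l\<close> permutes two of the last j letters.
  It passes the factors of index below l, meets the pair \<open>S_{l+1} S_l\<close> and becomes the
  scalar q there.\<close>

lemma multi_shuffle_hecke:
  assumes "q \<noteq> 0" "n - j < l" "l < n"
  shows "multi_shuffle q n j (hecke_op q l f) = scl q (multi_shuffle q n j f)"
  using assms(2,3)
proof (induction j arbitrary: n)
  case 0
  then show ?case by simp
next
  case (Suc j)
  show ?case
  proof (cases "Suc l = n")
    case True
    then obtain i where j: "j = Suc i" using Suc.prems by (cases j) auto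
    have "multi_shuffle q (l - 1) i (hecke_op q l f) = hecke_op q l (multi_shuffle q (l - 1) i f)"
      by (rule multi_shuffle_hecke_commute) (use Suc.prems in auto)
    then show ?thesis using shuffle_op_twice_hecke[OF assms(1), of l] True Suc.prems by (auto simp: j)
  next
    case False
    then show ?thesis using Suc.IH[of "n - 1"] Suc.prems by (simp add: shuffle_op_scl)
  qed
qed

section \<open>Leading terms\<close>

text \<open>Padding turns words of all lengths into functions on one domain, so that one operator
  can act on prefixes of different words. Words differing by trailing zeros coincide; hence the
  hypothesis on lengths in \<open>pad_inject\<close>.\<close>

definition pad :: "nat list \<Rightarrow> nat \<Rightarrow> nat" where
  "pad xs i = (if i < length xs then xs ! i else 0)"

definition word_fun :: "nat list \<Rightarrow> 'k::field wfun" where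
  "word_fun xs = (\<lambda>p. if p = pad xs then 1 else 0)"

lemma pad_inject:
  assumes "length xs = length ys" "pad xs = pad ys"
  shows "xs = ys"
  using assms by (intro nth_equalityI) (auto simp: pad_def fun_eq_iff split: if_splits)

lemma pad_swap:
  "(pad (as @ x # y # bs))(length as := y, Suc (length as) := x) = pad (as @ y # x # bs)"
proof
  fix i
  consider "i < length as" | "i = length as" | "i = Suc (length as)" | j where "i = Suc (Suc (length as)) + j"
    using less_iff_Suc_add by (metis add_Suc less_linear not_less_less_Suc_eq)
  then show "((pad (as @ x # y # bs))(length as := y, Suc (length as) := x)) i = pad (as @ y # x # bs) i"
    by cases (auto simp: pad_def nth_append)
qed

text \<open>At a descent the generator is a pure swap; a correction term appears only at an ascent.
  This is why the decreasing word is the starting point from which the other words are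
  reached.\<close>

lemma hecke_op_word_fun:
  fixes q :: "'k::field"
  assumes "x \<noteq> y" "i = Suc (length as)"
  shows "hecke_op q i (word_fun (as @ x # y # bs)) =
    word_fun (as @ y # x # bs)
      + (if x < y then scl (q - inverse q) (word_fun (as @ x # y # bs)) else 0)"
    (is "_ = ?r")
proof
  fix p :: "nat \<Rightarrow> nat"
  let ?a = "length as"
  let ?P = "pad (as @ x # y # bs)" and ?P' = "pad (as @ y # x # bs)"
  have P: "?P ?a = x" "?P (Suc ?a) = y" "?P' ?a = y" "?P' (Suc ?a) = x"
    by (auto simp: pad_def nth_append)
  have "p(?a := p (Suc ?a), Suc ?a := p ?a) = ?P \<longleftrightarrow> p = ?P'"
  proof
    assume l: "p(?a := p (Suc ?a), Suc ?a := p ?a) = ?P"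
    have pv: "p ?a = y" "p (Suc ?a) = x" using l P by (auto simp: fun_eq_iff split: if_splits)
    have "p = ?P(?a := p ?a, Suc ?a := p (Suc ?a))"
      unfolding l[symmetric] by (simp add: fun_eq_iff)
    then have "p = ?P(?a := y, Suc ?a := x)" by (simp only: pv)
    then show "p = ?P'" by (simp only: pad_swap)
  next
    assume "p = ?P'"
    then have "p(?a := p (Suc ?a), Suc ?a := p ?a) = ?P'(?a := x, Suc ?a := y)" using P by simp
    then show "p(?a := p (Suc ?a), Suc ?a := p ?a) = ?P" by (simp only: pad_swap)
  qed
  then show "hecke_op q i (word_fun (as @ x # y # bs)) p = ?r p"
    using assms P by (auto simp: hecke_op_def word_fun_def plus_fun_apply zero_fun_apply scl_apply)
qed

lemma fspan_linear_image:
  assumes "flinear T" "g \<in> fv.span A" "\<And>f. f \<in> A \<Longrightarrow> T f \<in> fv.span B"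
  shows "T g \<in> fv.span B"
proof -
  have "T g \<in> T ` fv.span A" using assms by auto
  also have "\<dots> = fv.span (T ` A)" using fvp.linear_span_image[OF assms(1)] by simp
  also have "\<dots> \<subseteq> fv.span B" using assms(3) by (intro fv.span_minimal) auto
  finally show ?thesis .
qed

text \<open>The lexicographically largest word obtained by inserting \<open>a\<close> into \<open>u\<close>.\<close>

definition ins :: "nat \<Rightarrow> nat list \<Rightarrow> nat list" where
  "ins a u = takeWhile ((<) a) u @ a # dropWhile ((<) a) u"

lemma ins_Nil [simp]: "ins a [] = [a]"
  by (simp add: ins_def)

lemma ins_append_greater: "\<forall>x\<in>set p. a < x \<Longrightarrow> ins a (p @ v) = p @ ins a v"
  by (simp add: ins_def takeWhile_append dropWhile_append)

lemma ins_greater: "\<forall>x\<in>set p. a < x \<Longrightarrow> ins a p = p @ [a]"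
  using ins_append_greater[of p a "[]"] by simp

lemma ins_Cons: "ins a (y # s) = (if a < y then y # ins a s else a # y # s)"
  by (simp add: ins_def)

lemma mset_ins [simp]: "mset (ins a u) = add_mset a (mset u)"
  by (induction u) (auto simp: ins_Cons)

lemma set_ins [simp]: "set (ins a u) = insert a (set u)"
  by (metis mset_ins set_mset_add_mset_insert set_mset_mset)

lemma length_ins [simp]: "length (ins a u) = Suc (length u)"
  by (metis mset_ins size_add_mset size_mset)

lemma distinct_ins [simp]: "distinct (ins a u) \<longleftrightarrow> a \<notin> set u \<and> distinct u"
  by (induction u) (auto simp: ins_Cons)

section \<open>Lexicographic order and insertion\<close>

abbreviation lexl :: "(nat list \<times> nat list) set" where
  "lexl \<equiv> lex less_than"

lemma lexlI: "(b::nat) < a \<Longrightarrow> length xs = length ys \<Longrightarrow> (p @ b # xs, p @ a # ys) \<in> lexl"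
  by (auto simp: lex_conv)

lemma lexlE:
  assumes "(x, y) \<in> lexl"
  obtains p b a xs ys where "x = p @ b # xs" "y = p @ a # ys" "b < a" "length xs = length ys"
  using assms by (auto simp: lex_conv)

lemma lexl_trans: "(x, y) \<in> lexl \<Longrightarrow> (y, z) \<in> lexl \<Longrightarrow> (x, z) \<in> lexl"
  using lex_transI[OF trans_less_than] unfolding trans_def by blast

text \<open>Insertion stops at the first letter below \<open>a\<close>. If the common prefix has
  such a letter, both words change in the same place. Otherwise let b < d be the first differing
  letters: if both are below \<open>a\<close>, it precedes both; if only b is, the words now differ
  by \<open>a\<close> against d; if neither is, both letters stay and decide.\<close>

lemma ins_lexl_mono:
  assumes "(x, w) \<in> lexl" "a \<notin> set x" "a \<notin> set w"
  shows "(ins a x, ins a w) \<in> lexl"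
  using assms(1)
proof (cases rule: lexlE)
  case (1 p b d xs ys)
  show ?thesis
  proof (cases "\<forall>t\<in>set p. a < t")
    case True
    have "b \<noteq> a" "d \<noteq> a" using 1 assms by auto
    then consider "d < a" | "a < d" "b < a" | "a < d" "a < b" by linarith
    then show ?thesis
    proof cases
      case 1
      then show ?thesis using True \<open>b < d\<close> lexlI[of b d xs ys "p @ [a]"] \<open>length xs = _\<close>
        by (simp add: \<open>x = _\<close> \<open>w = _\<close> ins_append_greater ins_Cons)
    next
      case 2
      then show ?thesis using True lexlI[of a d "b # xs" "ins a ys" p] \<open>length xs = _\<close>
        by (simp add: \<open>x = _\<close> \<open>w = _\<close> ins_append_greater ins_Cons)
    next
      case 3
      then show ?thesis using True lexlI[of b d "ins a xs" "ins a ys" p] \<open>length xs = _\<close> \<open>b < d\<close>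
        by (simp add: \<open>x = _\<close> \<open>w = _\<close> ins_append_greater ins_Cons)
    qed
  next
    case False
    have "ins a (p @ v) = ins a p @ v" for v
    proof -
      obtain z where "z \<in> set p" "\<not> a < z" using False by blast
      then show ?thesis by (simp add: ins_def takeWhile_append1 dropWhile_append1)
    qed
    then show ?thesis unfolding \<open>x = _\<close> \<open>w = _\<close> using lexlI[OF \<open>b < d\<close> \<open>length xs = _\<close>] by metis
  qed
qed

text \<open>Only the part before \<open>r\<close> is compared: \<open>r\<close> holds the letters
  behind the positions on which the operator acts, and in inductions it absorbs letters from the end
  of the word.\<close>

definition lower :: "nat list \<Rightarrow> nat list \<Rightarrow> 'k::field wfun set" where
  "lower w r = {word_fun (x @ r) | x. (x, w) \<in> lexl \<and> mset x = mset w}"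

lemma lower_append_subset:
  fixes w r t :: "nat list"
  assumes "w @ [x] = t \<or> (w @ [x], t) \<in> lexl" "mset (w @ [x]) = mset t"
  shows "(lower w (x # r) :: 'k::field wfun set) \<subseteq> lower t r"
proof
  fix f :: "'k wfun" assume "f \<in> lower w (x # r)"
  then obtain y where y: "f = word_fun (y @ x # r)" "(y, w) \<in> lexl" "mset y = mset w"
    by (auto simp: lower_def)
  have "(y @ [x], w @ [x]) \<in> lexl" using y(2) by (simp add: lex_append_rightI)
  then have "(y @ [x], t) \<in> lexl" using assms(1) lexl_trans by blast
  moreover have "mset (y @ [x]) = mset t" using assms(2) y(3) by simp
  ultimately show "f \<in> lower t r" unfolding lower_def y(1)
    by (intro CollectI exI[of _ "y @ [x]"]) simp
qed

lemma span_lower_append: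
  assumes "w @ [x] = t \<or> (w @ [x], t) \<in> lexl" "mset (w @ [x]) = mset t" "g \<in> fv.span (lower w (x # r))"
  shows "g \<in> fv.span (lower t r)"
  using assms(3) fv.span_mono[OF lower_append_subset[OF assms(1,2), of r]] by blast

lemma word_fun_in_span_lower:
  "(x, t) \<in> lexl \<Longrightarrow> mset x = mset t \<Longrightarrow> word_fun (x @ r) \<in> fv.span (lower t r)"
  by (rule fv.span_base) (auto simp: lower_def)

text \<open>Induction from the right. In the shuffle of \<open>u x a\<close>, either
  \<open>a\<close> stays behind \<open>x\<close>, or the two are swapped and \<open>a\<close> is
  inserted into \<open>u\<close> with \<open>x\<close> added to the tail; if \<open>x < a\<close>,
  the swap also yields a term in which \<open>x\<close> is inserted into \<open>u\<close> instead.
  The first term leads if \<open>a\<close> is below all letters, with coefficient 1, otherwise the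
  second one does.\<close>

lemma shuffle_op_leading_term:
  fixes q :: "'k::field"
  assumes "q \<noteq> 0" "distinct u" "a \<notin> set u"
  shows "\<exists>c g. c \<noteq> 0 \<and> g \<in> fv.span (lower (ins a u) r) \<and>
    shuffle_op q (Suc (length u)) (word_fun (u @ a # r)) = scl c (word_fun (ins a u @ r)) + g"
  using assms(2,3)
proof (induction u arbitrary: a r rule: rev_induct)
  case Nil
  show ?case
    by (intro exI[of _ 1] exI[of _ 0] conjI fv.span_zero) (simp_all add: wfun_eq_iff)
next
  case (snoc x u)
  let ?m = "length u" and ?c = "q - inverse q"
  let ?t = "ins a (u @ [x])"
  let ?Lo = "fv.span (lower ?t r) :: 'k wfun set"
  let ?S = "shuffle_op q (Suc ?m)"
  have ax: "a \<noteq> x" and au: "a \<notin> set u" and xu: "x \<notin> set u" and du: "distinct u" using snoc.prems by auto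
  obtain c1 g1 where 1: "c1 \<noteq> 0" "g1 \<in> fv.span (lower (ins a u) (x # r))"
    "?S (word_fun (u @ a # x # r)) = scl c1 (word_fun (ins a u @ x # r)) + g1"
    using snoc.IH[OF du au, of "x # r"] by auto
  obtain c2 g2 where 2: "g2 \<in> fv.span (lower (ins x u) (a # r))"
    "?S (word_fun (u @ x # a # r)) = scl c2 (word_fun (ins x u @ a # r)) + g2"
    using snoc.IH[OF du xu, of "a # r"] by auto
  \<comment> \<open>The contribution of the correction term at the ascent
    \<open>x < a\<close>.\<close>
  define w3 where "w3 = (if x < a then scl (q * ?c) (scl c2 (word_fun (ins x u @ a # r)) + g2) else 0)"
  have main: "shuffle_op q (Suc (length (u @ [x]))) (word_fun ((u @ [x]) @ a # r))
     = word_fun (u @ x # a # r) + (scl (q * c1) (word_fun (ins a u @ x # r)) + scl q g1) + w3"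
  proof -
    have "hecke_op q (Suc ?m) (word_fun (u @ x # a # r)) = word_fun (u @ a # x # r)
        + (if x < a then scl ?c (word_fun (u @ x # a # r)) else 0)"
      using ax by (intro hecke_op_word_fun) auto
    then have "?S (hecke_op q (Suc ?m) (word_fun (u @ x # a # r)))
      = ?S (word_fun (u @ a # x # r)) + (if x < a then scl ?c (?S (word_fun (u @ x # a # r))) else 0)"
      by (simp only: shuffle_op_add shuffle_op_scl if_distrib[of ?S] fv.scale_zero_right
           fvp.linear_0[OF shuffle_op_linear])
    then show ?thesis
      unfolding 1 2 w3_def
      by (simp add: shuffle_op.simps(2)[of q "Suc ?m"] fv.scale_right_distrib add.assoc del: shuffle_op.simps)
  qed
  have mt: "mset (u @ [x, a]) = mset ?t" "mset (ins a u @ [x]) = mset ?t" "mset (ins x u @ [a]) = mset ?t"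
    by auto
  have w3: "w3 \<in> ?Lo" if "x < a \<Longrightarrow> (ins x u @ [a], ?t) \<in> lexl"
    using that span_lower_append[OF _ mt(3) 2(1)] word_fun_in_span_lower[OF _ mt(3), of r]
    by (auto simp: w3_def intro!: fv.span_scale fv.span_add fv.span_zero)
  show ?case
  proof (cases "(\<forall>y\<in>set u. a < y) \<and> a < x")
    case True
    have t: "?t = u @ [x, a]" using ins_greater[of "u @ [x]" a] True by simp
    have l: "(ins a u @ [x], ?t) \<in> lexl" using lexlI[of a x "[x]" "[a]" u] True
      by (simp add: ins_greater t)
    show ?thesis
    proof (intro exI conjI)
      show "(1::'k) \<noteq> 0" by simp
      show "(scl (q * c1) (word_fun (ins a u @ x # r)) + scl q g1) + w3 \<in> ?Lo"
        using True word_fun_in_span_lower[OF l mt(2), of r] span_lower_append[OF disjI2[OF l] mt(2) 1(2)]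
        by (intro fv.span_add fv.span_scale w3) auto
    qed (simp only: main t, simp add: add.assoc)
  next
    case False
    \<comment> \<open>Now some letter of \<open>u @ [x]\<close> is below \<open>a\<close>, so
      \<open>a\<close> settles before it. The words of the first and third terms have a letter
      smaller than \<open>a\<close> either where \<open>a\<close> stands in \<open>?t\<close> or,
      for the third, possibly \<open>x\<close> itself there.\<close>
    have "?t = ins a u @ [x] \<and> (u @ [x, a], ?t) \<in> lexl \<and> (x < a \<longrightarrow> (ins x u @ [a], ?t) \<in> lexl)"
    proof (cases "\<forall>y\<in>set u. a < y")
      case True
      then have "x < a" using False ax by auto
      moreover have "\<forall>y\<in>set u. x < y" using True \<open>x < a\<close> by auto
      ultimately show ?thesis using True lexlI[of x a "[a]" "[x]" u]
        by (simp add: ins_greater ins_append_greater ins_Cons)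
    next
      case False
      define p s where "p = takeWhile ((<) a) u" and "s = dropWhile ((<) a) u"
      have u: "u = p @ s" by (simp add: p_def s_def)
      have "s \<noteq> []" using False by (auto simp: s_def)
      then obtain y s' where s: "s = y # s'" by (cases s) auto
      have "\<not> a < y" using s s_def by (metis hd_dropWhile list.discI list.sel(1))
      then have y: "y < a" using au u s by auto
      have p: "\<forall>z\<in>set p. a < z" by (auto simp: p_def dest: set_takeWhileD)
      have t: "ins a u = p @ a # s" "?t = p @ a # s @ [x]"
        using p y by (auto simp: u s ins_append_greater ins_Cons)
      have "(ins x u @ [a], ?t) \<in> lexl" if "x < a"
      proof -
        have px: "\<forall>z\<in>set p. x < z" using p that by auto
        then have "ins x u = p @ ins x s" by (simp add: u ins_append_greater)
        then show ?thesis using that y lexlI[of x a "s @ [a]" "s @ [x]" p]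
            lexlI[of y a "ins x s' @ [a]" "s @ [x]" p]
          unfolding t(2) by (auto simp: s ins_Cons)
      qed
      moreover have "(u @ [x, a], ?t) \<in> lexl"
        unfolding t(2) using lexlI[of y a "s' @ [x, a]" "s @ [x]" p] y by (simp add: u s)
      ultimately show ?thesis using t by simp
    qed
    then have t: "?t = ins a u @ [x]" and l: "(u @ [x, a], ?t) \<in> lexl"
      and l3: "x < a \<Longrightarrow> (ins x u @ [a], ?t) \<in> lexl" by auto
    show ?thesis
    proof (intro exI conjI)
      show "q * c1 \<noteq> 0" using 1 assms by simp
      show "word_fun (u @ x # a # r) + scl q g1 + w3 \<in> ?Lo"
        using word_fun_in_span_lower[OF l mt(1), of r]
          span_lower_append[OF disjI1[OF t[symmetric]] mt(2) 1(2)]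
        by (intro fv.span_add fv.span_scale w3 l3) auto
    qed (simp only: main t, simp add: add_ac)
  qed
qed

lemma mset_fold_ins [simp]: "mset (fold ins v u) = mset v + mset u"
  by (induction v arbitrary: u) auto

lemma length_fold_ins [simp]: "length (fold ins v u) = length v + length u"
  by (induction v arbitrary: u) auto

lemma set_fold_ins [simp]: "set (fold ins v u) = set v \<union> set u"
  by (induction v arbitrary: u) auto

lemma distinct_fold_ins [simp]: "distinct (fold ins v u) \<longleftrightarrow> distinct (u @ v)"
  by (induction v arbitrary: u) auto

text \<open>The factor of smallest index acts first, so the letters of \<open>v\<close> are inserted
  from left to right, in agreement with \<open>fold\<close>.\<close>

lemma multi_shuffle_leading_term:
  fixes q :: "'k::field"
  assumes "q \<noteq> 0" "distinct (u @ v)"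
  shows "\<exists>c g. c \<noteq> 0 \<and> g \<in> fv.span (lower (fold ins v u) r) \<and>
    multi_shuffle q (length u + length v) (length v) (word_fun (u @ v @ r))
      = scl c (word_fun (fold ins v u @ r)) + g"
  using assms(2)
proof (induction v arbitrary: r rule: rev_induct)
  case Nil
  show ?case
    by (rule exI[of _ 1], rule exI[of _ 0]) (simp add: fv.span_zero)
next
  case (snoc a v)
  let ?w = "fold ins v u" and ?n = "length u + length v"
  obtain c g where cg: "c \<noteq> 0" "g \<in> fv.span (lower ?w (a # r))"
    "multi_shuffle q ?n (length v) (word_fun (u @ v @ a # r)) = scl c (word_fun (?w @ a # r)) + g"
    using snoc.IH[of "a # r"] snoc.prems by auto
  have n: "length ?w = ?n" by simp
  have dw: "distinct ?w" "a \<notin> set ?w" using snoc.prems by auto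
  obtain c' g' where cg': "c' \<noteq> 0" "g' \<in> fv.span (lower (ins a ?w) r)"
    "shuffle_op q (Suc ?n) (word_fun (?w @ a # r)) = scl c' (word_fun (ins a ?w @ r)) + g'"
    using shuffle_op_leading_term[OF assms(1) dw, of r] unfolding n by blast
  \<comment> \<open>Lower terms stay lower: each has a leading word of its own after the insertion
    of \<open>a\<close>, and \<open>ins_lexl_mono\<close> compares it with the main one.\<close>
  have "shuffle_op q (Suc ?n) g \<in> fv.span (lower (ins a ?w) r)"
  proof (rule fspan_linear_image[OF shuffle_op_linear cg(2)])
    fix f :: "'k wfun" assume "f \<in> lower ?w (a # r)"
    then obtain x where x: "f = word_fun (x @ a # r)" "(x, ?w) \<in> lexl" "mset x = mset ?w"
      by (auto simp: lower_def)
    have dx: "distinct x" "a \<notin> set x" "length x = ?n"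
      using dw x(3) n by (metis mset_eq_imp_distinct_iff, metis mset_eq_setD, metis mset_eq_length)
    obtain c' g' where c': "g' \<in> fv.span (lower (ins a x) r)"
      "shuffle_op q (Suc ?n) f = scl c' (word_fun (ins a x @ r)) + g'"
      using shuffle_op_leading_term[OF assms(1) dx(1,2), of r] unfolding dx(3) x(1) by blast
    have l: "(ins a x, ins a ?w) \<in> lexl" by (rule ins_lexl_mono[OF x(2) dx(2) dw(2)])
    have m: "mset (ins a x) = mset (ins a ?w)" using x(3) by simp
    have "lower (ins a x) r \<subseteq> lower (ins a ?w) r"
      using l m lexl_trans by (auto simp: lower_def)
    then have "g' \<in> fv.span (lower (ins a ?w) r)" using c'(1) fv.span_mono by blast
    then show "shuffle_op q (Suc ?n) f \<in> fv.span (lower (ins a ?w) r)"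
      unfolding c'(2) by (intro fv.span_add fv.span_scale word_fun_in_span_lower l m)
  qed
  then have "scl c g' + shuffle_op q (Suc ?n) g \<in> fv.span (lower (ins a ?w) r)"
    using cg'(2) by (intro fv.span_add fv.span_scale)
  moreover have "multi_shuffle q (length u + length (v @ [a])) (length (v @ [a])) (word_fun (u @ (v @ [a]) @ r))
     = scl (c * c') (word_fun (fold ins (v @ [a]) u @ r)) + (scl c g' + shuffle_op q (Suc ?n) g)"
    using cg(3) cg'(3) by (simp add: shuffle_op_add shuffle_op_scl fv.scale_right_distrib add_ac del: shuffle_op.simps)
  ultimately show ?case using cg(1) cg'(1)
    by (intro exI[of _ "c * c'"] exI[of _ "scl c g' + shuffle_op q (Suc ?n) g"]) simp
qed

section \<open>A triangular basis\<close>

definition singles :: "nat list \<Rightarrow> nat set" where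
  "singles w = {a. \<exists>xs ys. w = xs @ a # ys \<and> (\<forall>x\<in>set xs. a < x) \<and> (ys = [] \<or> hd ys < a)}"

definition core :: "nat list \<Rightarrow> nat list" where
  "core w = filter (\<lambda>x. x \<notin> singles w) w"

lemma singles_subset: "singles w \<subseteq> set w"
  by (auto simp: singles_def)

lemma finite_singles [simp]: "finite (singles w)"
  using singles_subset finite_subset by blast

lemma ins_split:
  assumes "a \<notin> set u"
  obtains p s where "u = p @ s" "ins a u = p @ a # s" "\<forall>x\<in>set p. a < x" "s = [] \<or> hd s < a"
proof
  let ?p = "takeWhile ((<) a) u" and ?s = "dropWhile ((<) a) u"
  show "u = ?p @ ?s" by simp
  show "ins a u = ?p @ a # ?s" by (simp add: ins_def)
  show "\<forall>x\<in>set ?p. a < x" by (auto dest: set_takeWhileD)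
  show "?s = [] \<or> hd ?s < a"
    using assms hd_dropWhile[of "(<) a" u] hd_in_set[of ?s] set_dropWhileD[of "hd ?s" "(<) a" u]
    by (metis linorder_neqE_nat)
qed

text \<open>At the junction, a letter at the end of \<open>p\<close> has the successor
  \<open>a\<close> instead of the head of \<open>s\<close>, and both are below it. A letter of
  \<open>s\<close> that is smaller than everything before it is at most the head of
  \<open>s\<close>, hence below \<open>a\<close>.\<close>

lemma singles_insert_middle:
  assumes d: "distinct (p @ a # s)" and p: "\<forall>x\<in>set p. a < x" and s: "s = [] \<or> hd s < a"
  shows "singles (p @ a # s) = insert a (singles (p @ s))"
proof (intro equalityI subsetI)
  fix b assume "b \<in> singles (p @ a # s)"
  then obtain xs ys where w: "p @ a # s = xs @ b # ys" and xs: "\<forall>x\<in>set xs. b < x"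
    and ys: "ys = [] \<or> hd ys < b" by (auto simp: singles_def)
  show "b \<in> insert a (singles (p @ s))"
  proof (cases "b = a")
    case False
    from w consider us where "p = xs @ b # us" "ys = us @ a # s" | us where "xs = p @ a # us" "s = us @ b # ys"
      using False by (auto simp: append_eq_append_conv2 append_eq_Cons_conv Cons_eq_append_conv)
    then show ?thesis
    proof cases
      case 1
      then have "us @ s = [] \<or> hd (us @ s) < b" using ys s p
        by (cases us) auto
      then show ?thesis using 1 xs unfolding singles_def
        by (intro insertI2 CollectI exI[of _ xs] exI[of _ "us @ s"]) auto
    next
      case 2
      then show ?thesis using ys xs unfolding singles_def
        by (intro insertI2 CollectI exI[of _ "p @ us"] exI[of _ ys]) auto
    qed
  qed simp
next
  fix b assume "b \<in> insert a (singles (p @ s))"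
  then consider "b = a" | "b \<in> singles (p @ s)" by auto
  then show "b \<in> singles (p @ a # s)"
  proof cases
    case 1
    then show ?thesis using p s by (auto simp: singles_def)
  next
    case 2
    then obtain xs ys where w: "p @ s = xs @ b # ys" and xs: "\<forall>x\<in>set xs. b < x"
      and ys: "ys = [] \<or> hd ys < b" by (auto simp: singles_def)
    from w consider us where "p = xs @ b # us" "ys = us @ s" | us where "xs = p @ us" "s = us @ b # ys"
      by (auto simp: append_eq_append_conv2 append_eq_Cons_conv Cons_eq_append_conv)
    then show ?thesis
    proof cases
      case 1
      then have "hd (us @ a # s) < b" using ys p by (cases us) auto
      then show ?thesis using 1 xs unfolding singles_def
        by (intro CollectI exI[of _ xs] exI[of _ "us @ a # s"]) auto
    next
      case 2
      then have "b < a" using xs s by (cases us) (auto dest: order.strict_trans)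
      then show ?thesis using 2 ys xs unfolding singles_def
        by (intro CollectI exI[of _ "p @ a # us"] exI[of _ ys]) auto
    qed
  qed
qed

lemma singles_ins:
  assumes "distinct u" "a \<notin> set u"
  shows "singles (ins a u) = insert a (singles u)"
proof -
  obtain p s where "u = p @ s" "ins a u = p @ a # s" "\<forall>x\<in>set p. a < x" "s = [] \<or> hd s < a"
    using ins_split assms(2) by blast
  then show ?thesis using singles_insert_middle[of p a s] assms by auto
qed

lemma ins_remove1:
  assumes "distinct w" "a \<in> singles w"
  shows "ins a (remove1 a w) = w"
proof -
  obtain xs ys where w: "w = xs @ a # ys" and xs: "\<forall>x\<in>set xs. a < x"
    and ys: "ys = [] \<or> hd ys < a" using assms by (auto simp: singles_def)
  have "remove1 a w = xs @ ys" using assms(1) by (simp add: w remove1_append)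
  moreover have "ins a ys = a # ys" using ys by (cases ys) (auto simp: ins_Cons)
  ultimately show ?thesis using xs by (simp add: w ins_append_greater)
qed

lemma singles_fold_ins:
  "distinct (u @ v) \<Longrightarrow> singles (fold ins v u) = set v \<union> singles u"
  by (induction v arbitrary: u) (auto simp: singles_ins)

lemma filter_ins: "\<not> P a \<Longrightarrow> filter P (ins a u) = filter P u"
  by (induction u) (auto simp: ins_Cons)

lemma filter_fold_ins: "(\<And>x. x \<in> set v \<Longrightarrow> \<not> P x) \<Longrightarrow> filter P (fold ins v u) = filter P u"
  by (induction v arbitrary: u) (auto simp: filter_ins)

text \<open>Deleting a single letter leaves the others single and does not change the core, and
  \<open>ins\<close> puts it back where it was. Hence the order in which \<open>v\<close> lists the
  letters is irrelevant.\<close>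

lemma fold_ins_core:
  assumes "distinct w" "distinct v" "set v = singles w"
  shows "fold ins v (core w) = w"
  using assms
proof (induction v arbitrary: w rule: rev_induct)
  case Nil
  then show ?case by (simp add: core_def)
next
  case (snoc a v)
  let ?w = "remove1 a w"
  have a: "a \<in> singles w" "a \<in> set w" using snoc.prems singles_subset by auto
  have d: "distinct ?w" "a \<notin> set ?w" using snoc.prems by auto
  have w: "ins a ?w = w" by (rule ins_remove1) (use snoc.prems a in auto)
  have s: "singles w = insert a (singles ?w)" using singles_ins[OF d] w by simp
  have "a \<notin> singles ?w" using d singles_subset by blast
  then have sv: "set v = singles ?w" using s snoc.prems by auto
  have "core ?w = core w"
  proof -
    have "core w = filter (\<lambda>x. x \<notin> singles w) (ins a ?w)" by (simp add: core_def w)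
    also have "\<dots> = filter (\<lambda>x. x \<notin> singles w) ?w" using a by (simp add: filter_ins)
    also have "\<dots> = filter (\<lambda>x. x \<notin> singles ?w) ?w" using d s by (intro filter_cong) auto
    finally show ?thesis by (simp add: core_def)
  qed
  then show ?case using snoc.IH[OF d(1) _ sv] snoc.prems w by simp
qed

text \<open>Insertion never destroys single letters. Since reinserting restores \<open>w\<close>, a
  single letter of the core would be single in \<open>w\<close>, and such letters have been
  removed.\<close>

lemma singles_core:
  assumes "distinct w"
  shows "singles (core w) = {}"
proof -
  let ?v = "sorted_list_of_set (singles w)"
  have "singles (fold ins ?v (core w)) = set ?v \<union> singles (core w)"
    by (rule singles_fold_ins) (use assms in \<open>auto simp: core_def\<close>)
  then have "singles (core w) \<subseteq> singles w" using fold_ins_core[OF assms, of ?v] by auto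
  moreover have "singles (core w) \<inter> singles w = {}"
    using singles_subset[of "core w"] by (auto simp: core_def)
  ultimately show ?thesis by blast
qed

lemma core_fold_ins:
  assumes "distinct (u @ v)" "singles u = {}"
  shows "core (fold ins v u) = u"
proof -
  have "core (fold ins v u) = filter (\<lambda>x. x \<notin> set v) (fold ins v u)"
    using assms by (simp add: core_def singles_fold_ins)
  also have "\<dots> = filter (\<lambda>x. x \<notin> set v) u" by (intro filter_fold_ins) auto
  also have "\<dots> = u" using assms by (auto simp: filter_id_conv)
  finally show ?thesis .
qed

lemma length_core:
  assumes "distinct w"
  shows "length (core w) + card (singles w) = length w"
proof -
  have "length (fold ins (sorted_list_of_set (singles w)) (core w)) = length w"
    using fold_ins_core[OF assms] by simp
  then show ?thesis by simp
qed

text \<open>The first letter of \<open>v\<close> is carried to its place in \<open>v'\<close> after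
  the tail has been arranged. \<open>R\<close> need not be symmetric, because the swap rule covers
  both directions; \<open>M\<close> restricts it to words with the given letters.\<close>

lemma adjacent_swaps_imp_permutation:
  assumes refl: "\<And>v. R v v" and trans: "\<And>u v w. R u v \<Longrightarrow> R v w \<Longrightarrow> R u w"
    and swap: "\<And>as x y bs. mset (as @ x # y # bs) = M \<Longrightarrow> R (as @ x # y # bs) (as @ y # x # bs)"
    and m: "mset v = mset v'" "mset (as @ v) = M"
  shows "R (as @ v) (as @ v')"
  using m
proof (induction v arbitrary: as v')
  case Nil
  then show ?case using refl by simp
next
  case (Cons x v)
  have "x \<in> set v'" using Cons.prems by (metis list.set_intros(1) mset_eq_setD)
  then obtain p s where v': "v' = p @ x # s" by (meson split_list)
  have mv: "mset v = mset (p @ s)" using Cons.prems v' by simp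
  have 1: "R ((as @ [x]) @ v) ((as @ [x]) @ (p @ s))"
    by (rule Cons.IH[OF mv]) (use Cons.prems in simp)
  have 2: "R (bs @ x # p @ s) (bs @ p @ x # s)" if "mset (bs @ x # p @ s) = M" for bs
    using that
  proof (induction p arbitrary: bs)
    case (Cons y p)
    have "R (bs @ x # y # p @ s) (bs @ y # x # p @ s)" by (rule swap) (use Cons.prems in simp)
    moreover have "R ((bs @ [y]) @ x # p @ s) ((bs @ [y]) @ p @ x # s)"
      by (rule Cons.IH) (use Cons.prems in \<open>simp add: add_mset_commute\<close>)
    ultimately show ?case using trans[of "bs @ x # y # p @ s" "bs @ y # x # p @ s"] by simp
  qed (use refl in simp)
  have "R (as @ x # p @ s) (as @ p @ x # s)" by (rule 2) (use Cons.prems mv in simp)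
  then show ?case using trans[OF 1] v' by simp
qed

text \<open>Swapping two neighbours among the inserted letters multiplies the vector by q or its
  inverse: a descent is swapped by a generator without correction, and
  \<open>multi_shuffle_hecke\<close> evaluates that generator. Membership in the span of one vector
  records proportionality, which is transitive.\<close>

lemma multi_shuffle_permute:
  fixes q :: "'k::field"
  assumes "q \<noteq> 0" "distinct (u @ v)" "mset v = mset v'"
  shows "multi_shuffle q (length u + length v) (length v) (word_fun (u @ v @ r))
    \<in> fv.span {multi_shuffle q (length u + length v) (length v) (word_fun (u @ v' @ r))}"
proof -
  let ?j = "length v"
  define B where "B x = (multi_shuffle q (length u + ?j) ?j (word_fun (u @ x @ r)) :: 'k wfun)" for x
  define R where "R x y \<longleftrightarrow> B x \<in> fv.span {B y}" for x y
  have desc: "B (as @ y # x # bs) = scl q (B (as @ x # y # bs))"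
    if "length (as @ x # y # bs) = ?j" "y < x" for as x y bs
  proof -
    let ?l = "Suc (length (u @ as))"
    have "word_fun (u @ (as @ y # x # bs) @ r) = hecke_op q ?l (word_fun ((u @ as) @ x # y # bs @ r))"
      using that by (subst hecke_op_word_fun) (auto)
    then have "B (as @ y # x # bs) = multi_shuffle q (length u + ?j) ?j (hecke_op q ?l (word_fun ((u @ as) @ x # y # bs @ r)))"
      unfolding B_def by simp
    also have "\<dots> = scl q (multi_shuffle q (length u + ?j) ?j (word_fun ((u @ as) @ x # y # bs @ r)))"
      by (rule multi_shuffle_hecke) (use assms(1) that(1) in auto)
    finally show ?thesis by (simp add: B_def)
  qed
  have "R ([] @ v) ([] @ v')"
  proof (rule adjacent_swaps_imp_permutation[where R = R and M = "mset v"])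
    show "R x x" for x by (simp add: R_def fv.span_base)
    show "R x z" if "R x y" "R y z" for x y z
      using that fv.span_minimal[of "{B y}" "fv.span {B z}"] fv.subspace_span unfolding R_def by blast
    fix as bs :: "nat list" and x y :: nat
    assume m: "mset (as @ x # y # bs) = mset v"
    then have l: "length (as @ x # y # bs) = ?j" by (metis size_mset)
    then have l': "length (as @ y # x # bs) = ?j" by simp
    have "distinct (as @ x # y # bs)" using m assms(2) mset_eq_imp_distinct_iff by (metis distinct_append)
    then have "x < y \<or> y < x" by auto
    then show "R (as @ x # y # bs) (as @ y # x # bs)"
    proof
      assume "x < y"
      then have "B (as @ x # y # bs) = scl q (B (as @ y # x # bs))" using desc[OF l'] by simp
      then show ?thesis by (simp add: R_def fv.span_base fv.span_scale)
    next
      assume "y < x"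
      then have "B (as @ y # x # bs) = scl q (B (as @ x # y # bs))" using desc[OF l] by simp
      then have "B (as @ x # y # bs) = scl (inverse q) (B (as @ y # x # bs))"
        using assms(1) by simp
      then show ?thesis by (simp add: R_def fv.span_base fv.span_scale)
    qed
  qed (use assms in auto)
  then show ?thesis by (simp add: R_def B_def)
qed

text \<open>The sorted order is a mere choice: by \<open>multi_shuffle_permute\<close> another one
  only rescales the vector. The leading word is \<open>w\<close> itself, because reinserting the
  single letters into the core restores \<open>w\<close>.\<close>

definition shuffle_basis :: "'k::field \<Rightarrow> nat list \<Rightarrow> nat list \<Rightarrow> 'k wfun" where
  "shuffle_basis q r w = multi_shuffle q (length w) (card (singles w))
     (word_fun (core w @ sorted_list_of_set (singles w) @ r))"

lemma shuffle_basis_leading_term: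
  fixes q :: "'k::field"
  assumes "q \<noteq> 0" "distinct w"
  shows "\<exists>c g. c \<noteq> 0 \<and> g \<in> fv.span (lower w r) \<and>
    shuffle_basis q r w = scl c (word_fun (w @ r)) + g"
  using multi_shuffle_leading_term[OF assms(1), of "core w" "sorted_list_of_set (singles w)" r]
    fold_ins_core[OF assms(2), of "sorted_list_of_set (singles w)"] length_core[OF assms(2)]
  unfolding shuffle_basis_def by (simp add: core_def assms(2) Int_def)

section \<open>Spanning, independence and the filtration by single letters\<close>

lemma lower_subset_permutations:
  "w \<in> permutations_of_set A \<Longrightarrow> lower w r \<subseteq> (\<lambda>x. word_fun (x @ r)) ` permutations_of_set A"
  unfolding lower_def permutations_of_set_def
  using mset_eq_setD mset_eq_imp_distinct_iff by fast

lemma word_fun_in_span_shuffle_basis: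
  fixes q :: "'k::field"
  assumes "q \<noteq> 0" "x \<in> permutations_of_set A"
  shows "word_fun (x @ r) \<in> fv.span (shuffle_basis q r ` permutations_of_set A)"
  using assms(2)
proof (induction x rule: wf_induct[OF wf_lex[OF wf_less_than]])
  case (1 x)
  let ?Sp = "fv.span (shuffle_basis q r ` permutations_of_set A)"
  have "distinct x" using 1 by (simp add: permutations_of_set_def)
  then obtain c g where cg: "c \<noteq> 0" "g \<in> fv.span (lower x r)"
    "shuffle_basis q r x = scl c (word_fun (x @ r)) + g"
    using shuffle_basis_leading_term assms(1) by blast
  have "lower x r \<subseteq> ?Sp"
  proof
    fix f :: "'k wfun" assume "f \<in> lower x r"
    then obtain y where y: "f = word_fun (y @ r)" "(y, x) \<in> lexl" "mset y = mset x"
      by (auto simp: lower_def)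
    then have "y \<in> permutations_of_set A" using 1(2)
      by (metis mset_eq_setD mset_eq_imp_distinct_iff permutations_of_setD permutations_of_setI)
    then show "f \<in> ?Sp" using 1(1) y by blast
  qed
  then have "g \<in> ?Sp" using cg(2) fv.span_minimal fv.subspace_span by blast
  moreover have "shuffle_basis q r x \<in> ?Sp" using 1 by (intro fv.span_base) auto
  ultimately have "scl (inverse c) (shuffle_basis q r x - g) \<in> ?Sp"
    by (intro fv.span_scale fv.span_diff)
  moreover have "scl (inverse c) (shuffle_basis q r x - g) = word_fun (x @ r)"
    using cg by simp
  ultimately show ?case by simp
qed

lemma shuffle_basis_in_span_word_fun:
  fixes q :: "'k::field"
  assumes "q \<noteq> 0" "w \<in> permutations_of_set A"
  shows "shuffle_basis q r w \<in> fv.span ((\<lambda>x. word_fun (x @ r)) ` permutations_of_set A)"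
proof -
  have "distinct w" using assms by (simp add: permutations_of_set_def)
  then obtain c g where cg: "g \<in> fv.span (lower w r)"
    "shuffle_basis q r w = scl c (word_fun (w @ r)) + g"
    using shuffle_basis_leading_term assms(1) by blast
  then have g: "g \<in> fv.span ((\<lambda>x. word_fun (x @ r)) ` permutations_of_set A)"
    using fv.span_mono[OF lower_subset_permutations[OF assms(2), of r]] by blast
  show ?thesis unfolding cg(2)
    by (rule fv.span_add[OF fv.span_scale[OF fv.span_base] g]) (use assms in auto)
qed

lemma multi_shuffle_excess: "n < j \<Longrightarrow> multi_shuffle q n j f = 0"
proof (induction j arbitrary: n)
  case (Suc j)
  then show ?case
    by (cases n) (simp_all add: fvp.linear_0[OF shuffle_op_linear] del: shuffle_op.simps(2))
qed simp

text \<open>Let v be the last j letters of x. The prefix is expanded in the shuffle basis of its own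
  alphabet, with v moved into the tail. Applying \<open>B_j\<close> lengthens the product in each
  basis vector: with k single letters it becomes \<open>B_{j+k}\<close> of a core followed by k + j
  letters, which is a multiple of a basis vector with at least j single letters.\<close>

lemma multi_shuffle_in_span_shuffle_basis:
  fixes q :: "'k::field"
  assumes "q \<noteq> 0" "x \<in> permutations_of_set A"
  shows "multi_shuffle q (length x) j (word_fun (x @ r))
    \<in> fv.span (shuffle_basis q r ` {w \<in> permutations_of_set A. j \<le> card (singles w)})"
    (is "_ \<in> ?Sp")
proof (cases "j \<le> length x")
  case False
  then show ?thesis by (simp add: multi_shuffle_excess fv.span_zero)
next
  case True
  define u v where "u = take (length x - j) x" and "v = drop (length x - j) x"
  have x: "x = u @ v" and lv: "length v = j" and lu: "length u = length x - j"
    using True by (auto simp: u_def v_def)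
  have dx: "distinct (u @ v)" "A = set u \<union> set v" using assms x by (auto simp: permutations_of_set_def)
  have "word_fun (u @ v @ r) \<in> fv.span (shuffle_basis q (v @ r) ` permutations_of_set (set u))"
    by (rule word_fun_in_span_shuffle_basis) (use assms dx in \<open>auto simp: permutations_of_set_def\<close>)
  then have "multi_shuffle q (length x) j (word_fun (u @ v @ r)) \<in> ?Sp"
  proof (rule fspan_linear_image[OF multi_shuffle_linear])
    fix f :: "'k wfun" assume "f \<in> shuffle_basis q (v @ r) ` permutations_of_set (set u)"
    then obtain w where f: "f = shuffle_basis q (v @ r) w" and w: "distinct w" "set w = set u"
      by (auto simp: permutations_of_set_def)
    let ?v = "sorted_list_of_set (singles w)" and ?u = "core w"
    \<comment> \<open>The word whose core is that of \<open>w\<close> and whose single letters are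
      those of \<open>w\<close> together with the letters of \<open>v\<close>; it indexes the basis
      vector obtained.\<close>
    let ?w = "fold ins (?v @ v) ?u"
    have lw: "length w = length u" using w dx by (metis distinct_append distinct_card)
    have sw: "singles w \<subseteq> set u" using singles_subset w by blast
    have du: "distinct (?u @ ?v @ v)" using w dx sw by (auto simp: core_def)
    have su: "set ?u \<union> singles w = set u" using w sw by (auto simp: core_def)
    have sw': "singles ?w = set (?v @ v)" using singles_fold_ins[of ?u "?v @ v"] du singles_core[OF w(1)] by simp
    have cw: "core ?w = ?u" by (rule core_fold_ins) (use du singles_core[OF w(1)] in auto)
    have lens: "length ?u + length (?v @ v) = length x" "length (?v @ v) = j + card (singles w)"
      using length_core[OF w(1)] lw lv lu True by auto
    have "distinct ?w" using du by (simp only: distinct_fold_ins)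
    have "mset (sorted_list_of_set (singles ?w)) = mset (?v @ v)"
      using sw' du by (metis distinct_append set_eq_iff_mset_eq_distinct
          distinct_sorted_list_of_set finite_singles set_sorted_list_of_set)
    then have ms: "mset (?v @ v) = mset (sorted_list_of_set (singles ?w))" by simp
    have "multi_shuffle q (length x) (j + card (singles w)) (word_fun (?u @ (?v @ v) @ r))
      \<in> fv.span {multi_shuffle q (length x) (j + card (singles w)) (word_fun (?u @ sorted_list_of_set (singles ?w) @ r))}"
      using multi_shuffle_permute[OF assms(1) du ms, of r] unfolding lens(1) unfolding lens(2) .
    moreover have "card (singles ?w) = j + card (singles w)"
      using sw' du lens(2) by (metis distinct_append distinct_card)
    moreover have "length ?w = length x" using lens(1) by simp
    ultimately have 1: "multi_shuffle q (length x) (j + card (singles w)) (word_fun (?u @ (?v @ v) @ r))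
      \<in> fv.span {shuffle_basis q r ?w}"
      by (simp only: shuffle_basis_def cw)
    have "?w \<in> {w \<in> permutations_of_set A. j \<le> card (singles w)}"
      using \<open>card (singles ?w) = _\<close> \<open>distinct ?w\<close> dx su by (auto simp: permutations_of_set_def)
    then have "fv.span {shuffle_basis q r ?w} \<subseteq> ?Sp" by (intro fv.span_mono) auto
    moreover have "multi_shuffle q (length x) j f
       = multi_shuffle q (length x) (j + card (singles w)) (word_fun (?u @ (?v @ v) @ r))"
      using multi_shuffle_compose[of q "length x" j "card (singles w)"] lw lu
      by (simp add: f shuffle_basis_def)
    ultimately show "multi_shuffle q (length x) j f \<in> ?Sp" using 1 by auto
  qed
  then show ?thesis using x by simp
qed

text \<open>By \<open>shuffle_op_multi_shuffle\<close> the difference is a multiple of the next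
  iterated shuffle of the same word, and that lies one layer deeper.\<close>

lemma shuffle_op_shuffle_basis:
  fixes q :: "'k::field"
  assumes "q \<noteq> 0" "w \<in> permutations_of_set A"
  shows "shuffle_op q (card A) (shuffle_basis q r w)
     - scl (\<Sum>i<card (singles w). q ^ (2 * i)) (shuffle_basis q r w)
    \<in> fv.span (shuffle_basis q r ` {w' \<in> permutations_of_set A. card (singles w) < card (singles w')})"
proof -
  have w: "distinct w" "set w = A" "card A = length w"
    using assms by (auto simp: permutations_of_set_def distinct_card)
  let ?x = "core w @ sorted_list_of_set (singles w)"
  have x: "?x \<in> permutations_of_set A" and lx: "length ?x = length w"
    using w singles_subset[of w] length_core[of w] by (auto simp: permutations_of_set_def core_def)
  have sb: "shuffle_basis q r w = multi_shuffle q (length w) (card (singles w)) (word_fun (?x @ r))"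
    by (simp add: shuffle_basis_def)
  have "multi_shuffle q (length w) (Suc (card (singles w))) (word_fun (?x @ r))
    \<in> fv.span (shuffle_basis q r ` {w' \<in> permutations_of_set A. Suc (card (singles w)) \<le> card (singles w')})"
    using multi_shuffle_in_span_shuffle_basis[OF assms(1) x] unfolding lx .
  then show ?thesis
    unfolding w(3) sb shuffle_op_multi_shuffle[OF assms(1)] add_diff_cancel_left' Suc_le_eq
    by (rule fv.span_scale)
qed

lemma word_fun_inject:
  assumes "length x = length y" "(word_fun x :: 'k::field wfun) = word_fun y"
  shows "x = y"
proof -
  have "(word_fun x :: 'k wfun) (pad x) = word_fun y (pad x)" using assms by simp
  then have "pad x = pad y" by (simp add: word_fun_def split: if_splits)
  then show ?thesis using pad_inject assms by blast
qed

lemma wfun_sum_apply: "(\<Sum>x\<in>X. f x) p = (\<Sum>x\<in>X. f x p)"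
  for f :: "'b \<Rightarrow> 'k::field wfun"
  by (induction X rule: infinite_finite_induct) (auto simp: zero_fun_apply plus_fun_apply)

text \<open>By counting: the family spans all word functions and is indexed by as many words, so a
  repetition or a dependence would give a spanning set that is too small.\<close>

lemma shuffle_basis_independent:
  fixes q :: "'k::field" and A :: "nat set"
  assumes q: "q \<noteq> 0" and A: "finite A"
  defines "P \<equiv> permutations_of_set A"
  shows "inj_on (shuffle_basis q r) P" "fv.independent (shuffle_basis q r ` P)"
proof -
  let ?B = "shuffle_basis q r ` P"
  let ?E = "(\<lambda>x. word_fun (x @ r) :: 'k wfun) ` P"
  have fP: "finite P" using A by (simp add: P_def)
  have len: "length x = card A" if "x \<in> P" for x using that by (auto simp: P_def permutations_of_set_def distinct_card)
  have inj: "inj_on (\<lambda>x. word_fun (x @ r) :: 'k wfun) P"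
    by (rule inj_onI) (metis len word_fun_inject length_append append_same_eq)
  have indE: "fv.independent ?E"
  proof (rule fv.independent_if_scalars_zero)
    show "finite ?E" using fP by simp
    fix f :: "'k wfun \<Rightarrow> 'k" and e assume s: "(\<Sum>x\<in>?E. scl (f x) x) = 0" and "e \<in> ?E"
    then obtain y where y: "y \<in> P" "e = word_fun (y @ r)" by auto
    have "0 = (\<Sum>x\<in>?E. scl (f x) x) (pad (y @ r))" by (simp only: s zero_fun_apply)
    also have "\<dots> = (\<Sum>x\<in>P. f (word_fun (x @ r)) * word_fun (x @ r) (pad (y @ r)))"
      by (simp add: sum.reindex[OF inj] wfun_sum_apply scl_apply)
    also have "\<dots> = (\<Sum>x\<in>P. if x = y then f (word_fun (y @ r)) else 0)"
      using y len pad_inject[of "_ @ r" "y @ r"] by (intro sum.cong) (auto simp: word_fun_def)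
    also have "\<dots> = f e" using y fP by simp
    finally show "f e = 0" by simp
  qed
  have cE: "card ?E = card P" by (rule card_image[OF inj])
  have sp: "?E \<subseteq> fv.span ?B" using word_fun_in_span_shuffle_basis[OF q] by (auto simp: P_def)
  have low: "card P \<le> card T" if "finite T" "?E \<subseteq> fv.span T" for T
    using fv.independent_span_bound[OF that(1) indE that(2)] cE by simp
  have "card ?B = card P" using low[OF _ sp] fP card_image_le[OF fP, of "shuffle_basis q r"] by simp
  then show "inj_on (shuffle_basis q r) P" using fP eq_card_imp_inj_on by blast
  show "fv.independent ?B"
  proof
    assume "fv.dependent ?B"
    then obtain b where b: "b \<in> ?B" "b \<in> fv.span (?B - {b})" unfolding fv.dependent_def by blast
    then have "fv.span ?B = fv.span (?B - {b})" by (metis fv.span_redundant insert_Diff)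
    then have "card P \<le> card (?B - {b})" using sp fP by (intro low) auto
    moreover have "card (?B - {b}) < card ?B" using b fP by (intro psubset_card_mono) auto
    ultimately show False using \<open>card ?B = card P\<close> by simp
  qed
qed

section \<open>Counting words by single letters\<close>

lemma sum_Pow_card:
  fixes h :: "nat \<Rightarrow> real"
  assumes "finite S"
  shows "(\<Sum>T\<in>Pow S. h (card T)) = (\<Sum>k\<le>card S. of_nat (card S choose k) * h k)"
proof -
  have "(\<Sum>T\<in>Pow S. h (card T)) = (\<Sum>k\<le>card S. \<Sum>T\<in>{T \<in> Pow S. card T = k}. h (card T))"
    by (rule sum.group[symmetric]) (use assms card_mono in auto)
  also have "\<dots> = (\<Sum>k\<le>card S. of_nat (card S choose k) * h k)"
  proof (rule sum.cong[OF refl])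
    fix k
    have "card {T \<in> Pow S. card T = k} = card S choose k"
      using n_subsets[OF assms, of k] by (simp add: Pow_def)
    then show "(\<Sum>T\<in>{T \<in> Pow S. card T = k}. h (card T)) = of_nat (card S choose k) * h k" by simp
  qed
  finally show ?thesis .
qed

text \<open>Permutations classified by fixed points and words classified by \<open>singles\<close> both satisfy the
  hypotheses, so the two statistics have the same distribution.\<close>

lemma card_statistic_eq:
  fixes s :: "nat set \<Rightarrow> 'x \<Rightarrow> nat set"
  assumes fin: "\<And>A. finite A \<Longrightarrow> finite (\<Omega> A)"
    and card: "\<And>A. finite A \<Longrightarrow> card (\<Omega> A) = fact (card A)"
    and sub: "\<And>A x. x \<in> \<Omega> A \<Longrightarrow> s A x \<subseteq> A"
    and fibre: "\<And>A V. finite A \<Longrightarrow> V \<subseteq> A \<Longrightarrow>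
      card {x \<in> \<Omega> A. s A x = V} = card {x \<in> \<Omega> (A - V). s (A - V) x = {}}"
    and A: "finite A" and j: "j \<le> card A"
  shows "real (card {x \<in> \<Omega> A. card (s A x) = j})
    = fact (card A) / fact j * (\<Sum>i=0..card A - j. (- 1) ^ i / fact i)"
proof -
  define X where "X A = real (card {x \<in> \<Omega> A. s A x = {}})" for A
  \<comment> \<open>Sort the objects over \<open>S\<close> by the value V of the statistic; the
    fibre over V is counted by \<open>X (S - V)\<close>, and complementation reindexes the
    sum.\<close>
  have tot: "fact (card S) = (\<Sum>T\<in>Pow S. X T)" if S: "finite S" for S
  proof -
    have "card (\<Omega> S) = (\<Sum>V\<in>Pow S. card {x \<in> \<Omega> S. s S x = V})"
      using sum.group[of "\<Omega> S" "Pow S" "s S" "\<lambda>_. 1::nat"] S fin[OF S] sub[of _ S]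
      by (simp add: image_subset_iff)
    also have "real \<dots> = (\<Sum>V\<in>Pow S. X (S - V))"
      unfolding of_nat_sum X_def using fibre[OF S] by (intro sum.cong) auto
    also have "\<dots> = (\<Sum>T\<in>Pow S. X T)"
      by (rule sum.reindex_bij_witness[of _ "\<lambda>T. S - T" "\<lambda>T. S - T"]) (auto simp: double_diff)
    finally show ?thesis using card[OF S] by simp
  qed
  have X: "X S = fact (card S) * (\<Sum>i=0..card S. (- 1) ^ i / fact i)" if S: "finite S" for S
  proof -
    let ?m = "card S"
    \<comment> \<open>Inversion over subsets in its symmetric form carries the sign on both sides,
      so it is applied to X multiplied by the sign.\<close>
    have "(- 1) ^ card S * X S = (\<Sum>T\<in>Pow S. (- 1) ^ card T * fact (card T))"
    proof (rule inclusion_exclusion_symmetric[OF _ S])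
      fix S :: "nat set" assume "finite S"
      then show "(fact (card S) :: real) = (\<Sum>T\<in>Pow S. (- 1) ^ card T * ((- 1) ^ card T * X T))"
        unfolding tot[OF \<open>finite S\<close>]
        by (intro sum.cong) (auto simp: minus_one_power_iff)
    qed
    also have "\<dots> = (\<Sum>k\<le>?m. of_nat (?m choose k) * ((- 1) ^ k * fact k))"
      using sum_Pow_card[OF S, of "\<lambda>k. (- 1) ^ k * fact k"] .
    also have "\<dots> = (\<Sum>k\<le>?m. fact ?m * ((- 1) ^ k / fact (?m - k)))"
      by (rule sum.cong) (auto simp: binomial_fact field_simps)
    also have "\<dots> = (\<Sum>i\<le>?m. fact ?m * ((- 1) ^ (?m - i) / fact i))"
      by (rule sum.reindex_bij_witness[of _ "\<lambda>k. ?m - k" "\<lambda>k. ?m - k"]) auto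
    also have "\<dots> = (- 1) ^ ?m * (fact ?m * (\<Sum>i\<le>?m. (- 1) ^ i / fact i))"
      unfolding sum_distrib_left by (rule sum.cong) (auto simp: minus_one_power_iff)
    finally show ?thesis by (simp add: atMost_atLeast0)
  qed
  have "card {x \<in> \<Omega> A. card (s A x) = j} = (\<Sum>V\<in>{V. V \<subseteq> A \<and> card V = j}. card {x \<in> \<Omega> A. s A x = V})"
  proof -
    have "card {x \<in> \<Omega> A. card (s A x) = j}
        = card (\<Union>V\<in>{V. V \<subseteq> A \<and> card V = j}. {x \<in> \<Omega> A. s A x = V})"
      using sub by (intro arg_cong[of _ _ card]) blast
    also have "\<dots> = (\<Sum>V\<in>{V. V \<subseteq> A \<and> card V = j}. card {x \<in> \<Omega> A. s A x = V})"
      using A fin by (intro card_UN_disjoint) auto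
    finally show ?thesis .
  qed
  also have "real \<dots> = (\<Sum>V\<in>{V. V \<subseteq> A \<and> card V = j}. X (A - V))"
    unfolding of_nat_sum X_def using fibre[OF A] by (intro sum.cong) auto
  also have "\<dots> = (\<Sum>V\<in>{V. V \<subseteq> A \<and> card V = j}.
      fact (card A - j) * (\<Sum>i=0..card A - j. (- 1) ^ i / fact i))"
    using A by (intro sum.cong) (auto simp: X card_Diff_subset finite_subset)
  also have "\<dots> = of_nat (card A choose j) * (fact (card A - j) * (\<Sum>i=0..card A - j. (- 1) ^ i / fact i))"
    by (simp add: n_subsets[OF A])
  also have "\<dots> = fact (card A) / fact j * (\<Sum>i=0..card A - j. (- 1) ^ i / fact i)"
    using j by (simp add: binomial_fact field_simps)
  finally show ?thesis .
qed

text \<open>A permutation of A with fixed point set V is the same thing as a fixed-point-free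
  permutation of \<open>A - V\<close>, so the fibres are equal as sets.\<close>

lemma card_permutes_fixed_points:
  assumes "j \<le> n"
  shows "real (card {p. p permutes {1..n} \<and> card {i \<in> {1..n}. p i = i} = j})
    = fact n / fact j * (\<Sum>i=0..n - j. (- 1) ^ i / fact i)"
proof -
  have "real (card {p \<in> {p. p permutes {1..n}}. card {i \<in> {1..n}. p i = i} = j})
    = fact (card {1..n}) / fact j * (\<Sum>i=0..card {1..n} - j. (- 1) ^ i / fact i)"
  proof (rule card_statistic_eq[where \<Omega> = "\<lambda>A. {p. p permutes A}" and s = "\<lambda>A p. {i \<in> A. p i = i}"])
    fix A V :: "nat set" assume "finite A" "V \<subseteq> A"
    have "{p \<in> {p. p permutes A}. {i \<in> A. p i = i} = V}
        = {p \<in> {p. p permutes (A - V)}. {i \<in> A - V. p i = i} = {}}"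
    proof (intro equalityI subsetI)
      fix p assume "p \<in> {p \<in> {p. p permutes A}. {i \<in> A. p i = i} = V}"
      then have "p permutes A" "{i \<in> A. p i = i} = V" by auto
      then show "p \<in> {p \<in> {p. p permutes (A - V)}. {i \<in> A - V. p i = i} = {}}"
        using permutes_superset[of p A "A - V"] by auto
    next
      fix p assume "p \<in> {p \<in> {p. p permutes (A - V)}. {i \<in> A - V. p i = i} = {}}"
      then have p: "p permutes (A - V)" "{i \<in> A - V. p i = i} = {}" by auto
      then have "\<forall>i\<in>V. p i = i" by (auto simp: permutes_not_in)
      then show "p \<in> {p \<in> {p. p permutes A}. {i \<in> A. p i = i} = V}"
        using p \<open>V \<subseteq> A\<close> permutes_subset[of p "A - V" A] by auto
    qed
    then show "card {p \<in> {p. p permutes A}. {i \<in> A. p i = i} = V}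
        = card {p \<in> {p. p permutes (A - V)}. {i \<in> A - V. p i = i} = {}}" by simp
  qed (use assms in \<open>auto simp: finite_permutations card_permutations\<close>)
  then show ?thesis by simp
qed

text \<open>Passing to the core and reinserting V are inverse bijections between the words with
  single letters V and the words over \<open>A - V\<close> without single letters.\<close>

lemma card_words_singles:
  assumes "j \<le> n"
  shows "real (card {w \<in> permutations_of_set {1..n}. card (singles w) = j})
    = fact n / fact j * (\<Sum>i=0..n - j. (- 1) ^ i / fact i)"
proof -
  have "real (card {w \<in> permutations_of_set {1..n}. card (singles w) = j})
    = fact (card {1..n}) / fact j * (\<Sum>i=0..card {1..n} - j. (- 1) ^ i / fact i)"
  proof (rule card_statistic_eq[where \<Omega> = permutations_of_set and s = "\<lambda>_. singles"])
    fix A V :: "nat set" assume A: "finite A" and V: "V \<subseteq> A"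
    then have fV: "finite V" using finite_subset by blast
    let ?v = "sorted_list_of_set V"
    have "bij_betw core {w \<in> permutations_of_set A. singles w = V}
        {u \<in> permutations_of_set (A - V). singles u = {}}"
    proof (rule bij_betw_byWitness[where f' = "fold ins ?v"])
      show "\<forall>w\<in>{w \<in> permutations_of_set A. singles w = V}. fold ins ?v (core w) = w"
        using fV by (auto intro!: fold_ins_core dest: permutations_of_setD)
      show "\<forall>u\<in>{u \<in> permutations_of_set (A - V). singles u = {}}. core (fold ins ?v u) = u"
        using fV by (auto simp: permutations_of_set_def intro!: core_fold_ins)
      show "core ` {w \<in> permutations_of_set A. singles w = V} \<subseteq> {u \<in> permutations_of_set (A - V). singles u = {}}"
        by (auto simp: permutations_of_set_def singles_core) (auto simp: core_def)
      show "fold ins ?v ` {u \<in> permutations_of_set (A - V). singles u = {}} \<subseteq> {w \<in> permutations_of_set A. singles w = V}"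
      proof (rule image_subsetI)
        fix u assume u: "u \<in> {u \<in> permutations_of_set (A - V). singles u = {}}"
        then have d: "distinct (u @ ?v)" "set u = A - V" using fV by (auto simp: permutations_of_set_def)
        then have "singles (fold ins ?v u) = V" using fV u by (simp only: singles_fold_ins) simp
        then show "fold ins ?v u \<in> {w \<in> permutations_of_set A. singles w = V}"
          using d fV V by (auto simp: permutations_of_set_def)
      qed
    qed
    then show "card {w \<in> permutations_of_set A. singles w = V} = card {u \<in> permutations_of_set (A - V). singles u = {}}"
      by (rule bij_betw_same_card)
  qed (use assms singles_subset in \<open>auto dest: permutations_of_setD\<close>)
  then show ?thesis by simp
qed

section \<open>Characteristic polynomials of operators\<close>

text \<open>The target has operations only on a carrier, so its addition and scaling enter as
  arbitrary functions \<open>pl\<close> and \<open>sc\<close>. The induction is on a bound for the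
  last nonzero coordinate.\<close>

lemma vec_linear_ext:
  fixes F G :: "'k::field vec \<Rightarrow> 'v"
  assumes F: "\<And>v w. v \<in> carrier_vec N \<Longrightarrow> w \<in> carrier_vec N \<Longrightarrow> F (v + w) = pl (F v) (F w)"
      "\<And>c v. v \<in> carrier_vec N \<Longrightarrow> F (c \<cdot>\<^sub>v v) = sc c (F v)"
    and G: "\<And>v w. v \<in> carrier_vec N \<Longrightarrow> w \<in> carrier_vec N \<Longrightarrow> G (v + w) = pl (G v) (G w)"
      "\<And>c v. v \<in> carrier_vec N \<Longrightarrow> G (c \<cdot>\<^sub>v v) = sc c (G v)"
    and zero: "F (0\<^sub>v N) = G (0\<^sub>v N)"
    and unit: "\<And>j. j < N \<Longrightarrow> F (unit_vec N j) = G (unit_vec N j)"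
    and v: "v \<in> carrier_vec N"
  shows "F v = G v"
proof -
  have "\<forall>v\<in>carrier_vec N. (\<forall>i<N. k \<le> i \<longrightarrow> v $ i = 0) \<longrightarrow> F v = G v" if "k \<le> N" for k
    using that
  proof (induction k)
    case 0
    then show ?case
    proof (intro ballI impI)
      fix v :: "'k vec" assume "v \<in> carrier_vec N" "\<forall>i<N. 0 \<le> i \<longrightarrow> v $ i = 0"
      then have "v = 0\<^sub>v N" by (intro eq_vecI) auto
      then show "F v = G v" using zero by simp
    qed
  next
    case (Suc k)
    show ?case
    proof (intro ballI impI)
      fix v :: "'k vec" assume v: "v \<in> carrier_vec N" "\<forall>i<N. Suc k \<le> i \<longrightarrow> v $ i = 0"
      define w where "w = vec N (\<lambda>i. if i = k then 0 else v $ i)"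
      have w: "w \<in> carrier_vec N" "\<forall>i<N. k \<le> i \<longrightarrow> w $ i = 0"
        using v by (auto simp: w_def)
      have "v = w + v $ k \<cdot>\<^sub>v unit_vec N k"
        using v Suc.prems by (intro eq_vecI) (auto simp: w_def)
      moreover have "F w = G w" using Suc w by auto
      ultimately show "F v = G v" using F G unit[of k] Suc.prems w
        by (metis Suc_le_lessD smult_carrier_vec unit_vec_carrier)
    qed
  qed
  from this[of N] show ?thesis using v by auto
qed

lemma mat_eqI_mult_vec:
  fixes A B :: "'k::field mat"
  assumes "A \<in> carrier_mat m n" "B \<in> carrier_mat m n" "\<And>v. v \<in> carrier_vec n \<Longrightarrow> A *\<^sub>v v = B *\<^sub>v v"
  shows "A = B"
proof (rule eq_matI)
  fix i j assume ij: "i < dim_row B" "j < dim_col B"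
  have "(A *\<^sub>v unit_vec n j) $ i = (B *\<^sub>v unit_vec n j) $ i" using assms(3) by simp
  then show "A $$ (i, j) = B $$ (i, j)" using ij assms(1,2) by simp
qed (use assms in auto)

text \<open>Coordinates are indexed by list positions, to be acted on by matrices; in
  \<open>lincomb\<close> the coefficients are indexed by the vectors themselves.\<close>

definition list_comb :: "('k::field, 'v, 'm) module_scheme \<Rightarrow> 'v list \<Rightarrow> 'k vec \<Rightarrow> 'v" where
  "list_comb V bs v = (\<Oplus>\<^bsub>V\<^esub>i\<in>{..<length bs}. v $ i \<odot>\<^bsub>V\<^esub> bs ! i)"

section \<open>Coordinates with respect to a basis\<close>

locale class_vectorspace = vectorspace "class_ring :: 'k::field ring" V
  for V :: "('k::field, 'v, 'm) module_scheme" (structure)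
begin

lemma list_comb_closed: "set bs \<subseteq> carrier V \<Longrightarrow> list_comb V bs v \<in> carrier V"
  unfolding list_comb_def by (intro finsum_closed) (auto simp: subset_iff)

lemma list_comb_add:
  assumes "set bs \<subseteq> carrier V" "v \<in> carrier_vec (length bs)" "w \<in> carrier_vec (length bs)"
  shows "list_comb V bs (v + w) = list_comb V bs v \<oplus> list_comb V bs w"
proof -
  have b: "bs ! i \<in> carrier V" if "i < length bs" for i using assms(1) that by auto
  have "list_comb V bs (v + w) = (\<Oplus>i\<in>{..<length bs}. v $ i \<odot> bs ! i \<oplus> w $ i \<odot> bs ! i)"
    unfolding list_comb_def
    by (intro finsum_cong') (use assms b smult_l_distr in auto)
  also have "\<dots> = list_comb V bs v \<oplus> list_comb V bs w"
    unfolding list_comb_def by (intro finsum_addf) (use b in auto)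
  finally show ?thesis .
qed

lemma list_comb_smult:
  assumes "set bs \<subseteq> carrier V" "v \<in> carrier_vec (length bs)"
  shows "list_comb V bs (c \<cdot>\<^sub>v v) = c \<odot> list_comb V bs v"
proof -
  have b: "bs ! i \<in> carrier V" if "i < length bs" for i using assms(1) that by auto
  have "list_comb V bs (c \<cdot>\<^sub>v v) = (\<Oplus>i\<in>{..<length bs}. c \<odot> (v $ i \<odot> bs ! i))"
    unfolding list_comb_def
    by (intro finsum_cong') (use assms b smult_assoc1 in auto)
  also have "\<dots> = c \<odot> list_comb V bs v"
    unfolding list_comb_def by (intro finsum_smult[symmetric]) (use b in auto)
  finally show ?thesis .
qed

lemma list_comb_unit:
  assumes "set bs \<subseteq> carrier V" "j < length bs"
  shows "list_comb V bs (unit_vec (length bs) j) = bs ! j"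
proof -
  have b: "bs ! i \<in> carrier V" if "i < length bs" for i using assms(1) that by auto
  have "list_comb V bs (unit_vec (length bs) j) = (\<Oplus>i\<in>{..<length bs}. if j = i then bs ! i else \<zero>)"
    unfolding list_comb_def
    by (intro finsum_cong') (use assms b smult_one lmult_0 in \<open>auto simp: unit_vec_def\<close>)
  also have "\<dots> = bs ! j" using assms b by (intro finsum_singleton) auto
  finally show ?thesis .
qed

lemma list_comb_zero:
  assumes "set bs \<subseteq> carrier V"
  shows "list_comb V bs (0\<^sub>v (length bs)) = \<zero>"
proof -
  have smult_vec_zero: "(0::'k) \<cdot>\<^sub>v 0\<^sub>v (length bs) = 0\<^sub>v (length bs)" by (intro eq_vecI) auto
  have "list_comb V bs (0 \<cdot>\<^sub>v 0\<^sub>v (length bs)) = 0 \<odot> list_comb V bs (0\<^sub>v (length bs))"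
    using assms by (intro list_comb_smult) auto
  also have "\<dots> = \<zero>" using lmult_0[OF list_comb_closed[OF assms]] by simp
  finally show ?thesis by (simp add: smult_vec_zero)
qed

lemma list_comb_lincomb:
  assumes "set bs \<subseteq> carrier V" "distinct bs"
  shows "list_comb V bs (vec (length bs) (\<lambda>i. a (bs ! i))) = lincomb a (set bs)"
proof -
  have "lincomb a (set bs) = (\<Oplus>x\<in>(!) bs ` {..<length bs}. a x \<odot> x)"
    by (simp add: lincomb_def set_conv_nth lessThan_def image_def setcompr_eq_image)
  also have "\<dots> = (\<Oplus>i\<in>{..<length bs}. a (bs ! i) \<odot> bs ! i)"
    using assms by (intro finsum_reindex)
      (auto simp: subset_iff nth_eq_iff_index_eq inj_on_def)
  also have "\<dots> = list_comb V bs (vec (length bs) (\<lambda>i. a (bs ! i)))"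
    unfolding list_comb_def using assms by (intro finsum_cong') (auto simp: subset_iff)
  finally show ?thesis by simp
qed

lemma list_comb_eq_lincomb:
  assumes "set bs \<subseteq> carrier V" "distinct bs" "v \<in> carrier_vec (length bs)"
  obtains a where "a \<in> set bs \<rightarrow>\<^sub>E UNIV" "lincomb a (set bs) = list_comb V bs v"
    "\<And>j. j < length bs \<Longrightarrow> a (bs ! j) = v $ j"
proof -
  \<comment> \<open>The position of a vector in \<open>bs\<close> is unique by distinctness.
    Restricting fixes the values off the list, so that the uniqueness in
    \<open>basis_criterion\<close> can compare coefficient functions.\<close>
  define a where "a = restrict (\<lambda>b. v $ (THE i. i < length bs \<and> bs ! i = b)) (set bs)"
  have "(THE i. i < length bs \<and> bs ! i = bs ! j) = j" if "j < length bs" for j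
    using that assms(2) by (auto simp: nth_eq_iff_index_eq)
  then have a: "a (bs ! j) = v $ j" if "j < length bs" for j
    using that by (simp add: a_def)
  have "vec (length bs) (\<lambda>i. a (bs ! i)) = v" using assms a by (intro eq_vecI) auto
  then have "lincomb a (set bs) = list_comb V bs v" using list_comb_lincomb[OF assms(1,2), of a] by simp
  moreover have "a \<in> set bs \<rightarrow>\<^sub>E UNIV" by (auto simp: a_def)
  ultimately show ?thesis using that a by blast
qed

lemma list_comb_surj:
  assumes "distinct bs" "basis (set bs)" "x \<in> carrier V"
  obtains v where "v \<in> carrier_vec (length bs)" "x = list_comb V bs v"
proof -
  have c: "set bs \<subseteq> carrier V" using assms by (simp add: basis_def)
  obtain a where "lincomb a (set bs) = x"
    using basis_criterion[of "set bs"] assms c by (metis List.finite_set)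
  then have "x = list_comb V bs (vec (length bs) (\<lambda>i. a (bs ! i)))"
    using list_comb_lincomb[OF c assms(1), of a] by simp
  then show ?thesis using that[of "vec (length bs) (\<lambda>i. a (bs ! i))"] by simp
qed

lemma list_comb_inj:
  assumes "distinct bs" "basis (set bs)" "v \<in> carrier_vec (length bs)" "w \<in> carrier_vec (length bs)"
    "list_comb V bs v = list_comb V bs w"
  shows "v = w"
proof -
  have c: "set bs \<subseteq> carrier V" using assms by (simp add: basis_def)
  obtain a where a: "a \<in> set bs \<rightarrow>\<^sub>E UNIV" "lincomb a (set bs) = list_comb V bs v"
    "\<And>j. j < length bs \<Longrightarrow> a (bs ! j) = v $ j" using list_comb_eq_lincomb[OF c assms(1,3)] by blast
  obtain b where b: "b \<in> set bs \<rightarrow>\<^sub>E UNIV" "lincomb b (set bs) = list_comb V bs w"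
    "\<And>j. j < length bs \<Longrightarrow> b (bs ! j) = w $ j" using list_comb_eq_lincomb[OF c assms(1,4)] by blast
  have "\<exists>!a. a \<in> set bs \<rightarrow>\<^sub>E carrier class_ring \<and> lincomb a (set bs) = list_comb V bs v"
    using basis_criterion[of "set bs"] assms c list_comb_closed[OF c] by auto
  then have "\<exists>!a. a \<in> set bs \<rightarrow>\<^sub>E UNIV \<and> lincomb a (set bs) = list_comb V bs v" by simp
  then have "a = b" using a b assms(5) by metis
  then show ?thesis using assms a(3) b(3) by (intro eq_vecI) auto
qed

lemma basis_listI:
  assumes c: "set bs \<subseteq> carrier V" and d: "distinct bs"
    and surj: "\<And>x. x \<in> carrier V \<Longrightarrow> \<exists>v\<in>carrier_vec (length bs). x = list_comb V bs v"
    and inj: "\<And>v. v \<in> carrier_vec (length bs) \<Longrightarrow> list_comb V bs v = \<zero> \<Longrightarrow> v = 0\<^sub>v (length bs)"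
  shows "basis (set bs)"
proof -
  have "lin_indpt (set bs)"
  proof (rule finite_lin_indpt2)
    fix a assume "lincomb a (set bs) = \<zero>"
    then have "vec (length bs) (\<lambda>i. a (bs ! i)) = 0\<^sub>v (length bs)"
      using list_comb_lincomb[OF c d, of a] by (intro inj) auto
    then have "a (bs ! i) = 0" if "i < length bs" for i
      using that by (metis index_vec index_zero_vec(1))
    then show "\<forall>v\<in>set bs. a v = \<zero>\<^bsub>class_ring\<^esub>" by (auto simp: in_set_conv_nth)
  qed (use c in auto)
  moreover have "x \<in> span (set bs)" if x: "x \<in> carrier V" for x
  proof -
    obtain v where v: "v \<in> carrier_vec (length bs)" "x = list_comb V bs v" using surj[OF x] by blast
    then obtain a where "lincomb a (set bs) = x" using list_comb_eq_lincomb[OF c d v(1)] by metis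
    then show ?thesis unfolding span_def by auto
  qed
  moreover have "span (set bs) \<subseteq> carrier V" using c by (intro span_is_subset2)
  ultimately show ?thesis using c unfolding basis_def by auto
qed

lemma operator_matrix_list_comb:
  assumes T: "\<And>x. x \<in> carrier V \<Longrightarrow> T x \<in> carrier V"
      "\<And>x y. x \<in> carrier V \<Longrightarrow> y \<in> carrier V \<Longrightarrow> T (x \<oplus> y) = T x \<oplus> T y"
      "\<And>c x. x \<in> carrier V \<Longrightarrow> T (c \<odot> x) = c \<odot> T x"
    and M: "operator_matrix V T bs M" and v: "v \<in> carrier_vec (length bs)"
  shows "T (list_comb V bs v) = list_comb V bs (M *\<^sub>v v)"
proof -
  let ?N = "length bs"
  have c: "set bs \<subseteq> carrier V" and Mc: "M \<in> carrier_mat ?N ?N"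
    and Tb: "\<And>j. j < ?N \<Longrightarrow> T (bs ! j) = (\<Oplus>i\<in>{..<?N}. M $$ (i, j) \<odot> bs ! i)"
    using M by (auto simp: operator_matrix_def basis_def)
  note lcc = list_comb_closed[OF c]
  have T0: "T \<zero> = \<zero>" using T(3)[of \<zero> 0] T(1)[of \<zero>] lmult_0 by simp
  show ?thesis
  proof (rule vec_linear_ext[where F = "\<lambda>v. T (list_comb V bs v)" and G = "\<lambda>v. list_comb V bs (M *\<^sub>v v)"
        and pl = "(\<oplus>)" and sc = "(\<odot>)", OF _ _ _ _ _ _ v])
    show "T (list_comb V bs (v + w)) = T (list_comb V bs v) \<oplus> T (list_comb V bs w)"
      if "v \<in> carrier_vec ?N" "w \<in> carrier_vec ?N" for v w
      using that by (simp add: list_comb_add[OF c] T lcc)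
    show "T (list_comb V bs (k \<cdot>\<^sub>v v)) = k \<odot> T (list_comb V bs v)" if "v \<in> carrier_vec ?N" for k v
      using that by (simp add: list_comb_smult[OF c] T lcc)
    show "list_comb V bs (M *\<^sub>v (v + w)) = list_comb V bs (M *\<^sub>v v) \<oplus> list_comb V bs (M *\<^sub>v w)"
      if "v \<in> carrier_vec ?N" "w \<in> carrier_vec ?N" for v w
      using that Mc by (simp add: mult_add_distrib_mat_vec[OF Mc] list_comb_add[OF c])
    show "list_comb V bs (M *\<^sub>v (k \<cdot>\<^sub>v v)) = k \<odot> list_comb V bs (M *\<^sub>v v)" if "v \<in> carrier_vec ?N" for k v
      using that Mc by (simp add: mult_mat_vec[OF Mc] list_comb_smult[OF c])
    show "T (list_comb V bs (0\<^sub>v ?N)) = list_comb V bs (M *\<^sub>v 0\<^sub>v ?N)"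
    proof -
      have "M *\<^sub>v 0\<^sub>v ?N = 0\<^sub>v ?N" using Mc by (intro eq_vecI) auto
      then show ?thesis using T0 by (simp add: list_comb_zero[OF c])
    qed
    show "T (list_comb V bs (unit_vec ?N j)) = list_comb V bs (M *\<^sub>v unit_vec ?N j)" if "j < ?N" for j
    proof -
      have "list_comb V bs (M *\<^sub>v unit_vec ?N j) = (\<Oplus>i\<in>{..<?N}. M $$ (i, j) \<odot> bs ! i)"
        unfolding list_comb_def
        by (intro finsum_cong') (use c Mc that in \<open>auto simp: subset_iff\<close>)
      then show ?thesis using Tb[OF that] list_comb_unit[OF c that] by simp
    qed
  qed
qed

lemma basis_change_mat:
  assumes "distinct bs" "basis (set bs)" "set bs' \<subseteq> carrier V"
  obtains P where "P \<in> carrier_mat (length bs) (length bs')"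
    "\<And>v. v \<in> carrier_vec (length bs') \<Longrightarrow> list_comb V bs' v = list_comb V bs (P *\<^sub>v v)"
proof -
  let ?N = "length bs" and ?N' = "length bs'"
  have c: "set bs \<subseteq> carrier V" using assms by (simp add: basis_def)
  have "\<forall>j<?N'. \<exists>v\<in>carrier_vec ?N. bs' ! j = list_comb V bs v"
    using list_comb_surj[OF assms(1,2)] assms(3) by (metis nth_mem subsetD)
  then obtain col where col: "\<And>j. j < ?N' \<Longrightarrow> col j \<in> carrier_vec ?N \<and> bs' ! j = list_comb V bs (col j)"
    by metis
  define P where "P = mat ?N ?N' (\<lambda>(i, j). col j $ i)"
  have P: "P \<in> carrier_mat ?N ?N'" by (simp add: P_def)
  have "list_comb V bs' v = list_comb V bs (P *\<^sub>v v)" if v: "v \<in> carrier_vec ?N'" for v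
  proof (rule vec_linear_ext[where F = "list_comb V bs'" and G = "\<lambda>v. list_comb V bs (P *\<^sub>v v)"
        and pl = "(\<oplus>)" and sc = "(\<odot>)", OF _ _ _ _ _ _ v])
    show "list_comb V bs (P *\<^sub>v (v + w)) = list_comb V bs (P *\<^sub>v v) \<oplus> list_comb V bs (P *\<^sub>v w)"
      if "v \<in> carrier_vec ?N'" "w \<in> carrier_vec ?N'" for v w
      using that P by (simp add: mult_add_distrib_mat_vec[OF P] list_comb_add[OF c])
    show "list_comb V bs (P *\<^sub>v (k \<cdot>\<^sub>v v)) = k \<odot> list_comb V bs (P *\<^sub>v v)" if "v \<in> carrier_vec ?N'" for k v
      using that P by (simp add: mult_mat_vec[OF P] list_comb_smult[OF c])
    show "list_comb V bs' (0\<^sub>v ?N') = list_comb V bs (P *\<^sub>v 0\<^sub>v ?N')"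
    proof -
      have "P *\<^sub>v 0\<^sub>v ?N' = 0\<^sub>v ?N" using P by (intro eq_vecI) auto
      then show ?thesis using list_comb_zero[OF c] list_comb_zero[OF assms(3)] by simp
    qed
    show "list_comb V bs' (unit_vec ?N' j) = list_comb V bs (P *\<^sub>v unit_vec ?N' j)" if "j < ?N'" for j
    proof -
      have "P *\<^sub>v unit_vec ?N' j = col j" using that col[OF that] by (intro eq_vecI) (auto simp: P_def)
      then show ?thesis using col[OF that] list_comb_unit[OF assms(3) that] by simp
    qed
  qed (use assms list_comb_add list_comb_smult in auto)
  then show ?thesis using that P by blast
qed

text \<open>The definite description has only one candidate: the matrices belonging to two bases are
  conjugate by the change of coordinates.\<close>

lemma operator_char_poly_eq:
  assumes T: "\<And>x. x \<in> carrier V \<Longrightarrow> T x \<in> carrier V"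
      "\<And>x y. x \<in> carrier V \<Longrightarrow> y \<in> carrier V \<Longrightarrow> T (x \<oplus> y) = T x \<oplus> T y"
      "\<And>c x. x \<in> carrier V \<Longrightarrow> T (c \<odot> x) = c \<odot> T x"
    and M: "operator_matrix V T bs M"
  shows "operator_char_poly V T = char_poly M"
  unfolding operator_char_poly_def
proof (rule the_equality)
  show "\<exists>bs M'. operator_matrix V T bs M' \<and> char_poly M = char_poly M'" using M by blast
  fix p assume "\<exists>bs M. operator_matrix V T bs M \<and> p = char_poly M"
  then obtain bs' M' where M': "operator_matrix V T bs' M'" and p: "p = char_poly M'" by blast
  have b: "distinct bs" "basis (set bs)" "set bs \<subseteq> carrier V" "M \<in> carrier_mat (length bs) (length bs)"
    and b': "distinct bs'" "basis (set bs')" "set bs' \<subseteq> carrier V" "M' \<in> carrier_mat (length bs') (length bs')"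
    using M M' by (auto simp: operator_matrix_def basis_def)
  have len: "length bs' = length bs"
    using dim_basis[of "set bs"] dim_basis[of "set bs'"] b b' by (simp add: distinct_card)
  obtain P where P: "P \<in> carrier_mat (length bs) (length bs)"
    and lP: "\<And>v. v \<in> carrier_vec (length bs) \<Longrightarrow> list_comb V bs' v = list_comb V bs (P *\<^sub>v v)"
    using basis_change_mat[OF b(1,2) b'(3)] len by auto
  obtain Q where Q: "Q \<in> carrier_mat (length bs) (length bs)"
    and lQ: "\<And>v. v \<in> carrier_vec (length bs) \<Longrightarrow> list_comb V bs v = list_comb V bs' (Q *\<^sub>v v)"
    using basis_change_mat[OF b'(1,2) b(3)] len by auto
  note inj = list_comb_inj[OF b(1,2)]
  have PQ: "P * Q = 1\<^sub>m (length bs)"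
  proof (rule mat_eqI_mult_vec)
    fix v :: "'k vec" assume v: "v \<in> carrier_vec (length bs)"
    have "list_comb V bs (P *\<^sub>v (Q *\<^sub>v v)) = list_comb V bs v"
      using lP[of "Q *\<^sub>v v"] lQ[OF v] Q v by simp
    then have "P *\<^sub>v (Q *\<^sub>v v) = v" using P Q v by (intro inj) auto
    then show "(P * Q) *\<^sub>v v = 1\<^sub>m (length bs) *\<^sub>v v" using P Q v by (simp add: assoc_mult_mat_vec)
  qed (use P Q in auto)
  have QP: "Q * P = 1\<^sub>m (length bs)"
    using mat_mult_left_right_inverse[OF P Q PQ] .
  \<comment> \<open>P turns \<open>bs'\<close>-coordinates into \<open>bs\<close>-coordinates, so
    both sides send the \<open>bs'\<close>-coordinates of a vector to the
    \<open>bs\<close>-coordinates of its image under T.\<close>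
  have MP: "M * P = P * M'"
  proof (rule mat_eqI_mult_vec)
    fix v :: "'k vec" assume v: "v \<in> carrier_vec (length bs)"
    have "list_comb V bs (M *\<^sub>v (P *\<^sub>v v)) = T (list_comb V bs (P *\<^sub>v v))"
      using operator_matrix_list_comb[OF T M, of "P *\<^sub>v v"] P v by simp
    also have "\<dots> = T (list_comb V bs' v)" using lP[OF v] by simp
    also have "\<dots> = list_comb V bs' (M' *\<^sub>v v)"
      using operator_matrix_list_comb[OF T M', of v] len v by simp
    also have "\<dots> = list_comb V bs (P *\<^sub>v (M' *\<^sub>v v))" using lP[of "M' *\<^sub>v v"] b'(4) len v by simp
    finally have "M *\<^sub>v (P *\<^sub>v v) = P *\<^sub>v (M' *\<^sub>v v)"
      using b b' P v len by (intro inj) auto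
    then show "(M * P) *\<^sub>v v = (P * M') *\<^sub>v v"
      using b b' P v len by (simp add: assoc_mult_mat_vec)
  qed (use b b' P len in auto)
  have "M = M * (P * Q)" using PQ b by simp
  also have "\<dots> = P * M' * Q" using MP P Q b by (simp add: assoc_mult_mat[symmetric, of _ "length bs" "length bs" _ "length bs" _ "length bs"])
  finally have "similar_mat M M'"
    using P Q PQ QP b b' len by (intro similar_matI[of _ _ P Q "length bs"]) auto
  then show "p = char_poly M" using p char_poly_similar by metis
qed

lemma operator_eigenvalue_root:
  assumes T: "\<And>x. x \<in> carrier V \<Longrightarrow> T x \<in> carrier V"
      "\<And>x y. x \<in> carrier V \<Longrightarrow> y \<in> carrier V \<Longrightarrow> T (x \<oplus> y) = T x \<oplus> T y"
      "\<And>c x. x \<in> carrier V \<Longrightarrow> T (c \<odot> x) = c \<odot> T x"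
    and M: "operator_matrix V T bs M" and e: "operator_eigenvalue V T c"
  shows "poly (char_poly M) c = 0"
proof -
  have b: "distinct bs" "basis (set bs)" "set bs \<subseteq> carrier V" "M \<in> carrier_mat (length bs) (length bs)"
    using M by (auto simp: operator_matrix_def basis_def)
  obtain x where x: "x \<in> carrier V" "x \<noteq> \<zero>" "T x = c \<odot> x" using e by (auto simp: operator_eigenvalue_def)
  obtain v where v: "v \<in> carrier_vec (length bs)" "x = list_comb V bs v"
    using list_comb_surj[OF b(1,2) x(1)] by blast
  have "list_comb V bs (M *\<^sub>v v) = list_comb V bs (c \<cdot>\<^sub>v v)"
    using operator_matrix_list_comb[OF T M v(1)] x(3) v by (simp add: list_comb_smult[OF b(3)])
  then have "M *\<^sub>v v = c \<cdot>\<^sub>v v" using b v by (intro list_comb_inj[OF b(1,2)]) auto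
  moreover have "v \<noteq> 0\<^sub>v (length bs)" using v x list_comb_zero[OF b(3)] by auto
  ultimately have "eigenvalue M c" using v b unfolding eigenvalue_def eigenvector_def by auto
  then show ?thesis using eigenvalue_root_char_poly[OF b(4)] by simp
qed

end

section \<open>Group algebras and their quotients\<close>

lemma pres_cong_gwords: "(u, v) \<in> pres_cong X R \<Longrightarrow> u \<in> gwords X \<and> v \<in> gwords X"
  by (induction rule: pres_cong.induct) (auto simp: gwords_def)

lemma equiv_pres_cong: "equiv (gwords X) (pres_cong X R)"
proof (rule equivI)
  show "pres_cong X R \<subseteq> gwords X \<times> gwords X" by (auto dest: pres_cong_gwords)
  show "refl_on (gwords X) (pres_cong X R)" by (auto intro: refl_onI pres_refl)
  show "sym (pres_cong X R)" by (auto intro: symI pres_sym)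
  show "trans (pres_cong X R)" by (auto intro: transI pres_trans)
qed

lemma pres_cong_append:
  assumes "(u, u') \<in> pres_cong X R" "(v, v') \<in> pres_cong X R"
  shows "(u @ v, u' @ v') \<in> pres_cong X R"
proof -
  have g: "u \<in> gwords X" "u' \<in> gwords X" "v \<in> gwords X" "v' \<in> gwords X" "[] \<in> gwords X"
    using pres_cong_gwords[OF assms(1)] pres_cong_gwords[OF assms(2)] by (auto simp: gwords_def)
  have "([] @ u @ v, [] @ u' @ v) \<in> pres_cong X R" by (rule pres_context[OF assms(1) g(5) g(3)])
  moreover have "(u' @ v @ [], u' @ v' @ []) \<in> pres_cong X R" by (rule pres_context[OF assms(2) g(2) g(5)])
  ultimately show ?thesis using pres_trans by fastforce
qed

abbreviation pres_class :: "'g set \<Rightarrow> ('g gword \<times> 'g gword) set \<Rightarrow> 'g gword \<Rightarrow> 'g gword set" where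
  "pres_class X R u \<equiv> pres_cong X R `` {u}"

text \<open>The union in the definition runs over all representatives, but the congruence makes all
  its members the same class.\<close>

lemma presented_group_mult:
  assumes "u \<in> gwords X" "v \<in> gwords X"
  shows "pres_class X R u \<otimes>\<^bsub>presented_group X R\<^esub> pres_class X R v = pres_class X R (u @ v)"
proof -
  have "pres_class X R (u' @ v') = pres_class X R (u @ v)"
    if "u' \<in> pres_class X R u" "v' \<in> pres_class X R v" for u' v'
    using that equiv_class_eq[OF equiv_pres_cong] pres_cong_append by (metis ImageE singletonD)
  moreover have "u \<in> pres_class X R u" "v \<in> pres_class X R v" using assms by (auto intro: pres_refl)
  ultimately have "(\<Union>u'\<in>pres_class X R u. \<Union>v'\<in>pres_class X R v. pres_class X R (u' @ v'))
     = pres_class X R (u @ v)" by blast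
  then show ?thesis by (simp add: presented_group_def)
qed

lemma presented_group_carrier:
  "carrier (presented_group X R) = pres_class X R ` gwords X"
  by (auto simp: presented_group_def quotient_def)

lemma monoid_presented_group: "monoid (presented_group X R)"
proof (rule monoidI)
  let ?G = "presented_group X R"
  have app: "u @ v \<in> gwords X" if "u \<in> gwords X" "v \<in> gwords X" for u v
    using that by (auto simp: gwords_def)
  have nil: "[] \<in> gwords X" by (simp add: gwords_def)
  have one: "\<one>\<^bsub>?G\<^esub> = pres_class X R []" by (simp add: presented_group_def)
  fix x y z
  assume "x \<in> carrier (?G)"
  then obtain u where u: "u \<in> gwords X" "x = pres_class X R u" by (auto simp: presented_group_carrier)
  show "\<one>\<^bsub>?G\<^esub> \<otimes>\<^bsub>?G\<^esub> x = x"
    "x \<otimes>\<^bsub>?G\<^esub> \<one>\<^bsub>?G\<^esub> = x"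
    using u nil by (simp_all add: one presented_group_mult)
  assume "y \<in> carrier (?G)"
  then obtain v where v: "v \<in> gwords X" "y = pres_class X R v" by (auto simp: presented_group_carrier)
  show "x \<otimes>\<^bsub>?G\<^esub> y \<in> carrier (?G)"
    using u v app by (simp add: presented_group_mult presented_group_carrier)
  assume "z \<in> carrier (?G)"
  then obtain w where w: "w \<in> gwords X" "z = pres_class X R w" by (auto simp: presented_group_carrier)
  show "x \<otimes>\<^bsub>?G\<^esub> y \<otimes>\<^bsub>?G\<^esub> z
      = x \<otimes>\<^bsub>?G\<^esub> (y \<otimes>\<^bsub>?G\<^esub> z)"
    using u v w app by (simp add: presented_group_mult)
next
  let ?G = "presented_group X R"
  show "\<one>\<^bsub>?G\<^esub> \<in> carrier (?G)"
    unfolding presented_group_carrier by (auto simp: presented_group_def gwords_def)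
qed

text \<open>Pairing with test functions turns the convolution product into an iterated sum.\<close>

definition pairing :: "('g \<Rightarrow> 'k::field) \<Rightarrow> ('g \<Rightarrow> 'k) \<Rightarrow> 'k" where
  "pairing f t = (\<Sum>g | f g \<noteq> 0. f g * t g)"

lemma pairing_superset:
  assumes "finite S" "{g. f g \<noteq> 0} \<subseteq> S"
  shows "pairing f t = (\<Sum>g\<in>S. f g * t g)"
  unfolding pairing_def using assms by (intro sum.mono_neutral_left) auto

lemma pairing_delta: "finite {g. f g \<noteq> 0} \<Longrightarrow> pairing f (\<lambda>h. if h = g then 1 else 0) = f g"
  by (auto simp: pairing_def if_distrib[of "\<lambda>x. _ * x"] cong: if_cong)

lemma pairing_add_left:
  assumes "finite {g. f g \<noteq> 0}" "finite {g. f' g \<noteq> 0}"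
  shows "pairing (\<lambda>g. f g + f' g) t = pairing f t + pairing f' t"
proof -
  let ?S = "{g. f g \<noteq> 0} \<union> {g. f' g \<noteq> 0}"
  have "pairing (\<lambda>g. f g + f' g) t = (\<Sum>g\<in>?S. (f g + f' g) * t g)"
    "pairing f t = (\<Sum>g\<in>?S. f g * t g)" "pairing f' t = (\<Sum>g\<in>?S. f' g * t g)"
    using assms by (intro pairing_superset; auto)+
  then show ?thesis by (simp add: sum.distrib distrib_right)
qed

lemma pairing_scale_left: "pairing (\<lambda>g. c * f g) t = c * pairing f t"
  by (cases "c = 0") (auto simp: pairing_def sum_distrib_left mult.assoc)

lemma pairing_add_right: "pairing f (\<lambda>g. t g + t' g) = pairing f t + pairing f t'"
  by (simp add: pairing_def sum.distrib distrib_left)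

lemma pairing_scale_right: "pairing f (\<lambda>g. c * t g) = c * pairing f t"
  by (simp add: pairing_def sum_distrib_left mult_ac)

lemma pairing_cong: "(\<And>g. f g \<noteq> 0 \<Longrightarrow> t g = t' g) \<Longrightarrow> pairing f t = pairing f t'"
  by (simp add: pairing_def)

lemma pairing_elem: "pairing (group_algebra_elem g) t = t g"
proof -
  have "pairing (group_algebra_elem g) t = (\<Sum>h\<in>{g}. group_algebra_elem g h * t h)"
    by (rule pairing_superset) (auto simp: group_algebra_elem_def)
  then show ?thesis by (simp add: group_algebra_elem_def)
qed

section \<open>The group algebra as a ring and a module\<close>

lemma group_algebra_carrier:
  "f \<in> carrier (group_algebra G) \<longleftrightarrow> finite {g. f g \<noteq> 0} \<and> {g. f g \<noteq> 0} \<subseteq> carrier G"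
  by (simp add: group_algebra_def)

lemma group_algebra_simps:
  "zero (group_algebra G) = (\<lambda>g. 0)" "add (group_algebra G) f f' = (\<lambda>g. f g + f' g)"
  "smult (group_algebra G) c f = (\<lambda>g. c * f g)"
  "one (group_algebra G) = group_algebra_elem \<one>\<^bsub>G\<^esub>"
  by (simp_all add: group_algebra_def group_algebra_elem_def fun_eq_iff)

lemma group_algebra_mult_apply:
  assumes "finite {h. f h \<noteq> 0}" "finite {h. f' h \<noteq> 0}"
  shows "(f \<otimes>\<^bsub>group_algebra G\<^esub> f') g
    = (\<Sum>h | f h \<noteq> 0. \<Sum>h' | f' h' \<noteq> 0. f h * f' h' * (if h \<otimes>\<^bsub>G\<^esub> h' = g then 1 else 0))"
proof -
  let ?S = "{h. f h \<noteq> 0}" and ?S' = "{h. f' h \<noteq> 0}"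
  have "(f \<otimes>\<^bsub>group_algebra G\<^esub> f') g
     = (\<Sum>(h, h')\<in>{x \<in> ?S \<times> ?S'. fst x \<otimes>\<^bsub>G\<^esub> snd x = g}. f h * f' h')"
    unfolding group_algebra_def by (auto intro!: sum.cong)
  also have "\<dots> = (\<Sum>x\<in>?S \<times> ?S'. if fst x \<otimes>\<^bsub>G\<^esub> snd x = g then f (fst x) * f' (snd x) else 0)"
    unfolding case_prod_beta by (rule sum.inter_filter) (use assms in simp)
  also have "\<dots> = (\<Sum>h\<in>?S. \<Sum>h'\<in>?S'. f h * f' h' * (if h \<otimes>\<^bsub>G\<^esub> h' = g then 1 else 0))"
    unfolding sum.cartesian_product by (intro sum.cong) auto
  finally show ?thesis .
qed

lemma group_algebra_mult_support:
  assumes "finite {h. f h \<noteq> 0}" "finite {h. f' h \<noteq> 0}"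
  shows "{g. (f \<otimes>\<^bsub>group_algebra G\<^esub> f') g \<noteq> 0} \<subseteq> (\<lambda>(h, h'). h \<otimes>\<^bsub>G\<^esub> h') ` ({h. f h \<noteq> 0} \<times> {h. f' h \<noteq> 0})"
  (is "_ \<subseteq> ?T")
proof
  fix g assume g: "g \<in> {g. (f \<otimes>\<^bsub>group_algebra G\<^esub> f') g \<noteq> 0}"
  show "g \<in> ?T"
  proof (rule ccontr)
    assume "g \<notin> ?T"
    then have ne: "h \<otimes>\<^bsub>G\<^esub> h' \<noteq> g" if "f h \<noteq> 0" "f' h' \<noteq> 0" for h h' using that by force
    have "(f \<otimes>\<^bsub>group_algebra G\<^esub> f') g = 0"
      unfolding group_algebra_mult_apply[OF assms] by (intro sum.neutral ballI) (simp add: ne)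
    then show False using g by simp
  qed
qed

text \<open>Each pair (h, h') contributes to the single element g = h h', so the sum over g
  collapses. Since pairings separate elements (\<open>group_algebra_eqI\<close>), the ring laws
  become identities between iterated sums.\<close>

lemma pairing_mult:
  assumes "finite {h. f h \<noteq> 0}" "finite {h. f' h \<noteq> 0}"
  shows "pairing (f \<otimes>\<^bsub>group_algebra G\<^esub> f') t = pairing f (\<lambda>h. pairing f' (\<lambda>h'. t (h \<otimes>\<^bsub>G\<^esub> h')))"
proof -
  let ?S = "{h. f h \<noteq> 0}" and ?S' = "{h. f' h \<noteq> 0}"
  let ?T = "(\<lambda>(h, h'). h \<otimes>\<^bsub>G\<^esub> h') ` (?S \<times> ?S')"
  have fT: "finite ?T" using assms by simp
  have "pairing (f \<otimes>\<^bsub>group_algebra G\<^esub> f') t = (\<Sum>g\<in>?T. (f \<otimes>\<^bsub>group_algebra G\<^esub> f') g * t g)"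
    by (rule pairing_superset[OF fT group_algebra_mult_support[OF assms]])
  also have "\<dots> = (\<Sum>g\<in>?T. \<Sum>h\<in>?S. \<Sum>h'\<in>?S'. f h * f' h' * (if h \<otimes>\<^bsub>G\<^esub> h' = g then t g else 0))"
    unfolding group_algebra_mult_apply[OF assms] sum_distrib_right by (intro sum.cong) auto
  also have "\<dots> = (\<Sum>h\<in>?S. \<Sum>h'\<in>?S'. \<Sum>g\<in>?T. f h * f' h' * (if h \<otimes>\<^bsub>G\<^esub> h' = g then t g else 0))"
    by (subst sum.swap, rule sum.cong[OF refl], rule sum.swap)
  also have "\<dots> = (\<Sum>h\<in>?S. \<Sum>h'\<in>?S'. f h * f' h' * t (h \<otimes>\<^bsub>G\<^esub> h'))"
  proof (intro sum.cong[OF refl])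
    fix h h' assume "h \<in> ?S" "h' \<in> ?S'"
    then have "h \<otimes>\<^bsub>G\<^esub> h' \<in> ?T" by force
    then show "(\<Sum>g\<in>?T. f h * f' h' * (if h \<otimes>\<^bsub>G\<^esub> h' = g then t g else 0)) = f h * f' h' * t (h \<otimes>\<^bsub>G\<^esub> h')"
      using fT by (simp add: sum_distrib_left[symmetric])
  qed
  finally show ?thesis by (simp add: pairing_def sum_distrib_left mult.assoc)
qed

lemma group_algebra_eqI:
  assumes "f \<in> carrier (group_algebra G)" "f' \<in> carrier (group_algebra G)"
    "\<And>t. pairing f t = pairing f' t"
  shows "f = f'"
proof
  fix g show "f g = f' g"
    using assms pairing_delta[of f g] pairing_delta[of f' g] by (simp add: group_algebra_carrier)
qed

lemma group_algebra_elem_carrier: "g \<in> carrier G \<Longrightarrow> group_algebra_elem g \<in> carrier (group_algebra G)"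
  by (auto simp: group_algebra_carrier group_algebra_elem_def)

lemma group_algebra_mult_closed:
  assumes "monoid G" "f \<in> carrier (group_algebra G)" "f' \<in> carrier (group_algebra G)"
  shows "f \<otimes>\<^bsub>group_algebra G\<^esub> f' \<in> carrier (group_algebra G)"
proof -
  interpret monoid G by fact
  have f: "finite {h. f h \<noteq> 0}" "finite {h. f' h \<noteq> 0}" using assms by (auto simp: group_algebra_carrier)
  let ?T = "(\<lambda>(h, h'). h \<otimes>\<^bsub>G\<^esub> h') ` ({h. f h \<noteq> 0} \<times> {h. f' h \<noteq> 0})"
  have "finite ?T" "?T \<subseteq> carrier G" using f assms(2,3) by (auto simp: group_algebra_carrier subset_iff)
  then show ?thesis using group_algebra_mult_support[OF f, of G]
    unfolding group_algebra_carrier by (meson finite_subset subset_trans)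
qed

lemma group_algebra_add_closed:
  "f \<in> carrier (group_algebra G) \<Longrightarrow> f' \<in> carrier (group_algebra G)
    \<Longrightarrow> (\<lambda>g. f g + f' g) \<in> carrier (group_algebra G)"
proof -
  assume "f \<in> carrier (group_algebra G)" "f' \<in> carrier (group_algebra G)"
  moreover have "{g. f g + f' g \<noteq> 0} \<subseteq> {g. f g \<noteq> 0} \<union> {g. f' g \<noteq> 0}" by auto
  ultimately show ?thesis unfolding group_algebra_carrier
    by (meson finite_UnI finite_subset le_sup_iff subset_trans)
qed

lemma group_algebra_scale_closed:
  "f \<in> carrier (group_algebra G) \<Longrightarrow> (\<lambda>g. c * f g) \<in> carrier (group_algebra G)"
  unfolding group_algebra_carrier by (auto intro: finite_subset[of _ "{g. f g \<noteq> 0}"])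

lemma group_algebra_elem_mult:
  fixes G :: "('a, 'b) monoid_scheme"
  assumes "monoid G" "g \<in> carrier G" "h \<in> carrier G"
  shows "group_algebra_elem g \<otimes>\<^bsub>group_algebra G\<^esub> group_algebra_elem h
    = (group_algebra_elem (g \<otimes>\<^bsub>G\<^esub> h) :: _ \<Rightarrow> 'k::field)"
proof (rule group_algebra_eqI[where G = G])
  interpret monoid G by fact
  have fin: "finite {x. (group_algebra_elem y x :: 'k) \<noteq> 0}" for y :: 'a
    by (simp add: group_algebra_elem_def)
  have c: "(group_algebra_elem g :: _ \<Rightarrow> 'k) \<in> carrier (group_algebra G)"
    "(group_algebra_elem h :: _ \<Rightarrow> 'k) \<in> carrier (group_algebra G)"
    by (rule group_algebra_elem_carrier[OF assms(2)], rule group_algebra_elem_carrier[OF assms(3)])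
  show "group_algebra_elem g \<otimes>\<^bsub>group_algebra G\<^esub> group_algebra_elem h \<in> carrier (group_algebra G :: ('k, _) module)"
    by (rule group_algebra_mult_closed[OF assms(1) c])
  show "(group_algebra_elem (g \<otimes>\<^bsub>G\<^esub> h) :: _ \<Rightarrow> 'k) \<in> carrier (group_algebra G)"
    by (rule group_algebra_elem_carrier[OF m_closed[OF assms(2,3)]])
  show "pairing (group_algebra_elem g \<otimes>\<^bsub>group_algebra G\<^esub> group_algebra_elem h) t
     = pairing (group_algebra_elem (g \<otimes>\<^bsub>G\<^esub> h)) t" for t :: "_ \<Rightarrow> 'k"
    unfolding pairing_mult[OF fin fin] pairing_elem ..
qed

lemma ring_group_algebra:
  assumes "monoid G"
  shows "ring (group_algebra G :: ('k::field, _) module)"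
proof -
  interpret monoid G by fact
  let ?A = "group_algebra G :: ('k, _) module"
  note simps = group_algebra_simps
  have fin: "finite {h. f h \<noteq> 0}" if "f \<in> carrier ?A" for f using that by (simp add: group_algebra_carrier)
  have supp: "h \<in> carrier G" if "f \<in> carrier ?A" "f h \<noteq> 0" for f h
    using that by (auto simp: group_algebra_carrier)
  note closed = group_algebra_mult_closed[OF assms] group_algebra_add_closed group_algebra_elem_carrier
  show ?thesis
  proof (rule ringI)
    show "abelian_group ?A"
    proof (rule abelian_groupI)
      fix x assume x: "x \<in> carrier ?A"
      show "\<exists>y\<in>carrier ?A. y \<oplus>\<^bsub>?A\<^esub> x = \<zero>\<^bsub>?A\<^esub>"
        by (rule bexI[of _ "\<lambda>g. (- 1) * x g"])
          (use group_algebra_scale_closed[OF x, of "- 1"] in \<open>auto simp: simps\<close>)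
    next
      show "x \<oplus>\<^bsub>?A\<^esub> y \<in> carrier ?A" if "x \<in> carrier ?A" "y \<in> carrier ?A" for x y
        unfolding simps by (rule closed(2)[OF that])
      show "\<zero>\<^bsub>?A\<^esub> \<in> carrier ?A" by (simp add: simps group_algebra_carrier)
    qed (auto simp: simps add_ac)
    show "monoid ?A"
    proof (rule monoidI)
      fix x y z assume x: "x \<in> carrier ?A" and y: "y \<in> carrier ?A" and z: "z \<in> carrier ?A"
      show "x \<otimes>\<^bsub>?A\<^esub> y \<otimes>\<^bsub>?A\<^esub> z = x \<otimes>\<^bsub>?A\<^esub> (y \<otimes>\<^bsub>?A\<^esub> z)"
      proof (rule group_algebra_eqI[where G = G])
        show "pairing (x \<otimes>\<^bsub>?A\<^esub> y \<otimes>\<^bsub>?A\<^esub> z) t = pairing (x \<otimes>\<^bsub>?A\<^esub> (y \<otimes>\<^bsub>?A\<^esub> z)) t" for t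
          unfolding pairing_mult[OF fin[OF closed(1)[OF x y]] fin[OF z]] pairing_mult[OF fin[OF x] fin[OF y]]
            pairing_mult[OF fin[OF x] fin[OF closed(1)[OF y z]]] pairing_mult[OF fin[OF y] fin[OF z]]
          by (intro pairing_cong) (use supp[OF x] supp[OF y] supp[OF z] m_assoc in simp)
      qed (intro closed(1) x y z)+
    next
      fix x assume x: "x \<in> carrier ?A"
      have o: "group_algebra_elem \<one>\<^bsub>G\<^esub> \<in> carrier ?A" by (rule closed) simp
      show "\<one>\<^bsub>?A\<^esub> \<otimes>\<^bsub>?A\<^esub> x = x" unfolding simps
      proof (rule group_algebra_eqI[where G = G])
        show "pairing (group_algebra_elem \<one>\<^bsub>G\<^esub> \<otimes>\<^bsub>?A\<^esub> x) t = pairing x t" for t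
          unfolding pairing_mult[OF fin[OF o] fin[OF x]] pairing_elem
          by (intro pairing_cong) (use supp[OF x] in simp)
      qed (intro closed(1) x o)+
      show "x \<otimes>\<^bsub>?A\<^esub> \<one>\<^bsub>?A\<^esub> = x" unfolding simps
      proof (rule group_algebra_eqI[where G = G])
        show "pairing (x \<otimes>\<^bsub>?A\<^esub> group_algebra_elem \<one>\<^bsub>G\<^esub>) t = pairing x t" for t
          unfolding pairing_mult[OF fin[OF x] fin[OF o]] pairing_elem
          by (intro pairing_cong) (use supp[OF x] in simp)
      qed (intro closed(1) x o)+
    next
      show "\<one>\<^bsub>?A\<^esub> \<in> carrier ?A" unfolding simps by (rule closed(3)) simp
    qed (rule closed(1))
  next
    fix x y z assume x: "x \<in> carrier ?A" and y: "y \<in> carrier ?A" and z: "z \<in> carrier ?A"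
    have xy: "(\<lambda>g. x g + y g) \<in> carrier ?A" using x y closed by blast
    show "(x \<oplus>\<^bsub>?A\<^esub> y) \<otimes>\<^bsub>?A\<^esub> z = x \<otimes>\<^bsub>?A\<^esub> z \<oplus>\<^bsub>?A\<^esub> y \<otimes>\<^bsub>?A\<^esub> z" unfolding simps
    proof (rule group_algebra_eqI[where G = G])
      show "pairing ((\<lambda>g. x g + y g) \<otimes>\<^bsub>?A\<^esub> z) t = pairing (\<lambda>g. (x \<otimes>\<^bsub>?A\<^esub> z) g + (y \<otimes>\<^bsub>?A\<^esub> z) g) t" for t
        unfolding pairing_add_left[OF fin[OF closed(1)[OF x z]] fin[OF closed(1)[OF y z]]]
          pairing_mult[OF fin[OF xy] fin[OF z]] pairing_mult[OF fin[OF x] fin[OF z]]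
          pairing_mult[OF fin[OF y] fin[OF z]] pairing_add_left[OF fin[OF x] fin[OF y]] by simp
    qed (rule closed(1)[OF xy z], rule closed(2)[OF closed(1)[OF x z] closed(1)[OF y z]])
    show "z \<otimes>\<^bsub>?A\<^esub> (x \<oplus>\<^bsub>?A\<^esub> y) = z \<otimes>\<^bsub>?A\<^esub> x \<oplus>\<^bsub>?A\<^esub> z \<otimes>\<^bsub>?A\<^esub> y" unfolding simps
    proof (rule group_algebra_eqI[where G = G])
      show "pairing (z \<otimes>\<^bsub>?A\<^esub> (\<lambda>g. x g + y g)) t = pairing (\<lambda>g. (z \<otimes>\<^bsub>?A\<^esub> x) g + (z \<otimes>\<^bsub>?A\<^esub> y) g) t" for t
        unfolding pairing_add_left[OF fin[OF closed(1)[OF z x]] fin[OF closed(1)[OF z y]]]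
          pairing_mult[OF fin[OF z] fin[OF xy]] pairing_mult[OF fin[OF z] fin[OF x]]
          pairing_mult[OF fin[OF z] fin[OF y]] pairing_add_left[OF fin[OF x] fin[OF y]] pairing_add_right by simp
    qed (rule closed(1)[OF z xy], rule closed(2)[OF closed(1)[OF z x] closed(1)[OF z y]])
  qed
qed

lemma group_algebra_smult_mult:
  fixes x y :: "_ \<Rightarrow> 'k::field"
  assumes "monoid G" "x \<in> carrier (group_algebra G)" "y \<in> carrier (group_algebra G)"
  shows "(c \<odot>\<^bsub>group_algebra G\<^esub> x) \<otimes>\<^bsub>group_algebra G\<^esub> y = c \<odot>\<^bsub>group_algebra G\<^esub> (x \<otimes>\<^bsub>group_algebra G\<^esub> y)"
    and "x \<otimes>\<^bsub>group_algebra G\<^esub> (c \<odot>\<^bsub>group_algebra G\<^esub> y) = c \<odot>\<^bsub>group_algebra G\<^esub> (x \<otimes>\<^bsub>group_algebra G\<^esub> y)"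
proof -
  let ?A = "group_algebra G :: ('k, _) module"
  have fin: "finite {h. f h \<noteq> 0}" if "f \<in> carrier (?A)" for f :: "_ \<Rightarrow> 'k"
    using that by (simp add: group_algebra_carrier)
  have cl: "(\<lambda>g. c * x g) \<in> carrier (?A)" "(\<lambda>g. c * y g) \<in> carrier (?A)"
    using assms group_algebra_scale_closed by blast+
  note m = group_algebra_mult_closed[OF assms(1)]
  show "(c \<odot>\<^bsub>?A\<^esub> x) \<otimes>\<^bsub>?A\<^esub> y = c \<odot>\<^bsub>?A\<^esub> (x \<otimes>\<^bsub>?A\<^esub> y)"
    unfolding group_algebra_simps
  proof (rule group_algebra_eqI[where G = G])
    show "pairing ((\<lambda>g. c * x g) \<otimes>\<^bsub>?A\<^esub> y) t = pairing (\<lambda>g. c * (x \<otimes>\<^bsub>?A\<^esub> y) g) t" for t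
      unfolding pairing_scale_left pairing_mult[OF fin[OF cl(1)] fin[OF assms(3)]]
        pairing_mult[OF fin[OF assms(2)] fin[OF assms(3)]] ..
  qed (rule m[OF cl(1) assms(3)], rule group_algebra_scale_closed[OF m[OF assms(2,3)]])
  show "x \<otimes>\<^bsub>?A\<^esub> (c \<odot>\<^bsub>?A\<^esub> y) = c \<odot>\<^bsub>?A\<^esub> (x \<otimes>\<^bsub>?A\<^esub> y)"
    unfolding group_algebra_simps
  proof (rule group_algebra_eqI[where G = G])
    show "pairing (x \<otimes>\<^bsub>?A\<^esub> (\<lambda>g. c * y g)) t = pairing (\<lambda>g. c * (x \<otimes>\<^bsub>?A\<^esub> y) g) t" for t
      unfolding pairing_scale_left pairing_mult[OF fin[OF assms(2)] fin[OF cl(2)]]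
        pairing_mult[OF fin[OF assms(2)] fin[OF assms(3)]] pairing_scale_right ..
  qed (rule m[OF assms(2) cl(2)], rule group_algebra_scale_closed[OF m[OF assms(2,3)]])
qed

lemma module_group_algebra:
  assumes "monoid G"
  shows "Module.module class_ring (group_algebra G :: ('k::field, _) module)"
proof (rule moduleI)
  show "cring (class_ring :: 'k ring)"
    by (rule fieldE(1)[OF class_field])
  show "abelian_group (group_algebra G :: ('k, _) module)"
    using ring_group_algebra[OF assms] by (rule ring.is_abelian_group)
qed (auto simp: group_algebra_simps group_algebra_scale_closed fun_eq_iff algebra_simps)

text \<open>Induction on the part of the support already included. The empty part is reached as a
  zero multiple of some group element, which \<open>ne\<close> provides.\<close>

lemma group_algebra_induct [consumes 1, case_names add elem]:
  assumes f: "f \<in> carrier (group_algebra G)"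
    and add: "\<And>f f'. f \<in> carrier (group_algebra G) \<Longrightarrow> f' \<in> carrier (group_algebra G) \<Longrightarrow> P f \<Longrightarrow> P f'
       \<Longrightarrow> P (f \<oplus>\<^bsub>group_algebra G\<^esub> f')"
    and elem: "\<And>c g. g \<in> carrier G \<Longrightarrow> P (c \<odot>\<^bsub>group_algebra G\<^esub> group_algebra_elem g)"
    and ne: "carrier G \<noteq> {}"
  shows "P (f :: _ \<Rightarrow> 'k::field)"
proof -
  let ?A = "group_algebra G :: ('k, _) module"
  have "P (\<lambda>g. if g \<in> S then f g else 0)" if "finite S" "S \<subseteq> {g. f g \<noteq> 0}" for S
    using that
  proof (induction S rule: finite_induct)
    case empty
    obtain g where "g \<in> carrier G" using ne by blast
    then have "P (0 \<odot>\<^bsub>?A\<^esub> group_algebra_elem g)" by (rule elem)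
    then show ?case by (simp add: group_algebra_simps)
  next
    case (insert a S)
    have a: "a \<in> carrier G" using insert f by (auto simp: group_algebra_carrier)
    have "(\<lambda>g. if g \<in> S then f g else 0) \<in> carrier (?A)"
      using f insert by (auto simp: group_algebra_carrier)
    moreover have "f a \<odot>\<^bsub>?A\<^esub> group_algebra_elem a \<in> carrier (?A)"
      using group_algebra_scale_closed[OF group_algebra_elem_carrier[OF a]] by (simp add: group_algebra_simps)
    ultimately have "P ((f a \<odot>\<^bsub>?A\<^esub> group_algebra_elem a) \<oplus>\<^bsub>?A\<^esub> (\<lambda>g. if g \<in> S then f g else 0))"
      using insert elem[OF a] by (intro add) auto
    moreover have "(f a \<odot>\<^bsub>?A\<^esub> group_algebra_elem a) \<oplus>\<^bsub>?A\<^esub> (\<lambda>g. if g \<in> S then f g else 0)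
       = (\<lambda>g. if g \<in> insert a S then f g else 0)"
      using insert by (auto simp: group_algebra_simps group_algebra_elem_def fun_eq_iff)
    ultimately show ?case by simp
  qed
  from this[of "{g. f g \<noteq> 0}"] have "P (\<lambda>g. if f g \<noteq> 0 then f g else 0)"
    using f by (simp add: group_algebra_carrier)
  moreover have "(\<lambda>g. if f g \<noteq> 0 then f g else 0) = f" by auto
  ultimately show ?thesis by simp
qed

section \<open>Quotients of algebras by ideals\<close>

locale quotient_algebra =
  fixes A :: "('k::field, 'v, 'm) module_scheme" and I :: "'v set"
  assumes ring_A: "ring A" and module_A: "Module.module class_ring A" and ideal_I: "ideal I A"
    and smult_mult: "\<And>c x y. x \<in> carrier A \<Longrightarrow> y \<in> carrier A \<Longrightarrow> (c \<odot>\<^bsub>A\<^esub> x) \<otimes>\<^bsub>A\<^esub> y = c \<odot>\<^bsub>A\<^esub> (x \<otimes>\<^bsub>A\<^esub> y)"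
    and mult_smult: "\<And>c x y. x \<in> carrier A \<Longrightarrow> y \<in> carrier A \<Longrightarrow> x \<otimes>\<^bsub>A\<^esub> (c \<odot>\<^bsub>A\<^esub> y) = c \<odot>\<^bsub>A\<^esub> (x \<otimes>\<^bsub>A\<^esub> y)"
begin

abbreviation "H \<equiv> quot_algebra A I"
abbreviation "proj x \<equiv> I +>\<^bsub>A\<^esub> x"

interpretation A: ring A by (rule ring_A)
interpretation M: Module.module class_ring A by (rule module_A)
interpretation I: ideal I A by (rule ideal_I)

lemma smult_closed: "x \<in> carrier A \<Longrightarrow> c \<odot>\<^bsub>A\<^esub> x \<in> carrier A"
  using M.smult_closed[of c x] by simp

lemma carrier_H: "carrier H = proj ` carrier A"
  by (auto simp: quot_algebra_def FactRing_def A_RCOSETS_def')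

lemma proj_closed: "x \<in> carrier A \<Longrightarrow> proj x \<in> carrier H"
  by (simp add: carrier_H)

lemma proj_add: "x \<in> carrier A \<Longrightarrow> y \<in> carrier A \<Longrightarrow> proj x \<oplus>\<^bsub>H\<^esub> proj y = proj (x \<oplus>\<^bsub>A\<^esub> y)"
  by (simp add: quot_algebra_def FactRing_def I.a_rcos_sum)

lemma proj_mult: "x \<in> carrier A \<Longrightarrow> y \<in> carrier A \<Longrightarrow> proj x \<otimes>\<^bsub>H\<^esub> proj y = proj (x \<otimes>\<^bsub>A\<^esub> y)"
  by (simp add: quot_algebra_def FactRing_def I.rcoset_mult_add)

lemma proj_ideal: "x \<in> I \<Longrightarrow> proj x = \<zero>\<^bsub>H\<^esub>"
  using A.a_rcos_zero[OF ideal_I] by (simp add: quot_algebra_def FactRing_def)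

lemma proj_zero: "\<zero>\<^bsub>H\<^esub> = proj \<zero>\<^bsub>A\<^esub>"
  using proj_ideal[of "\<zero>\<^bsub>A\<^esub>"] by simp

lemma proj_one: "\<one>\<^bsub>H\<^esub> = proj \<one>\<^bsub>A\<^esub>"
  by (simp add: quot_algebra_def FactRing_def)

lemma proj_self: "x \<in> carrier A \<Longrightarrow> x \<in> proj x"
  unfolding a_r_coset_def' using I.zero_closed A.l_zero by force

lemma mem_projE:
  assumes "y \<in> proj x"
  obtains i where "i \<in> I" "y = i \<oplus>\<^bsub>A\<^esub> x"
  using assms unfolding a_r_coset_def' by auto

text \<open>A scalar multiple of i is the product of i with the same multiple of 1; so a ring ideal
  is a subspace, and scaling of cosets is well defined.\<close>

lemma smult_ideal: "i \<in> I \<Longrightarrow> c \<odot>\<^bsub>A\<^esub> i \<in> I"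
  using I.I_l_closed[of i "c \<odot>\<^bsub>A\<^esub> \<one>\<^bsub>A\<^esub>"] smult_mult[of "\<one>\<^bsub>A\<^esub>" i c] I.Icarr smult_closed by simp

lemma proj_smult:
  assumes x: "x \<in> carrier A"
  shows "c \<odot>\<^bsub>H\<^esub> proj x = proj (c \<odot>\<^bsub>A\<^esub> x)"
proof -
  have "proj (c \<odot>\<^bsub>A\<^esub> y) = proj (c \<odot>\<^bsub>A\<^esub> x)" if y: "y \<in> proj x" for y
  proof -
    obtain i where i: "i \<in> I" "y = i \<oplus>\<^bsub>A\<^esub> x" using mem_projE[OF y] .
    have ic: "i \<in> carrier A" using i I.Icarr by simp
    have "c \<odot>\<^bsub>A\<^esub> y = c \<odot>\<^bsub>A\<^esub> i \<oplus>\<^bsub>A\<^esub> c \<odot>\<^bsub>A\<^esub> x"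
      using M.smult_r_distr[of c i x] i ic x by simp
    then have "proj (c \<odot>\<^bsub>A\<^esub> y) = proj (c \<odot>\<^bsub>A\<^esub> i) \<oplus>\<^bsub>H\<^esub> proj (c \<odot>\<^bsub>A\<^esub> x)"
      using ic x by (simp add: proj_add smult_closed)
    also have "\<dots> = proj (c \<odot>\<^bsub>A\<^esub> x)"
      using proj_ideal[OF smult_ideal[OF i(1)]] proj_zero proj_add[of "\<zero>\<^bsub>A\<^esub>" "c \<odot>\<^bsub>A\<^esub> x"] x smult_closed by simp
    finally show ?thesis .
  qed
  then have "(\<Union>y\<in>proj x. proj (c \<odot>\<^bsub>A\<^esub> y)) = proj (c \<odot>\<^bsub>A\<^esub> x)" using proj_self[OF x] by blast
  then show ?thesis by (simp add: quot_algebra_def)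
qed

lemmas proj_simps = proj_add proj_mult proj_smult smult_closed

lemma ring_H: "ring H"
proof (rule ringI)
  show "abelian_group H"
  proof (rule abelian_groupI)
    fix x assume "x \<in> carrier H"
    then obtain a where "a \<in> carrier A" "x = proj a" by (auto simp: carrier_H)
    then show "\<exists>y\<in>carrier H. y \<oplus>\<^bsub>H\<^esub> x = \<zero>\<^bsub>H\<^esub>"
      by (intro bexI[of _ "proj (\<ominus>\<^bsub>A\<^esub> a)"]) (auto simp: carrier_H proj_simps proj_zero A.l_neg)
  qed (auto simp: carrier_H proj_simps proj_zero A.a_ac)
  show "monoid H"
    by (rule monoidI) (auto simp: carrier_H proj_simps proj_one A.m_assoc)
qed (auto simp: carrier_H proj_simps A.l_distr A.r_distr)

lemma module_H: "Module.module class_ring H"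
proof (rule moduleI)
  show "cring (class_ring :: 'k ring)"
    by (rule fieldE(1)[OF class_field])
  show "abelian_group H" using ring_H by (rule ring.is_abelian_group)
qed (use M.smult_l_distr M.smult_r_distr M.smult_assoc1 M.smult_one in \<open>auto simp: carrier_H proj_simps\<close>)

lemma H_smult_mult:
  assumes "x \<in> carrier H" "y \<in> carrier H"
  shows "(c \<odot>\<^bsub>H\<^esub> x) \<otimes>\<^bsub>H\<^esub> y = c \<odot>\<^bsub>H\<^esub> (x \<otimes>\<^bsub>H\<^esub> y)" "x \<otimes>\<^bsub>H\<^esub> (c \<odot>\<^bsub>H\<^esub> y) = c \<odot>\<^bsub>H\<^esub> (x \<otimes>\<^bsub>H\<^esub> y)"
  using assms by (auto simp: carrier_H proj_simps smult_mult mult_smult)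

end

section \<open>Reduced words\<close>

text \<open>The product of generators that turns the decreasing word into \<open>xs\<close>: the first letter \<open>x\<close> is
  brought to the front past the larger ones, then the tail is arranged.\<close>

fun red_word :: "nat list \<Rightarrow> nat list" where
  "red_word [] = []"
| "red_word (x # ys) = map Suc (red_word ys) @ [1..<Suc (length (filter ((<) x) ys))]"

lemma red_word_bound: "i \<in> set (red_word xs) \<Longrightarrow> 1 \<le> i \<and> i < length xs"
proof (induction xs arbitrary: i)
  case (Cons x ys)
  have "i < length (x # ys)" if "i < Suc (length (filter ((<) x) ys))"
    using that length_filter_le[of "(<) x" ys] unfolding list.size by linarith
  then show ?case using Cons.prems by (auto dest: Cons.IH simp del: upt_Suc)
qed simp

text \<open>Abstracted from left multiplication by the generators because \<open>red_word\<close>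
  shifts indices: the induction in \<open>red_word_swap\<close> passes to the family starting at
  index 2, which is again of this kind.\<close>

definition braid_family :: "nat \<Rightarrow> 'v set \<Rightarrow> (nat \<Rightarrow> 'v \<Rightarrow> 'v) \<Rightarrow> bool" where
  "braid_family n C \<tau> \<longleftrightarrow>
    (\<forall>i x. 1 \<le> i \<longrightarrow> i < n \<longrightarrow> x \<in> C \<longrightarrow> \<tau> i x \<in> C) \<and>
    (\<forall>i x. 1 \<le> i \<longrightarrow> Suc i < n \<longrightarrow> x \<in> C \<longrightarrow> \<tau> i (\<tau> (Suc i) (\<tau> i x)) = \<tau> (Suc i) (\<tau> i (\<tau> (Suc i) x))) \<and>
    (\<forall>i j x. 1 \<le> i \<longrightarrow> Suc i < j \<longrightarrow> j < n \<longrightarrow> x \<in> C \<longrightarrow> \<tau> i (\<tau> j x) = \<tau> j (\<tau> i x))"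

lemma braid_family_shift:
  assumes "braid_family n C \<tau>"
  shows "braid_family (n - 1) C (\<lambda>i. \<tau> (Suc i))"
proof -
  note fam = assms[unfolded braid_family_def]
  have "\<tau> (Suc i) (\<tau> (Suc j) x) = \<tau> (Suc j) (\<tau> (Suc i) x)"
    if "1 \<le> i" "Suc i < j" "j < n - 1" "x \<in> C" for i j x
    using fam[THEN conjunct2, THEN conjunct2, rule_format, of "Suc i" "Suc j" x] that by simp
  moreover have "\<tau> (Suc i) x \<in> C" if "1 \<le> i" "i < n - 1" "x \<in> C" for i x
    using fam[THEN conjunct1, rule_format, of "Suc i" x] that by simp
  moreover have "\<tau> (Suc i) (\<tau> (Suc (Suc i)) (\<tau> (Suc i) x)) = \<tau> (Suc (Suc i)) (\<tau> (Suc i) (\<tau> (Suc (Suc i)) x))"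
    if "1 \<le> i" "Suc i < n - 1" "x \<in> C" for i x
    using fam[THEN conjunct2, THEN conjunct1, rule_format, of "Suc i" x] that by simp
  ultimately show ?thesis unfolding braid_family_def by blast
qed

lemma braid_family_foldr_closed:
  assumes "braid_family n C \<tau>" "\<And>i. i \<in> set ws \<Longrightarrow> 1 \<le> i \<and> i < n" "z \<in> C"
  shows "foldr \<tau> ws z \<in> C"
  using assms(2)
proof (induction ws)
  case (Cons i ws)
  then have "foldr \<tau> ws z \<in> C" "1 \<le> i" "i < n" by auto
  then show ?case using assms(1) by (auto simp: braid_family_def)
qed (use assms in simp)

lemma braid_family_foldr_commute:
  assumes fam: "braid_family n C \<tau>" and z: "z \<in> C" and j: "1 \<le> j" "j < n"
    and ws: "\<And>i. i \<in> set ws \<Longrightarrow> 1 \<le> i \<and> i < n \<and> (Suc i < j \<or> Suc j < i)"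
  shows "foldr \<tau> ws (\<tau> j z) = \<tau> j (foldr \<tau> ws z)"
  using ws
proof (induction ws)
  case (Cons i ws)
  have IH: "foldr \<tau> ws (\<tau> j z) = \<tau> j (foldr \<tau> ws z)" using Cons by auto
  have c: "foldr \<tau> ws z \<in> C" using Cons.prems by (intro braid_family_foldr_closed[OF fam _ z]) auto
  have i: "1 \<le> i" "i < n" "Suc i < j \<or> Suc j < i" using Cons.prems[of i] by auto
  then have "\<tau> i (\<tau> j (foldr \<tau> ws z)) = \<tau> j (\<tau> i (foldr \<tau> ws z))"
    using fam j c unfolding braid_family_def by metis
  then show ?case using IH by simp
qed simp

text \<open>From the right, \<open>\<tau> j\<close> commutes with everything up to the factors of
  index \<open>j\<close> and \<open>Suc j\<close>. There the braid relation turns it into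
  \<open>\<tau> (Suc j)\<close>, which commutes with the remaining factors.\<close>

lemma braid_family_slide:
  assumes fam: "braid_family n C \<tau>" and z: "z \<in> C" and "1 \<le> l" "l \<le> j" "Suc j < m" "m \<le> n"
  shows "foldr \<tau> [l..<m] (\<tau> j z) = \<tau> (Suc j) (foldr \<tau> [l..<m] z)"
proof -
  have split: "[l..<m] = [l..<j] @ j # Suc j # [Suc (Suc j)..<m]"
    using assms upt_add_eq_append[of l j "m - j"]
    by (simp add: upt_conv_Cons[of j] upt_conv_Cons[of "Suc j"] del: upt_Suc)
  let ?w = "foldr \<tau> [Suc (Suc j)..<m] z"
  have w: "?w \<in> C" using assms by (intro braid_family_foldr_closed[OF fam _ z]) auto
  have c: "\<tau> j (\<tau> (Suc j) ?w) \<in> C" using fam w assms unfolding braid_family_def by auto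
  have "foldr \<tau> [Suc (Suc j)..<m] (\<tau> j z) = \<tau> j ?w"
    using assms by (intro braid_family_foldr_commute[OF fam z]) auto
  then have "foldr \<tau> [l..<m] (\<tau> j z) = foldr \<tau> [l..<j] (\<tau> j (\<tau> (Suc j) (\<tau> j ?w)))"
    unfolding split by simp
  also have "\<dots> = foldr \<tau> [l..<j] (\<tau> (Suc j) (\<tau> j (\<tau> (Suc j) ?w)))"
    using fam w assms unfolding braid_family_def by auto
  also have "\<dots> = \<tau> (Suc j) (foldr \<tau> [l..<j] (\<tau> j (\<tau> (Suc j) ?w)))"
    using assms by (intro braid_family_foldr_commute[OF fam c]) auto
  finally show ?thesis unfolding split by simp
qed

lemma braid_family_slide_many:
  assumes fam: "braid_family n C \<tau>" and z: "z \<in> C" and "a \<le> b" "Suc (Suc b) \<le> n"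
  shows "foldr \<tau> [1..<Suc (Suc b)] (foldr \<tau> [1..<Suc a] z)
    = foldr \<tau> [2..<Suc (Suc a)] (foldr \<tau> [1..<Suc (Suc b)] z)"
  using assms(3) z
proof (induction a arbitrary: z)
  case (Suc a)
  have z': "\<tau> (Suc a) z \<in> C" using fam Suc assms(4) unfolding braid_family_def by auto
  have "foldr \<tau> [1..<Suc (Suc b)] (foldr \<tau> [1..<Suc (Suc a)] z)
      = foldr \<tau> [1..<Suc (Suc b)] (foldr \<tau> [1..<Suc a] (\<tau> (Suc a) z))" by simp
  also have "\<dots> = foldr \<tau> [2..<Suc (Suc a)] (foldr \<tau> [1..<Suc (Suc b)] (\<tau> (Suc a) z))"
    using Suc z' by simp
  also have "foldr \<tau> [1..<Suc (Suc b)] (\<tau> (Suc a) z) = \<tau> (Suc (Suc a)) (foldr \<tau> [1..<Suc (Suc b)] z)"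
    using Suc assms(4) by (intro braid_family_slide[OF fam]) auto
  finally show ?case by simp
qed simp

lemma foldr_map_Suc: "foldr \<tau> (map Suc ws) z = foldr (\<lambda>i. \<tau> (Suc i)) ws z"
  by (induction ws) auto

text \<open>With \<open>as\<close> empty, let a and b count the letters of \<open>bs\<close> above x
  and y; y < x gives a \<le> b. Both products arrange \<open>bs\<close> last. Before that,
  \<open>x # y # bs\<close> has
  \<open>\<sigma>_2 ... \<sigma>_{b+1} \<sigma>_1 ... \<sigma>_a\<close>, while
  \<open>y # x # bs\<close> has
  \<open>\<sigma>_2 ... \<sigma>_{a+1} \<sigma>_1 ... \<sigma>_{b+1}\<close>, since y also passes x.
  A further \<open>\<sigma>_1\<close> on the left of the first is absorbed, and
  \<open>braid_family_slide_many\<close> identifies them.\<close>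

lemma red_word_swap:
  assumes "braid_family n C \<tau>" "z \<in> C" "length (as @ x # y # bs) \<le> n" "y < x"
  shows "\<tau> (Suc (length as)) (foldr \<tau> (red_word (as @ x # y # bs)) z)
    = foldr \<tau> (red_word (as @ y # x # bs)) z"
  using assms
proof (induction as arbitrary: n \<tau> z)
  case Nil
  define a b where "a = length (filter ((<) x) bs)" and "b = length (filter ((<) y) bs)"
  have "filter ((<) x) bs = filter ((<) x) (filter ((<) y) bs)"
    unfolding filter_filter using Nil.prems(4) by (intro filter_cong) auto
  then have ab: "a \<le> b" using length_filter_le unfolding a_def b_def by metis
  have "b \<le> length bs" by (simp add: b_def)
  then have bn: "Suc (Suc b) \<le> n" using Nil.prems(3) by simp
  let ?W = "map Suc (map Suc (red_word bs))"
  have r1: "red_word (x # y # bs) = ?W @ [2..<Suc (Suc b)] @ [1..<Suc a]"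
    using Nil.prems(4) by (simp add: a_def b_def map_Suc_upt numeral_2_eq_2 del: upt_Suc)
  have r2: "red_word (y # x # bs) = ?W @ [2..<Suc (Suc a)] @ [1..<Suc (Suc b)]"
    using Nil.prems(4) by (simp add: a_def b_def map_Suc_upt numeral_2_eq_2 del: upt_Suc)
  let ?z = "foldr \<tau> [2..<Suc (Suc b)] (foldr \<tau> [1..<Suc a] z)"
  have zc: "?z \<in> C" using ab bn
    by (intro braid_family_foldr_closed[OF Nil.prems(1)] Nil.prems(2)) auto
  have "\<tau> 1 (foldr \<tau> (red_word (x # y # bs)) z) = \<tau> 1 (foldr \<tau> ?W ?z)" unfolding r1 by simp
  \<comment> \<open>The indices in \<open>?W\<close> are shifted twice, hence at least 3, and far
    from 1.\<close>
  also have "\<dots> = foldr \<tau> ?W (\<tau> 1 ?z)"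
  proof (rule braid_family_foldr_commute[OF Nil.prems(1) zc, symmetric])
    fix i assume "i \<in> set ?W"
    then obtain k where "k \<in> set (red_word bs)" "i = Suc (Suc k)" by auto
    then show "1 \<le> i \<and> i < n \<and> (Suc i < 1 \<or> Suc 1 < i)"
      using red_word_bound[of k bs] Nil.prems(3) by auto
  qed (use bn in auto)
  also have "\<tau> 1 ?z = foldr \<tau> [1..<Suc (Suc b)] (foldr \<tau> [1..<Suc a] z)"
  proof -
    have "[1..<Suc (Suc b)] = 1 # [2..<Suc (Suc b)]"
      by (subst upt_conv_Cons) (simp_all add: numeral_2_eq_2 del: upt_Suc)
    then show ?thesis by simp
  qed
  also have "\<dots> = foldr \<tau> [2..<Suc (Suc a)] (foldr \<tau> [1..<Suc (Suc b)] z)"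
    by (rule braid_family_slide_many[OF Nil.prems(1,2) ab bn])
  also have "foldr \<tau> ?W \<dots> = foldr \<tau> (red_word (y # x # bs)) z" unfolding r2 by simp
  finally show ?case by simp
next
  case (Cons t as)
  let ?k = "[1..<Suc (length (filter ((<) t) (as @ x # y # bs)))]"
  have k: "[1..<Suc (length (filter ((<) t) (as @ y # x # bs)))] = ?k" by simp
  define m where "m = length (filter ((<) t) (as @ x # y # bs))"
  have "m < n" using length_filter_le[of "(<) t" "as @ x # y # bs"] Cons.prems(3) by (simp add: m_def)
  then have zc: "foldr \<tau> ?k z \<in> C" unfolding m_def[symmetric]
    by (intro braid_family_foldr_closed[OF Cons.prems(1) _ Cons.prems(2)]) (auto simp del: upt_Suc)
  have "\<tau> (Suc (Suc (length as))) (foldr (\<lambda>i. \<tau> (Suc i)) (red_word (as @ x # y # bs)) (foldr \<tau> ?k z))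
     = foldr (\<lambda>i. \<tau> (Suc i)) (red_word (as @ y # x # bs)) (foldr \<tau> ?k z)"
    by (rule Cons.IH[OF braid_family_shift[OF Cons.prems(1)] zc _ Cons.prems(4)])
      (use Cons.prems(3) in auto)
  moreover have "foldr \<tau> (red_word ((t # as) @ x # y # bs)) z
      = foldr (\<lambda>i. \<tau> (Suc i)) (red_word (as @ x # y # bs)) (foldr \<tau> ?k z)"
    by (simp only: append_Cons red_word.simps foldr_append foldr_map_Suc o_apply)
  moreover have "foldr \<tau> (red_word ((t # as) @ y # x # bs)) z
      = foldr (\<lambda>i. \<tau> (Suc i)) (red_word (as @ y # x # bs)) (foldr \<tau> ?k z)"
    unfolding k[symmetric] by (simp only: append_Cons red_word.simps foldr_append foldr_map_Suc o_apply)
  ultimately show ?case by (simp only: list.size add_Suc_right add_0_right)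
qed

section \<open>Reduced words applied to the decreasing word\<close>

lemma sorted_ins:
  "sorted_wrt (>) u \<Longrightarrow> a \<notin> set u \<Longrightarrow> sorted_wrt (>) (ins a u)"
  by (induction u) (auto simp: ins_Cons)

lemma sorted_foldr_ins: "distinct xs \<Longrightarrow> sorted_wrt (>) (foldr ins xs [])"
proof (induction xs)
  case (Cons x xs)
  have "set (foldr ins xs []) = set xs" by (induction xs) auto
  then show ?case using Cons by (auto intro: sorted_ins)
qed simp

lemma mset_foldr_ins: "mset (foldr ins xs []) = mset xs"
  by (induction xs) auto

text \<open>Every swap on the way happens at a descent, so no correction terms arise.\<close>

lemma hecke_op_move_left:
  assumes "\<forall>d\<in>set ds. x < d"
  shows "foldr (hecke_op q) [Suc (length as)..<Suc (length as + length ds)] (word_fun (as @ ds @ x # r))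
    = word_fun (as @ x # ds @ r)"
  using assms
proof (induction ds arbitrary: as)
  case (Cons d ds)
  have "foldr (hecke_op q) [Suc (length (as @ [d]))..<Suc (length (as @ [d]) + length ds)]
      (word_fun ((as @ [d]) @ ds @ x # r)) = word_fun ((as @ [d]) @ x # ds @ r)"
    by (rule Cons.IH) (use Cons.prems in auto)
  then have "foldr (hecke_op q) [Suc (length as)..<Suc (length as + length (d # ds))] (word_fun (as @ (d # ds) @ x # r))
     = hecke_op q (Suc (length as)) (word_fun (as @ d # x # ds @ r))"
    by (simp add: upt_conv_Cons[of "Suc (length as)"] del: upt_Suc)
  also have "\<dots> = word_fun (as @ x # d # ds @ r)"
    using Cons.prems hecke_op_word_fun[of d x "Suc (length as)" as q "ds @ r"] by simp
  finally show ?case by simp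
qed simp

lemma length_takeWhile_sorted:
  "sorted_wrt (>) (u :: nat list) \<Longrightarrow> length (takeWhile ((<) x) u) = length (filter ((<) x) u)"
proof (induction u)
  case (Cons y u)
  have "filter ((<) x) u = []" if "\<not> x < y" using Cons.prems that by (auto simp: filter_empty_conv)
  then show ?case using Cons by auto
qed simp

text \<open>\<open>foldr ins xs []\<close> is the decreasing arrangement of the letters. The prefix
  \<open>as\<close> collects the letters already placed and accounts for the shift of indices in the
  recursion of \<open>red_word\<close>.\<close>

lemma foldr_hecke_op_red_word_shifted:
  assumes "distinct xs"
  shows "foldr (hecke_op q) (map ((+) (length as)) (red_word xs)) (word_fun (as @ foldr ins xs [] @ r))
    = word_fun (as @ xs @ r)"
  using assms
proof (induction xs arbitrary: as)
  case (Cons x ys)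
  let ?u = "foldr ins ys []"
  let ?p = "takeWhile ((<) x) ?u" and ?s = "dropWhile ((<) x) ?u"
  have "length ?p = length (filter ((<) x) ?u)"
    using Cons.prems by (intro length_takeWhile_sorted sorted_foldr_ins) simp
  also have "\<dots> = length (filter ((<) x) ys)"
    using mset_foldr_ins[of ys] by (metis mset_filter size_mset)
  finally have lp: "length ?p = length (filter ((<) x) ys)" .
  have ws: "map ((+) (length as)) (red_word (x # ys))
      = map ((+) (length (as @ [x]))) (red_word ys) @ [Suc (length as)..<Suc (length as + length ?p)]"
  proof -
    have "map ((+) k) [1..<Suc m] = [Suc k..<Suc (k + m)]" for k m by (induction m) auto
    then show ?thesis unfolding lp by (simp add: o_def del: upt_Suc)
  qed
  have "foldr (hecke_op q) [Suc (length as)..<Suc (length as + length ?p)] (word_fun (as @ ?p @ x # ?s @ r))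
     = word_fun (as @ x # ?p @ ?s @ r)"
    by (rule hecke_op_move_left) (auto dest: set_takeWhileD)
  then have E: "foldr (hecke_op q) [Suc (length as)..<Suc (length as + length ?p)] (word_fun (as @ foldr ins (x # ys) [] @ r))
     = word_fun ((as @ [x]) @ ?u @ r)"
  proof -
    have "as @ foldr ins (x # ys) [] @ r = as @ ?p @ x # ?s @ r" by (simp add: ins_def)
    moreover have "as @ x # ?p @ ?s @ r = (as @ [x]) @ ?u @ r"
      using takeWhile_dropWhile_id[of "(<) x" ?u] by (metis append_Cons append_Nil append_assoc)
    ultimately show ?thesis using \<open>_ = word_fun (as @ x # ?p @ ?s @ r)\<close> by (simp only:)
  qed
  have "foldr (hecke_op q) (map ((+) (length (as @ [x]))) (red_word ys)) (word_fun ((as @ [x]) @ ?u @ r))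
     = word_fun ((as @ [x]) @ ys @ r)"
    by (rule Cons.IH) (use Cons.prems in simp)
  then show ?case unfolding ws foldr_append o_apply E by simp
qed simp

lemma foldr_ins_permutation:
  assumes "xs \<in> permutations_of_set {1..n}"
  shows "foldr ins xs [] = rev [1..<Suc n]"
proof -
  have d: "distinct xs" "set xs = {1..n}" using assms by (auto simp: permutations_of_set_def)
  have s: "sorted_wrt (>) (foldr ins xs [])" by (rule sorted_foldr_ins[OF d(1)])
  have "sorted_wrt (<) (rev (foldr ins xs []))" using s by (simp add: sorted_wrt_rev)
  moreover have "set (rev (foldr ins xs [])) = {1..n}"
    using mset_foldr_ins[of xs] d(2) by (metis mset_eq_setD set_rev)
  ultimately have "rev (foldr ins xs []) = [1..<Suc n]"
    using sorted_wrt_upt[of 1 "Suc n"] by (intro strict_sorted_equal) (simp_all add: atLeastLessThanSuc_atLeastAtMost del: upt_Suc)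
  then show ?thesis by (metis rev_rev_ident)
qed

lemma foldr_hecke_op_red_word:
  assumes "xs \<in> permutations_of_set {1..n}"
  shows "foldr (hecke_op q) (red_word xs) (word_fun (rev [1..<Suc n])) = word_fun xs"
proof -
  have d: "distinct xs" using assms by (auto simp: permutations_of_set_def)
  have "map ((+) 0) ws = ws" for ws :: "nat list" by (induction ws) auto
  then show ?thesis
    using foldr_hecke_op_red_word_shifted[OF d, of q "[]" "[]"] foldr_ins_permutation[OF assms] by simp
qed

section \<open>The Hecke algebra as a space of words\<close>

text \<open>Keeps \<open>{1..<n}\<close> in the form in which it occurs in the presentation of the braid group.\<close>

declare One_nat_def [simp del]

text \<open>The quadratic relation makes \<open>\<sigma> - (q - inverse q)\<close> the inverse of
  \<open>\<sigma>\<close>, which is how an inverse letter acts.\<close>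

definition letter_op :: "'k::field \<Rightarrow> nat \<times> bool \<Rightarrow> 'k wfun \<Rightarrow> 'k wfun" where
  "letter_op q l f = (if snd l then hecke_op q (fst l) f
     else hecke_op q (fst l) f - scl (q - inverse q) f)"

lemma hecke_op_diff: "hecke_op q i (f - g) = hecke_op q i f - hecke_op q i g"
  using fvp.linear_diff[OF hecke_op_linear] .

lemma letter_op_linear: "flinear (letter_op q l)"
  by (rule flinearI) (auto simp: letter_op_def hecke_op_add hecke_op_scl algebra_simps
      fv.scale_right_distrib fv.scale_right_diff_distrib)

lemma letter_op_cancel:
  assumes "i \<ge> 1" "q \<noteq> 0"
  shows "letter_op q (i, s) (letter_op q (i, \<not> s) f) = f"
  using assms by (cases s) (simp_all add: letter_op_def hecke_op_diff hecke_op_scl hecke_op_quadratic)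

abbreviation word_op :: "'k::field \<Rightarrow> nat gword \<Rightarrow> 'k wfun \<Rightarrow> 'k wfun" where
  "word_op q u \<equiv> foldr (letter_op q) u"

lemma word_op_linear: "flinear (word_op q u)"
proof (induction u)
  case Nil
  then show ?case by (intro flinearI) auto
next
  case (Cons l u)
  show ?case
    using fvp.linear_add[OF Cons.IH] fvp.linear_scale[OF Cons.IH]
      fvp.linear_add[OF letter_op_linear] fvp.linear_scale[OF letter_op_linear]
    by (intro flinearI) simp_all
qed

lemma word_op_pres_cong:
  assumes "q \<noteq> 0" "(u, v) \<in> pres_cong {1..<n} (braid_relations n)"
  shows "word_op q u = word_op q v"
  using assms(2)
proof (induction rule: pres_cong.induct)
  case (pres_cancel x s)
  then show ?case using letter_op_cancel[OF _ assms(1)] by (auto simp: fun_eq_iff)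
next
  case (pres_rel u v)
  then consider i j where "u = [(i, True), (j, True), (i, True)]" "v = [(j, True), (i, True), (j, True)]"
      "i \<ge> 1" "j \<ge> 1" "\<bar>int i - int j\<bar> = 1"
    | i j where "u = [(i, True), (j, True)]" "v = [(j, True), (i, True)]" "i \<ge> 1" "j \<ge> 1" "\<bar>int i - int j\<bar> > 1"
    unfolding braid_relations_def by auto
  then show ?case
  proof cases
    case 1
    then have "j = Suc i \<or> i = Suc j" by auto
    then show ?thesis using 1 hecke_op_braid_adjacent[OF _ assms(1)] by (auto simp: letter_op_def fun_eq_iff)
  next
    case 2
    then have "Suc i < j \<or> Suc j < i" by auto
    then show ?thesis using 2 hecke_op_commute[of i j q] hecke_op_commute[of j i q]
      by (auto simp: letter_op_def fun_eq_iff)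
  qed
qed simp_all

definition class_op :: "'k::field \<Rightarrow> nat gword set \<Rightarrow> 'k wfun \<Rightarrow> 'k wfun" where
  "class_op q g = word_op q (SOME u. u \<in> g)"

lemma class_op_linear: "flinear (class_op q g)"
  unfolding class_op_def by (rule word_op_linear)

definition algebra_op :: "'k::field \<Rightarrow> (nat gword set \<Rightarrow> 'k) \<Rightarrow> 'k wfun \<Rightarrow> 'k wfun" where
  "algebra_op q f v = (\<Sum>g | f g \<noteq> 0. scl (f g) (class_op q g v))"

lemma algebra_op_apply: "algebra_op q f v p = pairing f (\<lambda>g. class_op q g v p)"
  by (simp add: algebra_op_def wfun_sum_apply scl_apply pairing_def)

lemma linear_algebra_op:
  assumes "flinear T"
  shows "T (algebra_op q f v) p = pairing f (\<lambda>g. T (class_op q g v) p)"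
  unfolding algebra_op_def fvp.linear_sum[OF assms] fvp.linear_scale[OF assms]
  by (simp add: wfun_sum_apply scl_apply pairing_def)

section \<open>The Hecke algebra acting on words\<close>

locale hecke =
  fixes n :: nat and q :: "'k::field"
  assumes q0: "q \<noteq> 0"
begin

abbreviation "G \<equiv> braid_group n"
abbreviation "BA \<equiv> (braid_algebra n :: ('k, nat gword set \<Rightarrow> 'k) module)"
abbreviation "cls u \<equiv> pres_class {1..<n} (braid_relations n) u"
abbreviation "\<delta> u \<equiv> (group_algebra_elem (cls u) :: nat gword set \<Rightarrow> 'k)"

lemma monoid_G: "monoid G"
  by (simp add: braid_group_def monoid_presented_group)

interpretation BA: ring BA
  unfolding braid_algebra_def by (rule ring_group_algebra[OF monoid_G])

lemma carrier_G: "carrier G = cls ` gwords {1..<n}"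
  by (simp add: braid_group_def presented_group_carrier)

lemma G_mult: "u \<in> gwords {1..<n} \<Longrightarrow> v \<in> gwords {1..<n} \<Longrightarrow> cls u \<otimes>\<^bsub>G\<^esub> cls v = cls (u @ v)"
  by (simp add: braid_group_def presented_group_mult)

lemma delta_closed: "u \<in> gwords {1..<n} \<Longrightarrow> \<delta> u \<in> carrier BA"
  unfolding braid_algebra_def by (rule group_algebra_elem_carrier) (simp add: carrier_G)

lemma delta_mult: "u \<in> gwords {1..<n} \<Longrightarrow> v \<in> gwords {1..<n} \<Longrightarrow> \<delta> u \<otimes>\<^bsub>BA\<^esub> \<delta> v = \<delta> (u @ v)"
  unfolding braid_algebra_def
  by (subst group_algebra_elem_mult[OF monoid_G]) (auto simp: carrier_G G_mult)

lemma delta_cong: "(u, v) \<in> pres_cong {1..<n} (braid_relations n) \<Longrightarrow> \<delta> u = \<delta> v"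
  using equiv_class_eq[OF equiv_pres_cong] by metis

lemma one_BA: "\<one>\<^bsub>BA\<^esub> = \<delta> []"
  by (simp add: braid_algebra_def group_algebra_simps braid_group_def presented_group_def)

lemma class_op_cls:
  assumes "u \<in> gwords {1..<n}"
  shows "class_op q (cls u) = word_op q u"
proof -
  have "u \<in> cls u" using assms by (auto intro: pres_refl)
  then have "(SOME v. v \<in> cls u) \<in> cls u" by (rule someI)
  then have "(u, SOME v. v \<in> cls u) \<in> pres_cong {1..<n} (braid_relations n)" by simp
  then show ?thesis using word_op_pres_cong[OF q0] by (metis class_op_def)
qed

lemma class_op_mult:
  assumes "g \<in> carrier G" "h \<in> carrier G"
  shows "class_op q (g \<otimes>\<^bsub>G\<^esub> h) v = class_op q g (class_op q h v)"
proof -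
  obtain u w where u: "u \<in> gwords {1..<n}" "g = cls u" and w: "w \<in> gwords {1..<n}" "h = cls w"
    using assms by (auto simp: carrier_G)
  have "g \<otimes>\<^bsub>G\<^esub> h = cls (u @ w)" using u w by (simp add: braid_group_def presented_group_mult)
  moreover have "u @ w \<in> gwords {1..<n}" using u w by (auto simp: gwords_def)
  ultimately show ?thesis using u w by (simp add: class_op_cls)
qed

lemma supp_BA: "f \<in> carrier BA \<Longrightarrow> finite {g. f g \<noteq> 0}" "f \<in> carrier BA \<Longrightarrow> f g \<noteq> 0 \<Longrightarrow> g \<in> carrier G"
  by (auto simp: braid_algebra_def group_algebra_carrier)

lemma algebra_op_add:
  assumes "f \<in> carrier BA" "f' \<in> carrier BA"
  shows "algebra_op q (f \<oplus>\<^bsub>BA\<^esub> f') v = algebra_op q f v + algebra_op q f' v"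
  using pairing_add_left[OF supp_BA(1)[OF assms(1)] supp_BA(1)[OF assms(2)]]
  by (simp add: fun_eq_iff algebra_op_apply plus_fun_apply braid_algebra_def group_algebra_simps)

lemma algebra_op_smult: "algebra_op q (c \<odot>\<^bsub>BA\<^esub> f) v = scl c (algebra_op q f v)"
  by (simp add: fun_eq_iff algebra_op_apply scl_apply pairing_scale_left braid_algebra_def group_algebra_simps)

lemma algebra_op_zero: "algebra_op q \<zero>\<^bsub>BA\<^esub> v = 0"
  by (simp add: algebra_op_def braid_algebra_def group_algebra_simps)

lemma algebra_op_mult:
  assumes "f \<in> carrier BA" "f' \<in> carrier BA"
  shows "algebra_op q (f \<otimes>\<^bsub>BA\<^esub> f') v = algebra_op q f (algebra_op q f' v)"
proof
  fix p
  have "algebra_op q (f \<otimes>\<^bsub>BA\<^esub> f') v p = pairing f (\<lambda>h. pairing f' (\<lambda>h'. class_op q (h \<otimes>\<^bsub>G\<^esub> h') v p))"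
    unfolding algebra_op_apply braid_algebra_def
    by (rule pairing_mult[OF supp_BA(1)[OF assms(1)] supp_BA(1)[OF assms(2)]])
  also have "\<dots> = pairing f (\<lambda>h. pairing f' (\<lambda>h'. class_op q h (class_op q h' v) p))"
    using supp_BA(2)[OF assms(1)] supp_BA(2)[OF assms(2)] by (intro pairing_cong) (simp add: class_op_mult)
  also have "\<dots> = algebra_op q f (algebra_op q f' v) p"
    unfolding algebra_op_apply linear_algebra_op[OF class_op_linear] ..
  finally show "algebra_op q (f \<otimes>\<^bsub>BA\<^esub> f') v p = algebra_op q f (algebra_op q f' v) p" .
qed

lemma algebra_op_zero_right: "algebra_op q f 0 = 0"
  by (simp add: algebra_op_def fvp.linear_0[OF class_op_linear])

lemma algebra_op_delta: "u \<in> gwords {1..<n} \<Longrightarrow> algebra_op q (\<delta> u) v = word_op q u v"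
  by (simp add: fun_eq_iff algebra_op_apply pairing_elem class_op_cls)

text \<open>The annihilator of the space of word functions. It is a two-sided ideal containing the
  quadratic relations, hence contains \<open>hecke_ideal\<close>, and the action descends to the
  quotient.\<close>

definition op_kernel :: "(nat gword set \<Rightarrow> 'k) set" where
  "op_kernel = {f \<in> carrier BA. \<forall>v. algebra_op q f v = 0}"

lemma ideal_op_kernel: "ideal op_kernel BA"
proof (rule idealI)
  show "ring BA" by (rule BA.ring_axioms)
  show "subgroup op_kernel (add_monoid BA)"
  proof (rule BA.add.subgroupI)
    show "op_kernel \<subseteq> carrier BA" by (auto simp: op_kernel_def)
    show "op_kernel \<noteq> {}" using BA.zero_closed algebra_op_zero by (auto simp: op_kernel_def)
    show "f \<oplus>\<^bsub>BA\<^esub> g \<in> op_kernel" if "f \<in> op_kernel" "g \<in> op_kernel" for f g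
      using that by (auto simp: op_kernel_def algebra_op_add)
    show "\<ominus>\<^bsub>BA\<^esub> f \<in> op_kernel" if "f \<in> op_kernel" for f
    proof -
      have f: "f \<in> carrier BA" using that by (simp add: op_kernel_def)
      have "algebra_op q (f \<oplus>\<^bsub>BA\<^esub> \<ominus>\<^bsub>BA\<^esub> f) v = algebra_op q f v + algebra_op q (\<ominus>\<^bsub>BA\<^esub> f) v" for v
        using f by (intro algebra_op_add) auto
      then have "algebra_op q (\<ominus>\<^bsub>BA\<^esub> f) v = 0" for v
        using that f by (simp add: BA.r_neg algebra_op_zero op_kernel_def)
      then show ?thesis using f by (simp add: op_kernel_def)
    qed
  qed
qed (auto simp: op_kernel_def algebra_op_mult algebra_op_zero_right)

abbreviation rel :: "nat \<Rightarrow> nat gword set \<Rightarrow> 'k" where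
  "rel i \<equiv> (\<delta> [(i, True)] \<otimes>\<^bsub>BA\<^esub> \<delta> [(i, True)]) \<ominus>\<^bsub>BA\<^esub>
        (((q - inverse q) \<odot>\<^bsub>BA\<^esub> \<delta> [(i, True)]) \<oplus>\<^bsub>BA\<^esub> \<one>\<^bsub>BA\<^esub>)"

lemma hecke_ideal_eq: "hecke_ideal n q = Idl\<^bsub>BA\<^esub> (rel ` {1..<n})"
  by (simp add: hecke_ideal_def braid_gen_def Let_def)

lemma gwords_letter: "i \<in> {1..<n} \<Longrightarrow> [(i, s)] \<in> gwords {1..<n}"
  by (simp add: gwords_def)

lemma smult_closed_BA: "f \<in> carrier BA \<Longrightarrow> c \<odot>\<^bsub>BA\<^esub> f \<in> carrier BA"
  unfolding braid_algebra_def by (simp add: group_algebra_simps group_algebra_scale_closed)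

lemma rel_closed: "i \<in> {1..<n} \<Longrightarrow> rel i \<in> carrier BA"
  using delta_closed[OF gwords_letter] smult_closed_BA by simp

lemma rel_in_kernel:
  assumes i: "i \<in> {1..<n}"
  shows "rel i \<in> op_kernel"
proof -
  let ?s = "\<delta> [(i, True)]"
  let ?y = "((q - inverse q) \<odot>\<^bsub>BA\<^esub> ?s) \<oplus>\<^bsub>BA\<^esub> \<one>\<^bsub>BA\<^esub>"
  have s: "?s \<in> carrier BA" by (rule delta_closed[OF gwords_letter[OF i]])
  have y: "?y \<in> carrier BA" using s smult_closed_BA by simp
  \<comment> \<open>The relation is rearranged into a sum, so that \<open>algebra_op_add\<close>
    applies.\<close>
  have ss: "?s \<otimes>\<^bsub>BA\<^esub> ?s = rel i \<oplus>\<^bsub>BA\<^esub> ?y"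
    using s y by (simp add: BA.minus_eq BA.a_assoc BA.l_neg)
  have sop: "algebra_op q ?s v = hecke_op q i v" for v
    using algebra_op_delta[OF gwords_letter[OF i], of True v] by (simp add: letter_op_def)
  have oop: "algebra_op q \<one>\<^bsub>BA\<^esub> v = v" for v
    unfolding one_BA using algebra_op_delta[of "[]" v] by (simp add: gwords_def)
  have "algebra_op q (rel i) v = 0" for v
  proof -
    have "hecke_op q i (hecke_op q i v) = algebra_op q (rel i) v + algebra_op q ?y v"
      using algebra_op_mult[OF s s, of v] algebra_op_add[OF rel_closed[OF i] y, of v] ss sop by simp
    also have "algebra_op q ?y v = scl (q - inverse q) (hecke_op q i v) + v"
      using algebra_op_add[OF smult_closed_BA[OF s] BA.one_closed, of "q - inverse q" v]
      by (simp add: algebra_op_smult sop oop)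
    finally show ?thesis using hecke_op_quadratic[of i q v] i q0 by simp
  qed
  then show ?thesis using rel_closed[OF i] by (simp add: op_kernel_def)
qed

sublocale quotient_algebra BA "hecke_ideal n q"
proof (rule quotient_algebra.intro)
  show "ring BA" by (rule BA.ring_axioms)
  show "Module.module class_ring BA" unfolding braid_algebra_def by (rule module_group_algebra[OF monoid_G])
  show "ideal (hecke_ideal n q) BA" unfolding hecke_ideal_eq
    using rel_closed by (intro BA.genideal_ideal) auto
qed (simp_all add: braid_algebra_def group_algebra_smult_mult[OF monoid_G])

interpretation H: ring H by (rule ring_H)

lemma hecke_algebra_eq: "hecke_algebra n q = H"
  by (simp add: hecke_algebra_def)

lemma hecke_ideal_kernel: "hecke_ideal n q \<subseteq> op_kernel"
  unfolding hecke_ideal_eq using rel_in_kernel by (intro BA.genideal_minimal[OF ideal_op_kernel]) auto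

definition hop :: "(nat gword set \<Rightarrow> 'k) set \<Rightarrow> 'k wfun \<Rightarrow> 'k wfun" where
  "hop X v = algebra_op q (SOME y. y \<in> X) v"

lemma hop_proj:
  assumes x: "x \<in> carrier BA"
  shows "hop (proj x) v = algebra_op q x v"
proof -
  have "(SOME y. y \<in> proj x) \<in> proj x" by (rule someI[of "\<lambda>y. y \<in> proj x", OF proj_self[OF x]])
  then obtain i where i: "i \<in> hecke_ideal n q" "(SOME y. y \<in> proj x) = i \<oplus>\<^bsub>BA\<^esub> x"
    by (rule mem_projE)
  then have "i \<in> carrier BA" "algebra_op q i v = 0" using hecke_ideal_kernel by (auto simp: op_kernel_def)
  then show ?thesis using x by (simp add: hop_def i(2) algebra_op_add)
qed

lemma hop_add: "X \<in> carrier H \<Longrightarrow> Y \<in> carrier H \<Longrightarrow> hop (X \<oplus>\<^bsub>H\<^esub> Y) v = hop X v + hop Y v"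
  by (auto simp: carrier_H proj_add hop_proj algebra_op_add)

lemma hop_smult: "X \<in> carrier H \<Longrightarrow> hop (c \<odot>\<^bsub>H\<^esub> X) v = scl c (hop X v)"
  by (auto simp: carrier_H proj_smult hop_proj smult_closed algebra_op_smult)

lemma hop_mult: "X \<in> carrier H \<Longrightarrow> Y \<in> carrier H \<Longrightarrow> hop (X \<otimes>\<^bsub>H\<^esub> Y) v = hop X (hop Y v)"
  by (auto simp: carrier_H proj_mult hop_proj algebra_op_mult)

lemma hop_one: "hop \<one>\<^bsub>H\<^esub> v = v"
  using algebra_op_delta[of "[]" v] delta_closed[of "[]"]
  by (simp add: proj_one one_BA hop_proj gwords_def)

lemma hop_zero: "hop \<zero>\<^bsub>H\<^esub> v = 0"
  by (simp add: proj_zero hop_proj algebra_op_zero)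

section \<open>Generators and relations in the quotient\<close>

abbreviation "gen i \<equiv> hecke_gen n q i"

lemma gen_eq: "gen i = proj (\<delta> [(i, True)])"
  by (simp add: hecke_gen_def braid_gen_def)

lemma gen_closed: "i \<in> {1..<n} \<Longrightarrow> gen i \<in> carrier H"
  unfolding gen_eq by (intro proj_closed delta_closed gwords_letter)

lemma hop_gen: "i \<in> {1..<n} \<Longrightarrow> hop (gen i) v = hecke_op q i v"
  using algebra_op_delta[OF gwords_letter, of i True v] delta_closed[OF gwords_letter, of i True]
  by (simp add: gen_eq hop_proj letter_op_def)

lemma proj_delta_mult:
  "u \<in> gwords {1..<n} \<Longrightarrow> v \<in> gwords {1..<n} \<Longrightarrow> proj (\<delta> u) \<otimes>\<^bsub>H\<^esub> proj (\<delta> v) = proj (\<delta> (u @ v))"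
  by (simp add: proj_mult delta_closed delta_mult)

lemma gen_quadratic:
  assumes i: "i \<in> {1..<n}"
  shows "gen i \<otimes>\<^bsub>H\<^esub> gen i = ((q - inverse q) \<odot>\<^bsub>H\<^esub> gen i) \<oplus>\<^bsub>H\<^esub> \<one>\<^bsub>H\<^esub>"
proof -
  let ?s = "\<delta> [(i, True)]"
  let ?y = "((q - inverse q) \<odot>\<^bsub>BA\<^esub> ?s) \<oplus>\<^bsub>BA\<^esub> \<one>\<^bsub>BA\<^esub>"
  have s: "?s \<in> carrier BA" by (rule delta_closed[OF gwords_letter[OF i]])
  have y: "?y \<in> carrier BA" using s smult_closed_BA by simp
  have "?s \<otimes>\<^bsub>BA\<^esub> ?s = rel i \<oplus>\<^bsub>BA\<^esub> ?y"
    using s y by (simp add: BA.minus_eq BA.a_assoc BA.l_neg)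
  then have "gen i \<otimes>\<^bsub>H\<^esub> gen i = proj (rel i) \<oplus>\<^bsub>H\<^esub> proj ?y"
    using s y rel_closed[OF i] by (simp add: gen_eq proj_mult proj_add)
  moreover have "rel i \<in> hecke_ideal n q" unfolding hecke_ideal_eq
    using BA.genideal_self[of "rel ` {1..<n}"] rel_closed i by blast
  ultimately have "gen i \<otimes>\<^bsub>H\<^esub> gen i = proj ?y"
    using proj_ideal H.l_zero[OF proj_closed[OF y]] by simp
  then show ?thesis using s smult_closed_BA by (simp add: gen_eq proj_one proj_add[symmetric] proj_smult)
qed

lemma gen_braid:
  assumes "1 \<le> i" "Suc i < n"
  shows "gen i \<otimes>\<^bsub>H\<^esub> (gen (Suc i) \<otimes>\<^bsub>H\<^esub> gen i) = gen (Suc i) \<otimes>\<^bsub>H\<^esub> (gen i \<otimes>\<^bsub>H\<^esub> gen (Suc i))"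
proof -
  have g: "[(i, True), (Suc i, True), (i, True)] \<in> gwords {1..<n}"
    "[(Suc i, True), (i, True), (Suc i, True)] \<in> gwords {1..<n}"
    "[(i, True), (Suc i, True)] \<in> gwords {1..<n}" "[(Suc i, True), (i, True)] \<in> gwords {1..<n}"
    "[(i, True)] \<in> gwords {1..<n}" "[(Suc i, True)] \<in> gwords {1..<n}"
    using assms by (auto simp: gwords_def)
  have "([(i, True), (Suc i, True), (i, True)], [(Suc i, True), (i, True), (Suc i, True)]) \<in> braid_relations n"
    unfolding braid_relations_def using assms by auto
  then have "\<delta> [(i, True), (Suc i, True), (i, True)] = \<delta> [(Suc i, True), (i, True), (Suc i, True)]"
    using g by (intro delta_cong pres_rel)
  then show ?thesis unfolding gen_eq using g by (simp add: proj_delta_mult)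
qed

lemma gen_commute:
  assumes "1 \<le> i" "Suc i < j" "j < n"
  shows "gen i \<otimes>\<^bsub>H\<^esub> gen j = gen j \<otimes>\<^bsub>H\<^esub> gen i"
proof -
  have g: "[(i, True), (j, True)] \<in> gwords {1..<n}" "[(j, True), (i, True)] \<in> gwords {1..<n}"
    "[(i, True)] \<in> gwords {1..<n}" "[(j, True)] \<in> gwords {1..<n}"
    using assms by (auto simp: gwords_def)
  have "([(i, True), (j, True)], [(j, True), (i, True)]) \<in> braid_relations n"
    unfolding braid_relations_def using assms by auto
  then have "\<delta> [(i, True), (j, True)] = \<delta> [(j, True), (i, True)]"
    using g by (intro delta_cong pres_rel)
  then show ?thesis unfolding gen_eq using g by (simp add: proj_delta_mult)
qed

text \<open>Multiply the quadratic relation from the left by the inverse of the generator. It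
  follows that inverse letters contribute nothing beyond the span of products of generators.\<close>

lemma gen_inverse:
  assumes i: "i \<in> {1..<n}"
  shows "proj (\<delta> [(i, False)]) = gen i \<oplus>\<^bsub>H\<^esub> ((- (q - inverse q)) \<odot>\<^bsub>H\<^esub> \<one>\<^bsub>H\<^esub>)"
proof -
  interpret M: Module.module class_ring H by (rule module_H)
  let ?t = "proj (\<delta> [(i, False)])" and ?c = "q - inverse q"
  have g: "[(i, True)] \<in> gwords {1..<n}" "[(i, False)] \<in> gwords {1..<n}" "[(i, False), (i, True)] \<in> gwords {1..<n}"
    using i by (auto simp: gwords_def)
  have t: "?t \<in> carrier H" and s: "gen i \<in> carrier H"
    using g proj_closed delta_closed gen_closed i by auto
  have "\<delta> [(i, False), (i, True)] = \<delta> []"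
    using pres_cancel[of i "{1..<n}" False "braid_relations n"] i by (intro delta_cong) simp
  then have ts: "?t \<otimes>\<^bsub>H\<^esub> gen i = \<one>\<^bsub>H\<^esub>"
    using g by (simp add: gen_eq proj_delta_mult proj_one one_BA)
  have sm: "a \<odot>\<^bsub>H\<^esub> x \<in> carrier H" if "x \<in> carrier H" for a x using M.smult_closed[of a x] that by simp
  have "?t \<otimes>\<^bsub>H\<^esub> (gen i \<otimes>\<^bsub>H\<^esub> gen i) = gen i" using ts t s by (simp add: H.m_assoc[symmetric])
  moreover have "?t \<otimes>\<^bsub>H\<^esub> (gen i \<otimes>\<^bsub>H\<^esub> gen i) = (?c \<odot>\<^bsub>H\<^esub> \<one>\<^bsub>H\<^esub>) \<oplus>\<^bsub>H\<^esub> ?t"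
    unfolding gen_quadratic[OF i] using t s sm by (simp add: H.r_distr H_smult_mult ts)
  ultimately have e: "gen i = (?c \<odot>\<^bsub>H\<^esub> \<one>\<^bsub>H\<^esub>) \<oplus>\<^bsub>H\<^esub> ?t" by simp
  have "(?c \<odot>\<^bsub>H\<^esub> \<one>\<^bsub>H\<^esub>) \<oplus>\<^bsub>H\<^esub> ((- ?c) \<odot>\<^bsub>H\<^esub> \<one>\<^bsub>H\<^esub>) = (?c + - ?c) \<odot>\<^bsub>H\<^esub> \<one>\<^bsub>H\<^esub>"
    using M.smult_l_distr[of ?c "- ?c" "\<one>\<^bsub>H\<^esub>"] by simp
  also have "\<dots> = \<zero>\<^bsub>H\<^esub>" using M.lmult_0[of "\<one>\<^bsub>H\<^esub>"] by simp
  finally have "(?c \<odot>\<^bsub>H\<^esub> \<one>\<^bsub>H\<^esub>) \<oplus>\<^bsub>H\<^esub> ((- ?c) \<odot>\<^bsub>H\<^esub> \<one>\<^bsub>H\<^esub>) = \<zero>\<^bsub>H\<^esub>" .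
  then show ?thesis using t sm[OF H.one_closed]
    by (subst e) (metis H.a_assoc H.a_comm H.l_zero)
qed

text \<open>Braid words are built by prefixing letters; an inverse letter is traded by
  \<open>gen_inverse\<close> for the cases \<open>gen\<close>, \<open>smult\<close> and
  \<open>add\<close>.\<close>

lemma H_induct [consumes 1, case_names one add smult gen]:
  assumes x: "x \<in> carrier H"
    and one: "P \<one>\<^bsub>H\<^esub>"
    and add: "\<And>x y. x \<in> carrier H \<Longrightarrow> y \<in> carrier H \<Longrightarrow> P x \<Longrightarrow> P y \<Longrightarrow> P (x \<oplus>\<^bsub>H\<^esub> y)"
    and smult: "\<And>c x. x \<in> carrier H \<Longrightarrow> P x \<Longrightarrow> P (c \<odot>\<^bsub>H\<^esub> x)"
    and gen: "\<And>i x. i \<in> {1..<n} \<Longrightarrow> x \<in> carrier H \<Longrightarrow> P x \<Longrightarrow> P (gen i \<otimes>\<^bsub>H\<^esub> x)"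
  shows "P x"
proof -
  interpret M: Module.module class_ring H by (rule module_H)
  have sm: "a \<odot>\<^bsub>H\<^esub> x \<in> carrier H" if "x \<in> carrier H" for a x using M.smult_closed[of a x] that by simp
  have word: "P (proj (\<delta> u))" if "u \<in> gwords {1..<n}" for u
    using that
  proof (induction u)
    case Nil
    then show ?case using one by (simp add: proj_one one_BA)
  next
    case (Cons l u)
    obtain i s where l: "l = (i, s)" by fastforce
    have i: "i \<in> {1..<n}" and u: "u \<in> gwords {1..<n}" using Cons.prems l by (auto simp: gwords_def)
    have Pu: "P (proj (\<delta> u))" and uc: "proj (\<delta> u) \<in> carrier H"
      using Cons.IH u proj_closed delta_closed by auto
    have e: "proj (\<delta> (l # u)) = proj (\<delta> [(i, s)]) \<otimes>\<^bsub>H\<^esub> proj (\<delta> u)"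
      using proj_delta_mult[OF gwords_letter[OF i] u] l by simp
    show ?case
    proof (cases s)
      case True
      then show ?thesis using gen[OF i uc Pu] e by (simp add: gen_eq)
    next
      case False
      have "proj (\<delta> (l # u)) = (gen i \<otimes>\<^bsub>H\<^esub> proj (\<delta> u)) \<oplus>\<^bsub>H\<^esub> ((- (q - inverse q)) \<odot>\<^bsub>H\<^esub> proj (\<delta> u))"
        unfolding e using False gen_inverse[OF i] uc gen_closed[OF i] sm
        by (simp add: H.l_distr H_smult_mult)
      then show ?thesis using gen[OF i uc Pu] smult[OF uc Pu] gen_closed[OF i] uc sm by (simp add: add)
    qed
  qed
  obtain f where f: "f \<in> carrier BA" "x = proj f" using x by (auto simp: carrier_H)
  have "f \<in> carrier (group_algebra G)" using f by (simp add: braid_algebra_def)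
  then have "P (proj f)"
  proof (induction rule: group_algebra_induct)
    case (add f f')
    then have c: "f \<in> carrier BA" "f' \<in> carrier BA" by (simp_all add: braid_algebra_def)
    have "P (proj f \<oplus>\<^bsub>H\<^esub> proj f')" using add c by (intro assms(3) proj_closed)
    then show ?case using proj_add[OF c] by (simp add: braid_algebra_def)
  next
    case (elem c g)
    then obtain u where u: "u \<in> gwords {1..<n}" "g = cls u" by (auto simp: carrier_G)
    then show ?case using smult[OF proj_closed[OF delta_closed[OF u(1)]] word[OF u(1)], of c]
      by (simp add: proj_smult delta_closed braid_algebra_def[symmetric])
  next
    show "carrier G \<noteq> {}" by (auto simp: carrier_G gwords_def)
  qed
  then show ?thesis using f by simp
qed

end

lemma red_word_sorted: "sorted_wrt (>) xs \<Longrightarrow> red_word xs = []"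
proof (induction xs)
  case (Cons x xs)
  then have "filter ((<) x) xs = []" by (auto simp: filter_empty_conv)
  then show ?case using Cons by simp
qed simp

text \<open>Unrolling the recursion appends \<open>\<sigma>_n\<close> on the right of every product
  and raises the exponent of q by one, which matches the summands of
  \<open>additive_shuffle\<close>.\<close>

lemma shuffle_op_eq_sum:
  "shuffle_op q n f = (\<Sum>k<n. scl (q ^ k) (foldr (hecke_op q) [n - k..<n] f))"
proof (induction n arbitrary: f)
  case (Suc n)
  have "scl q (shuffle_op q n (hecke_op q n f))
      = (\<Sum>k<n. scl (q ^ Suc k) (foldr (hecke_op q) [Suc n - Suc k..<Suc n] f))"
    unfolding Suc by (simp add: fv.scale_sum_right)
  then show ?case by (simp add: sum.lessThan_Suc_shift del: upt_Suc sum.lessThan_Suc)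
qed simp

lemma fspan_image_coeffs:
  fixes b :: "'a \<Rightarrow> 'k::field wfun"
  assumes "finite S" "inj_on b S" "f \<in> fv.span (b ` S)"
  obtains c where "f = (\<Sum>w\<in>S. scl (c w) (b w))"
proof -
  obtain u where "f = (\<Sum>v\<in>b ` S. scl (u v) v)"
    using assms fv.span_finite[of "b ` S"] by auto
  then have "f = (\<Sum>w\<in>S. scl (u (b w)) (b w))" by (simp add: sum.reindex[OF assms(2)])
  then show ?thesis by (rule that)
qed

lemma fspan_independent_coeffs:
  fixes b :: "'a \<Rightarrow> 'k::field wfun"
  assumes "finite S" "inj_on b S" "fv.independent (b ` S)" "(\<Sum>w\<in>S. scl (c w) (b w)) = 0" "w \<in> S"
  shows "c w = 0"
proof -
  let ?u = "\<lambda>v. c (inv_into S b v)"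
  have "(\<Sum>v\<in>b ` S. scl (?u v) v) = (\<Sum>w\<in>S. scl (c w) (b w))"
    using assms(2) by (simp add: sum.reindex[OF assms(2)])
  then have "?u (b w) = 0" using assms
    by (intro fv.independentD[OF assms(3), of "b ` S" ?u "b w"]) auto
  then show ?thesis using assms by simp
qed

section \<open>The standard basis and faithfulness on the decreasing word\<close>

context hecke
begin

interpretation H: ring H by (rule ring_H)

sublocale class_vectorspace H
  unfolding class_vectorspace_def vectorspace_def using module_H class_field by blast

abbreviation "Perm \<equiv> permutations_of_set {1..n}"

lemma Perm_iff: "xs \<in> Perm \<longleftrightarrow> distinct xs \<and> set xs = {1..n}"
  by (auto simp: permutations_of_set_def)

lemma Perm_length: "xs \<in> Perm \<Longrightarrow> length xs = n"
  by (metis Perm_iff card_atLeastAtMost diff_Suc_1 distinct_card)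

lemma H_smult_closed: "x \<in> carrier H \<Longrightarrow> c \<odot>\<^bsub>H\<^esub> x \<in> carrier H"
  using Module.module.smult_closed[OF module_H, of c x] by simp

lemma braid_family_gen: "braid_family n (carrier H) (\<lambda>i x. gen i \<otimes>\<^bsub>H\<^esub> x)"
  unfolding braid_family_def
proof (intro conjI allI impI)
  fix i x assume "1 \<le> i" "i < n" "x \<in> carrier H"
  then show "gen i \<otimes>\<^bsub>H\<^esub> x \<in> carrier H" using gen_closed[of i] by simp
next
  fix i x assume i: "1 \<le> i" "Suc i < n" and x: "x \<in> carrier H"
  have "gen i \<in> carrier H" "gen (Suc i) \<in> carrier H" using i gen_closed by auto
  then show "gen i \<otimes>\<^bsub>H\<^esub> (gen (Suc i) \<otimes>\<^bsub>H\<^esub> (gen i \<otimes>\<^bsub>H\<^esub> x))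
     = gen (Suc i) \<otimes>\<^bsub>H\<^esub> (gen i \<otimes>\<^bsub>H\<^esub> (gen (Suc i) \<otimes>\<^bsub>H\<^esub> x))"
    using gen_braid[OF i] x by (metis H.m_assoc H.m_closed)
next
  fix i j x assume i: "1 \<le> i" "Suc i < j" "j < n" and x: "x \<in> carrier H"
  have "gen i \<in> carrier H" "gen j \<in> carrier H" using i gen_closed by auto
  then show "gen i \<otimes>\<^bsub>H\<^esub> (gen j \<otimes>\<^bsub>H\<^esub> x) = gen j \<otimes>\<^bsub>H\<^esub> (gen i \<otimes>\<^bsub>H\<^esub> x)"
    using gen_commute[OF i] x by (metis H.m_assoc)
qed

abbreviation "gprod ws \<equiv> foldr (\<lambda>i x. gen i \<otimes>\<^bsub>H\<^esub> x) ws \<one>\<^bsub>H\<^esub>"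
abbreviation "T xs \<equiv> gprod (red_word xs)"

lemma gprod_closed: "(\<And>i. i \<in> set ws \<Longrightarrow> 1 \<le> i \<and> i < n) \<Longrightarrow> gprod ws \<in> carrier H"
  by (rule braid_family_foldr_closed[OF braid_family_gen]) auto

lemma hop_gprod: "(\<And>i. i \<in> set ws \<Longrightarrow> 1 \<le> i \<and> i < n) \<Longrightarrow> hop (gprod ws) v = foldr (hecke_op q) ws v"
proof (induction ws)
  case Nil
  then show ?case by (simp add: hop_one)
next
  case (Cons i ws)
  then have "i \<in> {1..<n}" "gprod ws \<in> carrier H" using gprod_closed[of ws] by auto
  then show ?case using Cons gen_closed[of i] by (simp add: hop_mult hop_gen)
qed

lemma T_closed: "xs \<in> Perm \<Longrightarrow> T xs \<in> carrier H"
  by (rule gprod_closed) (use red_word_bound Perm_length in metis)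

definition vac :: "'k wfun" where
  "vac = word_fun (rev [1..<Suc n])"

lemma hop_T: "xs \<in> Perm \<Longrightarrow> hop (T xs) vac = word_fun xs"
  using foldr_hecke_op_red_word[of xs n q] hop_gprod[of "red_word xs" vac]
    red_word_bound[of _ xs] Perm_length[of xs] by (simp add: vac_def del: upt_Suc)

text \<open>Only the values at permutation words enter. On their span this is inverse to evaluating
  an element of the Hecke algebra at \<open>vac\<close>.\<close>

definition embed :: "'k wfun \<Rightarrow> (nat gword set \<Rightarrow> 'k) set" where
  "embed f = (\<Oplus>\<^bsub>H\<^esub>xs\<in>Perm. f (pad xs) \<odot>\<^bsub>H\<^esub> T xs)"

lemma embed_closed: "embed f \<in> carrier H"
  unfolding embed_def by (intro H.finsum_closed) (auto intro: H_smult_closed T_closed)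

lemma hop_finsum:
  assumes "finite S" "\<And>x. x \<in> S \<Longrightarrow> g x \<in> carrier H"
  shows "hop (\<Oplus>\<^bsub>H\<^esub>x\<in>S. g x) v = (\<Sum>x\<in>S. hop (g x) v)"
  using assms
proof (induction S rule: finite_induct)
  case (insert a S)
  then have "(\<Oplus>\<^bsub>H\<^esub>x\<in>S. g x) \<in> carrier H" "g \<in> S \<rightarrow> carrier H" "g a \<in> carrier H"
    by (auto intro!: H.finsum_closed)
  then show ?case using insert by (simp add: H.finsum_insert hop_add)
qed (simp add: hop_zero)

lemma hop_embed: "hop (embed f) vac = (\<Sum>xs\<in>Perm. scl (f (pad xs)) (word_fun xs))"
  unfolding embed_def
  by (subst hop_finsum) (auto intro!: sum.cong H_smult_closed T_closed simp: hop_smult T_closed hop_T)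

lemma sum_word_fun_apply:
  assumes "ys \<in> Perm"
  shows "(\<Sum>xs\<in>Perm. scl (c xs) (word_fun xs)) (pad ys) = c ys"
proof -
  have "(\<Sum>xs\<in>Perm. scl (c xs) (word_fun xs)) (pad ys) = (\<Sum>xs\<in>Perm. if xs = ys then c ys else 0)"
    unfolding wfun_sum_apply scl_apply
    using pad_inject[of ys] Perm_length assms by (intro sum.cong) (auto simp: word_fun_def)
  then show ?thesis using assms by simp
qed

lemma embed_eqI: "(\<And>xs. xs \<in> Perm \<Longrightarrow> f (pad xs) = g (pad xs)) \<Longrightarrow> embed f = embed g"
  unfolding embed_def by (intro H.finsum_cong') (auto intro: H_smult_closed T_closed)

lemma embed_add: "embed (f + g) = embed f \<oplus>\<^bsub>H\<^esub> embed g"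
proof -
  have "embed (f + g) = (\<Oplus>\<^bsub>H\<^esub>xs\<in>Perm. (f (pad xs) \<odot>\<^bsub>H\<^esub> T xs) \<oplus>\<^bsub>H\<^esub> (g (pad xs) \<odot>\<^bsub>H\<^esub> T xs))"
    unfolding embed_def
    by (intro H.finsum_cong')
      (use Module.module.smult_l_distr[OF module_H] in \<open>auto simp: plus_fun_apply intro!: H_smult_closed T_closed\<close>)
  also have "\<dots> = embed f \<oplus>\<^bsub>H\<^esub> embed g"
    unfolding embed_def by (intro H.finsum_addf) (auto intro: H_smult_closed T_closed)
  finally show ?thesis .
qed

lemma embed_scl: "embed (scl c f) = c \<odot>\<^bsub>H\<^esub> embed f"
proof -
  have "embed (scl c f) = (\<Oplus>\<^bsub>H\<^esub>xs\<in>Perm. c \<odot>\<^bsub>H\<^esub> (f (pad xs) \<odot>\<^bsub>H\<^esub> T xs))"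
    unfolding embed_def
    by (intro H.finsum_cong')
      (use Module.module.smult_assoc1[OF module_H] in \<open>auto simp: scl_apply intro!: H_smult_closed T_closed\<close>)
  also have "\<dots> = c \<odot>\<^bsub>H\<^esub> embed f"
    unfolding embed_def by (intro finsum_smult[symmetric]) (auto intro: H_smult_closed T_closed)
  finally show ?thesis .
qed

lemma embed_word_fun:
  assumes "ys \<in> Perm"
  shows "embed (word_fun ys) = T ys"
proof -
  have "embed (word_fun ys) = (\<Oplus>\<^bsub>H\<^esub>xs\<in>Perm. if ys = xs then T xs else \<zero>\<^bsub>H\<^esub>)"
    unfolding embed_def
    by (intro H.finsum_cong')
      (use assms pad_inject[of ys] Perm_length T_closed lmult_0 smult_one in \<open>auto simp: word_fun_def\<close>)
  also have "\<dots> = T ys" using assms T_closed by (intro H.finsum_singleton) auto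
  finally show ?thesis .
qed

text \<open>At a descent the product is the \<open>T\<close> of the swapped word. At an ascent
  \<open>T xs\<close> already has \<open>gen i\<close> as its left factor, and the quadratic
  relation applies. So the span of the \<open>T xs\<close> is stable under left
  multiplication.\<close>

lemma gen_T_in_range:
  assumes i: "i \<in> {1..<n}" and xs: "xs \<in> Perm"
  shows "gen i \<otimes>\<^bsub>H\<^esub> T xs \<in> range embed"
proof -
  have len: "length xs = n" using Perm_length[OF xs] .
  define as x y bs where "as = take (i - 1) xs" and "x = xs ! (i - 1)" and "y = xs ! i" and "bs = drop (Suc i) xs"
  have "Suc (i - 1) = i" "i - 1 < length xs" using i len by auto
  then have "xs = as @ x # drop i xs" using id_take_nth_drop[of "i - 1" xs] by (simp add: as_def x_def)
  then have xs_eq: "xs = as @ x # y # bs"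
    using Cons_nth_drop_Suc[of i xs] i len by (simp add: y_def bs_def)
  have la: "Suc (length as) = i" using i len by (auto simp: as_def min_def)
  let ?ys = "as @ y # x # bs"
  have ys: "?ys \<in> Perm" using xs unfolding xs_eq Perm_iff by auto
  note sw = red_word_swap[OF braid_family_gen H.one_closed]
  have "x \<noteq> y" using xs xs_eq by (simp add: Perm_iff)
  then consider "y < x" | "x < y" by linarith
  then show ?thesis
  proof cases
    case 1
    have "gen i \<otimes>\<^bsub>H\<^esub> T xs = T ?ys" using sw[of as x y bs] 1 la len unfolding xs_eq by simp
    then show ?thesis using embed_word_fun[OF ys] by (metis rangeI)
  next
    case 2
    have Tx: "T xs = gen i \<otimes>\<^bsub>H\<^esub> T ?ys" using sw[of as y x bs] 2 la len unfolding xs_eq by simp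
    have "gen i \<otimes>\<^bsub>H\<^esub> T xs = (gen i \<otimes>\<^bsub>H\<^esub> gen i) \<otimes>\<^bsub>H\<^esub> T ?ys"
      using gen_closed[OF i] T_closed[OF ys] by (simp add: Tx H.m_assoc)
    also have "\<dots> = ((q - inverse q) \<odot>\<^bsub>H\<^esub> T xs) \<oplus>\<^bsub>H\<^esub> T ?ys"
      unfolding gen_quadratic[OF i] using gen_closed[OF i] T_closed[OF ys]
      by (simp add: Tx H.l_distr H_smult_mult H_smult_closed)
    also have "\<dots> = embed (scl (q - inverse q) (word_fun xs) + word_fun ?ys)"
      using embed_word_fun[OF xs] embed_word_fun[OF ys] by (simp add: embed_add embed_scl)
    finally show ?thesis by (metis rangeI)
  qed
qed

lemma finsum_in_range_embed:
  assumes "finite S" "\<And>x. x \<in> S \<Longrightarrow> g x \<in> range embed"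
  shows "(\<Oplus>\<^bsub>H\<^esub>x\<in>S. g x) \<in> range embed"
  using assms
proof (induction S rule: finite_induct)
  case empty
  have "embed 0 = \<zero>\<^bsub>H\<^esub>"
    using embed_scl[of 0 0] lmult_0[OF embed_closed] by simp
  then show ?case by (metis H.finsum_empty rangeI)
next
  case (insert a S)
  have g: "g x \<in> carrier H" if "x \<in> insert a S" for x using insert.prems[OF that] embed_closed by auto
  obtain f f' where "g a = embed f" "(\<Oplus>\<^bsub>H\<^esub>x\<in>S. g x) = embed f'" using insert by blast
  moreover have "(\<Oplus>\<^bsub>H\<^esub>x\<in>insert a S. g x) = g a \<oplus>\<^bsub>H\<^esub> (\<Oplus>\<^bsub>H\<^esub>x\<in>S. g x)"
    using insert(1,2) g by (intro H.finsum_insert) auto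
  ultimately have "(\<Oplus>\<^bsub>H\<^esub>x\<in>insert a S. g x) = embed (f + f')" by (simp add: embed_add)
  then show ?case by blast
qed

lemma embed_surj:
  assumes "x \<in> carrier H"
  shows "x \<in> range embed"
  using assms
proof (induction rule: H_induct)
  case one
  have r: "rev [1..<Suc n] \<in> Perm" by (auto simp: Perm_iff simp del: upt_Suc)
  have "red_word (rev [1..<Suc n]) = []" by (rule red_word_sorted) (simp add: sorted_wrt_rev del: upt_Suc)
  then have "\<one>\<^bsub>H\<^esub> = embed (word_fun (rev [1..<Suc n]))" using embed_word_fun[OF r] by (simp del: upt_Suc)
  then show ?case by blast
next
  case (add x y)
  then obtain f g where "x = embed f" "y = embed g" by blast
  then have "x \<oplus>\<^bsub>H\<^esub> y = embed (f + g)" by (simp only: embed_add)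
  then show ?case by blast
next
  case (smult c x)
  then obtain f where "x = embed f" by blast
  then have "c \<odot>\<^bsub>H\<^esub> x = embed (scl c f)" by (simp only: embed_scl)
  then show ?case by blast
next
  case (gen i x)
  then obtain f where x: "x = embed f" by blast
  have "gen i \<otimes>\<^bsub>H\<^esub> x = (\<Oplus>\<^bsub>H\<^esub>xs\<in>Perm. gen i \<otimes>\<^bsub>H\<^esub> (f (pad xs) \<odot>\<^bsub>H\<^esub> T xs))"
    unfolding x embed_def using gen_closed[OF gen(1)]
    by (intro H.finsum_rdistr) (auto intro: H_smult_closed T_closed)
  also have "\<dots> \<in> range embed"
  proof (rule finsum_in_range_embed)
    fix xs assume xs: "xs \<in> Perm"
    obtain g where "gen i \<otimes>\<^bsub>H\<^esub> T xs = embed g" using gen_T_in_range[OF gen(1) xs] by blast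
    then have "gen i \<otimes>\<^bsub>H\<^esub> (f (pad xs) \<odot>\<^bsub>H\<^esub> T xs) = embed (scl (f (pad xs)) g)"
      using gen_closed[OF gen(1)] T_closed[OF xs] by (simp add: H_smult_mult embed_scl)
    then show "gen i \<otimes>\<^bsub>H\<^esub> (f (pad xs) \<odot>\<^bsub>H\<^esub> T xs) \<in> range embed" by blast
  qed simp
  finally show ?case .
qed

text \<open>Upper and lower bound meet: the elements \<open>T xs\<close> span, and their images at
  \<open>vac\<close> are distinct word functions, from which the coefficients can be read
  off.\<close>

lemma hop_vac_inj:
  assumes "x \<in> carrier H" "y \<in> carrier H" "hop x vac = hop y vac"
  shows "x = y"
proof -
  obtain f g where x: "x = embed f" and y: "y = embed g" using embed_surj assms by blast
  have "f (pad xs) = g (pad xs)" if "xs \<in> Perm" for xs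
    using assms(3) sum_word_fun_apply[OF that, of "\<lambda>xs. f (pad xs)"] sum_word_fun_apply[OF that, of "\<lambda>xs. g (pad xs)"]
    unfolding x y hop_embed by simp
  then show ?thesis unfolding x y by (rule embed_eqI)
qed

lemma hop_vac_in_span: "x \<in> carrier H \<Longrightarrow> hop x vac \<in> fv.span (word_fun ` Perm)"
proof -
  assume "x \<in> carrier H"
  then obtain f where "x = embed f" using embed_surj by blast
  then show ?thesis
    by (simp only: hop_embed) (rule fv.span_sum, rule fv.span_scale, rule fv.span_base, simp)
qed

lemma word_fun_inj_on: "inj_on (word_fun :: _ \<Rightarrow> 'k wfun) Perm"
  by (rule inj_onI) (metis word_fun_inject Perm_length)

lemma hop_embed_span:
  assumes "f \<in> fv.span (word_fun ` Perm)"
  shows "hop (embed f) vac = f"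
proof -
  obtain c where f: "f = (\<Sum>xs\<in>Perm. scl (c xs) (word_fun xs))"
    using fspan_image_coeffs[OF _ word_fun_inj_on assms] by auto
  have "f (pad xs) = c xs" if "xs \<in> Perm" for xs unfolding f by (rule sum_word_fun_apply[OF that])
  then have "(\<Sum>xs\<in>Perm. scl (f (pad xs)) (word_fun xs)) = (\<Sum>xs\<in>Perm. scl (c xs) (word_fun xs))"
    by (intro sum.cong) auto
  then show ?thesis unfolding hop_embed using f by metis
qed

section \<open>The shuffle operator and its triangular matrix\<close>

abbreviation "Sh \<equiv> shuffle_operator n q"

lemma additive_shuffle_closed: "additive_shuffle n q \<in> carrier H"
  and hop_additive_shuffle: "hop (additive_shuffle n q) v = shuffle_op q n v"
proof -
  have g: "gprod [n - k..<n] \<in> carrier H" if "k < n" for k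
    by (rule gprod_closed) (use that in auto)
  have h: "hop (gprod [n - k..<n]) v = foldr (hecke_op q) [n - k..<n] v" if "k < n" for k
    by (rule hop_gprod) (use that in auto)
  have eq: "additive_shuffle n q = (\<Oplus>\<^bsub>H\<^esub>k\<in>{..<n}. q ^ k \<odot>\<^bsub>H\<^esub> gprod [n - k..<n])"
    by (simp add: additive_shuffle_def hecke_algebra_eq)
  show "additive_shuffle n q \<in> carrier H"
    unfolding eq using g by (intro H.finsum_closed) (auto intro: H_smult_closed)
  show "hop (additive_shuffle n q) v = shuffle_op q n v"
    unfolding eq shuffle_op_eq_sum using g h
    by (subst hop_finsum) (auto intro!: sum.cong H_smult_closed simp: hop_smult)
qed

lemma Sh_closed: "x \<in> carrier H \<Longrightarrow> Sh x \<in> carrier H"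
  using additive_shuffle_closed by (simp add: shuffle_operator_def hecke_algebra_eq)

lemma Sh_add: "x \<in> carrier H \<Longrightarrow> y \<in> carrier H \<Longrightarrow> Sh (x \<oplus>\<^bsub>H\<^esub> y) = Sh x \<oplus>\<^bsub>H\<^esub> Sh y"
  using additive_shuffle_closed by (simp add: shuffle_operator_def hecke_algebra_eq H.r_distr)

lemma Sh_smult: "x \<in> carrier H \<Longrightarrow> Sh (c \<odot>\<^bsub>H\<^esub> x) = c \<odot>\<^bsub>H\<^esub> Sh x"
  using additive_shuffle_closed by (simp add: shuffle_operator_def hecke_algebra_eq H_smult_mult)

lemma hop_Sh: "x \<in> carrier H \<Longrightarrow> hop (Sh x) v = shuffle_op q n (hop x v)"
  using additive_shuffle_closed
  by (simp add: shuffle_operator_def hecke_algebra_eq hop_mult hop_additive_shuffle)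

abbreviation "eig w \<equiv> \<Sum>i<card (singles w). q ^ (2 * i)"

lemma triangular_operator_matrix:
  obtains bs M ws where "operator_matrix H Sh bs M" "M \<in> carrier_mat (length ws) (length ws)"
    "upper_triangular M" "diag_mat M = map eig ws" "set ws = Perm" "distinct ws"
proof -
  define b :: "nat list \<Rightarrow> 'k wfun" where "b = shuffle_basis q []"
  obtain l where l: "set l = Perm" "distinct l"
    using finite_distinct_list[of Perm] by auto
  \<comment> \<open>Decreasing number of single letters: the operator adds only vectors with more
    single letters, which must come earlier for an upper triangular matrix.\<close>
  define ws where "ws = rev (sort_key (\<lambda>w. card (singles w)) l)"
  have ws: "set ws = Perm" "distinct ws" using l by (auto simp: ws_def)
  define N where "N = length ws"
  have wsP: "ws ! i \<in> Perm" if "i < N" for i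
    using that unfolding ws(1)[symmetric] N_def by (rule nth_mem)
  have mono: "card (singles (ws ! i)) \<le> card (singles (ws ! j))" if "j \<le> i" "i < N" for i j
  proof -
    have "sorted (rev (map (\<lambda>w. card (singles w)) ws))" by (simp add: ws_def rev_map)
    then show ?thesis using sorted_rev_nth_mono[of "map (\<lambda>w. card (singles w)) ws" j i] that
      by (simp add: N_def)
  qed
  have injb: "inj_on b Perm" and indb: "fv.independent (b ` Perm)"
    using shuffle_basis_independent[OF q0, of "{1..n}" "[]"] by (auto simp: b_def)
  have b_span: "b w \<in> fv.span (word_fun ` Perm)" if "w \<in> Perm" for w
    using shuffle_basis_in_span_word_fun[OF q0 that, of "[]"] by (simp add: b_def)
  have hb: "hop (embed (b w)) vac = b w" if "w \<in> Perm" for w using hop_embed_span[OF b_span[OF that]] .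
  define bs where "bs = map (\<lambda>w. embed (b w)) ws"
  have lbs: "length bs = N" by (simp add: bs_def N_def)
  have bsi: "bs ! i = embed (b (ws ! i))" if "i < N" for i using that by (simp add: bs_def N_def)
  have bsc: "set bs \<subseteq> carrier H" by (auto simp: bs_def embed_closed)
  have "inj_on (\<lambda>w. embed (b w)) (set ws)"
  proof (rule inj_onI)
    fix v w assume vw: "v \<in> set ws" "w \<in> set ws" "embed (b v) = embed (b w)"
    then have "b v = b w" using hb[of v] hb[of w] ws(1) by metis
    then show "v = w" using injb vw ws(1) by (auto dest: inj_onD)
  qed
  then have dbs: "distinct bs" unfolding bs_def distinct_map using ws by simp
  have bij: "bij_betw ((!) ws) {..<N} Perm"
    using bij_betw_nth[OF ws(2), of "{..<N}" "Perm"] ws(1) by (simp add: N_def)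
  have reix: "(\<Sum>i<N. scl (c (ws ! i)) (b (ws ! i))) = (\<Sum>w\<in>Perm. scl (c w) (b w))" for c
    using sum.reindex_bij_betw[OF bij, of "\<lambda>w. scl (c w) (b w)"] .
  have hlc: "hop (list_comb H bs v) vac = (\<Sum>i<N. scl (v $ i) (b (ws ! i)))" for v
    unfolding list_comb_def lbs
    by (subst hop_finsum) (auto intro!: sum.cong H_smult_closed simp: bsi embed_closed hop_smult hb wsP)
  note lcc = list_comb_closed[OF bsc]
  have basis: "basis (set bs)"
  proof (rule basis_listI[OF bsc dbs])
    fix x assume x: "x \<in> carrier H"
    have "fv.span (word_fun ` Perm) \<subseteq> fv.span (b ` Perm)"
      using word_fun_in_span_shuffle_basis[OF q0, of _ "{1..n}" "[]"]
      by (intro fv.span_minimal) (auto simp: b_def)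
    then have "hop x vac \<in> fv.span (b ` Perm)" using hop_vac_in_span[OF x] by blast
    then obtain c where c: "hop x vac = (\<Sum>w\<in>Perm. scl (c w) (b w))"
      using fspan_image_coeffs[OF _ injb] by auto
    have "hop (list_comb H bs (vec N (\<lambda>i. c (ws ! i)))) vac = hop x vac"
      unfolding hlc c by (simp add: reix[symmetric])
    then have "x = list_comb H bs (vec N (\<lambda>i. c (ws ! i)))"
      using hop_vac_inj[OF lcc x] by metis
    then show "\<exists>v\<in>carrier_vec (length bs). x = list_comb H bs v" unfolding lbs
      by (intro bexI[of _ "vec N (\<lambda>i. c (ws ! i))"]) auto
  next
    fix v assume v: "v \<in> carrier_vec (length bs)" and z: "list_comb H bs v = \<zero>\<^bsub>H\<^esub>"
    \<comment> \<open>Coordinates carried over from positions to words, the index set of the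
      independence statement.\<close>
    let ?c = "\<lambda>w. v $ inv_into {..<N} ((!) ws) w"
    have "?c (ws ! i) = v $ i" if "i < N" for i
      using bij_betw_inv_into_left[OF bij] that by simp
    then have "(\<Sum>w\<in>Perm. scl (?c w) (b w)) = (\<Sum>i<N. scl (v $ i) (b (ws ! i)))"
      unfolding reix[symmetric] by simp
    also have "\<dots> = 0" using hlc[of v] hop_zero[of vac] z by simp
    finally have "?c w = 0" if "w \<in> Perm" for w
      using fspan_independent_coeffs[OF _ injb indb, of ?c w] that by simp
    then have "v $ i = 0" if "i < N" for i
      using \<open>\<And>i. i < N \<Longrightarrow> ?c (ws ! i) = v $ i\<close> that wsP by metis
    then show "v = 0\<^sub>v (length bs)" using v lbs by (intro eq_vecI) auto
  qed
  let ?rel = "\<lambda>w d. shuffle_op q n (b w) - scl (eig w) (b w)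
      = (\<Sum>w'\<in>{w' \<in> Perm. card (singles w) < card (singles w')}. scl (d w') (b w'))"
  have ex: "\<exists>d. ?rel w d" if w: "w \<in> Perm" for w
  proof -
    let ?S = "{w' \<in> Perm. card (singles w) < card (singles w')}"
    have mem: "shuffle_op q n (b w) - scl (eig w) (b w) \<in> fv.span (b ` ?S)"
      using shuffle_op_shuffle_basis[OF q0 w, of "[]"] by (simp add: b_def)
    have S: "finite ?S" "inj_on b ?S" using inj_on_subset[OF injb, of ?S] by auto
    obtain d where "shuffle_op q n (b w) - scl (eig w) (b w) = (\<Sum>w'\<in>?S. scl (d w') (b w'))"
      by (rule fspan_image_coeffs[OF S mem])
    then show ?thesis by (rule exI[of _ d])
  qed
  define d where "d w = (SOME d. ?rel w d)" for w
  have d: "?rel w (d w)" if "w \<in> Perm" for w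
    unfolding d_def by (rule someI_ex[OF ex[OF that]])
  \<comment> \<open>The coefficient of \<open>b w'\<close> in the image of \<open>b w\<close>: the
    eigenvalue on the diagonal and the terms of the deeper layers.\<close>
  define m where "m w w' = (if w' = w then eig w else 0)
      + (if card (singles w) < card (singles w') then d w w' else 0)" for w w'
  have m: "shuffle_op q n (b w) = (\<Sum>w'\<in>Perm. scl (m w w') (b w'))" if w: "w \<in> Perm" for w
  proof -
    have "(\<Sum>w'\<in>Perm. scl (m w w') (b w')) = (\<Sum>w'\<in>Perm. if w' = w then scl (eig w) (b w) else 0)
       + (\<Sum>w'\<in>Perm. if card (singles w) < card (singles w') then scl (d w w') (b w') else 0)"
      unfolding sum.distrib[symmetric]
      by (rule sum.cong) (auto simp: m_def)
    also have "\<dots> = scl (eig w) (b w) + (shuffle_op q n (b w) - scl (eig w) (b w))"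
      using w by (simp add: d sum.inter_filter)
    finally show ?thesis by simp
  qed
  define M where "M = mat N N (\<lambda>(i, j). m (ws ! j) (ws ! i))"
  have Mc: "M \<in> carrier_mat N N" by (simp add: M_def)
  have "operator_matrix H Sh bs M" unfolding operator_matrix_def lbs
  proof (intro conjI allI impI dbs basis Mc)
    fix j assume j: "j < N"
    let ?v = "vec N (\<lambda>i. M $$ (i, j))"
    have "(\<Oplus>\<^bsub>H\<^esub>i\<in>{..<N}. M $$ (i, j) \<odot>\<^bsub>H\<^esub> bs ! i) = list_comb H bs ?v"
      unfolding list_comb_def lbs
      by (intro H.finsum_cong') (auto simp: bsi embed_closed intro!: H_smult_closed)
    \<comment> \<open>The identity in the Hecke algebra is tested at \<open>vac\<close>, where it is
      the expansion \<open>m\<close> of word functions.\<close>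
    moreover have "Sh (bs ! j) = list_comb H bs ?v"
    proof (rule hop_vac_inj[OF Sh_closed lcc])
      show "bs ! j \<in> carrier H" using bsi[OF j] embed_closed by simp
      then have "hop (Sh (bs ! j)) vac = shuffle_op q n (b (ws ! j))"
        using hop_Sh hb[OF wsP[OF j]] bsi[OF j] by simp
      also have "\<dots> = (\<Sum>i<N. scl (m (ws ! j) (ws ! i)) (b (ws ! i)))"
        unfolding m[OF wsP[OF j]] using reix[of "m (ws ! j)"] by simp
      also have "\<dots> = hop (list_comb H bs ?v) vac"
        unfolding hlc using j by (intro sum.cong) (auto simp: M_def)
      finally show "hop (Sh (bs ! j)) vac = hop (list_comb H bs ?v) vac" .
    qed
    ultimately show "Sh (bs ! j) = (\<Oplus>\<^bsub>H\<^esub>i\<in>{..<N}. M $$ (i, j) \<odot>\<^bsub>H\<^esub> bs ! i)" by simp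
  qed
  moreover have "upper_triangular M"
  proof
    fix i j assume ij: "j < i" "i < dim_row M"
    then have "ws ! i \<noteq> ws ! j" using ws(2) by (simp add: M_def N_def nth_eq_iff_index_eq)
    then show "M $$ (i, j) = 0" using mono[of j i] ij by (simp add: M_def m_def)
  qed
  moreover have "diag_mat M = map eig ws"
    unfolding diag_mat_def by (rule nth_equalityI) (auto simp: M_def N_def m_def)
  ultimately show ?thesis using that ws Mc unfolding N_def by blast
qed

end

section \<open>Eigenvalues and multiplicities\<close>

lemma order_prod_list_linear:
  fixes a :: "'k::field"
  shows "Polynomial.order a (\<Prod>x\<leftarrow>xs. [:- x, 1:]) = count_list xs a"
proof (induction xs)
  case (Cons x xs)
  have nz: "(\<Prod>x\<leftarrow>xs. [:- x, 1:] :: 'k poly) \<noteq> 0" by (auto simp: prod_list_zero_iff)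
  have "Polynomial.order a [:- x, 1:] = (if x = a then 1 else 0)"
    using order_power_n_n[of a 1] by (auto simp: order_0I)
  then show ?case using Cons nz by (simp add: order_mult del: mult_pCons_left mult_pCons_right)
qed (simp add: order_0I)

lemma count_list_map: "distinct ws \<Longrightarrow> count_list (map f ws) a = card {w \<in> set ws. f w = a}"
proof -
  assume d: "distinct ws"
  have "count_list (map f ws) a = length (filter (\<lambda>w. f w = a) ws)"
    by (induction ws) auto
  also have "\<dots> = card (set (filter (\<lambda>w. f w = a) ws))" 
    using distinct_card[OF distinct_filter[OF d]] by metis
  finally show ?thesis by simp
qed

lemma geometric_sum_even_powers:
  fixes q :: "'k::field"
  shows "(q ^ 2 - 1) * (\<Sum>i<j. q ^ (2 * i)) = q ^ (2 * j) - 1"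
  using power_diff_1_eq[of "q ^ 2" j] by (simp add: power_mult)

text \<open>Both sides equal \<open>(q ^ (2 * j) - 1) / (q ^ 2 - 1)\<close>;
  \<open>q ^ 2 \<noteq> 1\<close> makes the denominator \<open>q - inverse q\<close>
  nonzero.\<close>

lemma shuffle_eigenvalue_eq:
  fixes q :: "'k::field"
  assumes "q \<noteq> 0" "q ^ 2 \<noteq> 1"
  shows "shuffle_eigenvalue q j = (\<Sum>i<j. q ^ (2 * i))"
proof -
  have d: "q - inverse q = (q ^ 2 - 1) / q" using assms by (simp add: field_simps power2_eq_square)
  have "q powi (int j - 1) * (q powi int j - q powi (- int j)) = (q ^ (2 * j) - 1) / q"
    using assms(1) by (simp add: power_int_diff power_int_minus field_simps power_mult power2_eq_square
        power_mult_distrib)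
  then have "shuffle_eigenvalue q j = ((q ^ (2 * j) - 1) / q) / ((q ^ 2 - 1) / q)"
    unfolding shuffle_eigenvalue_def q_int_def d times_divide_eq_right by (simp only:)
  also have "\<dots> = (\<Sum>i<j. q ^ (2 * i))"
    unfolding geometric_sum_even_powers[symmetric] using assms by simp
  finally show ?thesis .
qed

theorem mainTheorem8:
  fixes q :: "'k::field" and n :: nat
  assumes "n \<ge> 1"
    and "q \<noteq> 0"
    and "\<forall>m::nat. m \<ge> 1 \<longrightarrow> q ^ m \<noteq> 1"
  shows "(\<forall>c. operator_eigenvalue (hecke_algebra n q) (shuffle_operator n q) c
            \<longrightarrow> (\<exists>j\<in>{0..n}. c = shuffle_eigenvalue q j))
       \<and> (\<forall>j\<in>{0..n}. shuffle_eigenvalue q j = (\<Sum>i<j. q ^ (2 * i)))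
       \<and> (\<forall>j\<in>{0..n}.
            real (eigenvalue_multiplicity (hecke_algebra n q) (shuffle_operator n q)
                    (shuffle_eigenvalue q j))
              = fact n / fact j * (\<Sum>i=0..n - j. (- 1) ^ i / fact i)
          \<and> eigenvalue_multiplicity (hecke_algebra n q) (shuffle_operator n q)
                (shuffle_eigenvalue q j)
              = card {p. p permutes {1..n} \<and> card {i \<in> {1..n}. p i = i} = j})
       \<and> \<not> operator_eigenvalue (hecke_algebra n q) (shuffle_operator n q)
              (shuffle_eigenvalue q (n - 1))"
proof -
  interpret hecke n q by unfold_locales fact
  let ?lam = "\<lambda>j. \<Sum>i<j. q ^ (2 * i)"
  have q2: "q ^ 2 \<noteq> 1" using assms(3) by simp
  have lam: "shuffle_eigenvalue q j = ?lam j" for j by (rule shuffle_eigenvalue_eq[OF assms(2) q2])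
  \<comment> \<open>After multiplication by \<open>q ^ 2 - 1\<close> only powers of q are compared,
    so the argument holds in every characteristic.\<close>
  have lam_less: "?lam i \<noteq> ?lam j" if "i < j" for i j
  proof
    assume "?lam i = ?lam j"
    then have "q ^ (2 * i) = q ^ (2 * j)"
      using geometric_sum_even_powers[of q i] geometric_sum_even_powers[of q j] by simp
    moreover have "2 * i + 2 * (j - i) = 2 * j" using that by simp
    ultimately have "q ^ (2 * i) * q ^ (2 * (j - i)) = q ^ (2 * i)"
      by (metis power_add)
    then have "q ^ (2 * (j - i)) = 1" using assms(2) by simp
    then show False using assms(3) that by simp
  qed
  have lam_inj: "?lam i = ?lam j \<longleftrightarrow> i = j" for i j
    using lam_less[of i j] lam_less[of j i] by (metis linorder_neqE_nat)
  obtain bs M ws where M: "operator_matrix H Sh bs M" "M \<in> carrier_mat (length ws) (length ws)"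
    "upper_triangular M" "diag_mat M = map eig ws" and ws: "set ws = Perm" "distinct ws"
    by (rule triangular_operator_matrix)
  have cp: "char_poly M = (\<Prod>x\<leftarrow>map eig ws. [:- x, 1:])"
    using char_poly_upper_triangular[OF M(2,3)] M(4) by simp
  \<comment> \<open>Different numbers of single letters give different diagonal entries, so no two
    classes of words merge into one root.\<close>
  have mult: "Polynomial.order (?lam j) (char_poly M) = card {w \<in> Perm. card (singles w) = j}" for j
    unfolding cp order_prod_list_linear count_list_map[OF ws(2)] ws(1) lam_inj ..
  have ocp: "operator_char_poly H Sh = char_poly M"
    by (rule operator_char_poly_eq[OF Sh_closed Sh_add Sh_smult M(1)])
  have em: "eigenvalue_multiplicity (hecke_algebra n q) Sh (shuffle_eigenvalue q j)
      = card {w \<in> Perm. card (singles w) = j}" for j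
    unfolding eigenvalue_multiplicity_def hecke_algebra_eq ocp lam by (rule mult)
  have nz: "char_poly M \<noteq> 0" unfolding cp by (auto simp: prod_list_zero_iff)
  have eig_in: "\<exists>w\<in>Perm. c = eig w" if "operator_eigenvalue (hecke_algebra n q) Sh c" for c
  proof -
    have "poly (char_poly M) c = 0"
      using operator_eigenvalue_root[OF Sh_closed Sh_add Sh_smult M(1)] that by (simp add: hecke_algebra_eq)
    then have "count_list (map eig ws) c \<noteq> 0"
      using nz order_root[of "char_poly M" c] unfolding cp order_prod_list_linear by simp
    then show ?thesis using ws(1) by (auto simp: count_list_0_iff)
  qed
  have sn: "card (singles w) \<le> n" if "w \<in> Perm" for w
    using singles_subset[of w] that by (metis Perm_iff card_atLeastAtMost card_mono diff_Suc_1 finite_atLeastAtMost)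
  have cnt: "real (card {w \<in> Perm. card (singles w) = j}) = fact n / fact j * (\<Sum>i=0..n - j. (- 1) ^ i / fact i)"
    if "j \<le> n" for j by (rule card_words_singles[OF that])
  have not_eig: "\<not> operator_eigenvalue (hecke_algebra n q) Sh (shuffle_eigenvalue q (n - 1))"
  proof
    assume "operator_eigenvalue (hecke_algebra n q) Sh (shuffle_eigenvalue q (n - 1))"
    then obtain w where w: "w \<in> Perm" "?lam (n - 1) = eig w" using eig_in lam by metis
    then have "w \<in> {w \<in> Perm. card (singles w) = n - 1}" using lam_inj by simp
    \<comment> \<open>Here the alternating sum is 1 - 1; this includes n = 1, where the excluded
      value is 0.\<close>
    moreover have "card {w \<in> Perm. card (singles w) = n - 1} = 0"
    proof -
      have "n - (n - 1) = 1" using assms(1) by simp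
      then have "real (card {w \<in> Perm. card (singles w) = n - 1}) = 0" using cnt[of "n - 1"] by (simp add: One_nat_def)
      then show ?thesis by simp
    qed
    ultimately show False by auto
  qed
  have eigs: "\<exists>j\<in>{0..n}. c = shuffle_eigenvalue q j" if "operator_eigenvalue (hecke_algebra n q) Sh c" for c
    using eig_in[OF that] sn lam by fastforce
  have cards: "real (card {w \<in> Perm. card (singles w) = j}) = fact n / fact j * (\<Sum>i=0..n - j. (- 1) ^ i / fact i)
      \<and> card {w \<in> Perm. card (singles w) = j} = card {p. p permutes {1..n} \<and> card {i \<in> {1..n}. p i = i} = j}"
    if "j \<le> n" for j
  proof -
    have "real (card {w \<in> Perm. card (singles w) = j})
        = real (card {p. p permutes {1..n} \<and> card {i \<in> {1..n}. p i = i} = j})"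
      unfolding cnt[OF that] card_permutes_fixed_points[OF that] ..
    then show ?thesis using cnt[OF that] by (simp only: of_nat_eq_iff)
  qed
  show ?thesis unfolding em
    by (intro conjI allI ballI impI, erule eigs, rule lam, rule cards[THEN conjunct1], simp,
        rule cards[THEN conjunct2], simp, rule not_eig)
qed

end
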